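(* Consider the DEKI iteration (defined in the context) for the regularized problem $l(u)=\frac12\|z-\mathcal H(u)\|^2$, in the high dimensional regime $d_u\gg J$. Assume: (1) (Bounded Hessian) $\mathcal H\in C^2$ and there is $H>0$ with $\sup_u\big(\sum_{s=1}^{d_z}\|\nabla^2\mathcal H_s(u)\|_2^2\big)^{1/2}\le H$, where $\mathcal H_s$ is the $s$-th component of $\mathcal H$; (2) (Boundedness of $H_n$) there are $0<\gamma\le M$ such that $\gamma^2 I\preceq H_n^{\mathsf T}H_n\preceq M^2 I$ for all $n\in\mathbb N$; (3) ($L$-smoothness) there is $L>0$ with $\|\nabla l(u)-\nabla l(v)\|\le L\|u-v\|$ for all $u,v\in\mathbb R^{d_u}$; (4) (Polyak–Łojasiewicz condition) there is $c>0$ with $\|\nabla l(u)\|^2\ge c\,(l(u)-l_{\min})$ for all $u\in\mathbb R^{d_u}$, where $l_{\min}=\min_u l(u)$. Use standard Gaussian initialization of the ensemble, so that $\min_s P(s,s)>0$, where $P$ is the orthogonal projector onto $\mathrm{Im}(C_0^{uu})$. Choose the adaptive step sizes $$h_n=\theta\,\|C_n^{uu}\|^{-1},\qquad \tilde h_n=\mu\,\|C_n^{uu}\|^{-1},\qquad 0<\theta\le M^{-2},\quad 0<\mu\le L^{-1}.$$ Then there exist $n_0\in\mathbb N$ and constants $\beta\in(0,1)$ and $C_2$ ($n_0$, $\beta$, $C_2$ do not depend on $n$; they may depend on the problem data, the algorithm parameters and the initial ensemble) such that for all $n>n_0$ $$\mathbb E_{n_0}\,l(\overline u_n)-l_{\min}\le(1-\beta)^{\,n-n_0}\big(l(\overline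 u_{n_0})-l_{\min}+C_2\big).$$
   Context: Problem. $\mathcal G:\mathbb R^{d_u}\to\mathbb R^{d_y}$ is the forward map, $y\in\mathbb R^{d_y}$ the data, $\mathcal C_0\in\mathbb R^{d_u\times d_u}$ a positive definite matrix, $d_z=d_y+d_u$, $z=\begin{bmatrix}y\\0\end{bmatrix}\in\mathbb R^{d_z}$, $\mathcal H(u)=\begin{bmatrix}\mathcal G(u)\\ \mathcal C_0^{-1/2}u\end{bmatrix}$, and $l(u)=\frac12\|z-\mathcal H(u)\|^2=\frac12\|y-\mathcal G(u)\|^2+\frac12\|\mathcal C_0^{-1/2}u\|^2$. Vector norms are Euclidean, matrix norms are spectral norms, and $A\preceq B$ means $B-A$ is positive semidefinite. The regime $d_u\gg J$ is only a qualitative description; no quantitative relation is imposed. Ensemble quantities. The ensemble $\{u_n^{(j)}\}_{j=1}^J\subset\mathbb R^{d_u}$ ($J\ge2$) has mean $\overline u_n=\frac1J\sum_j u_n^{(j)}$, deviations $\tau_n^{(j)}=u_n^{(j)}-\overline u_n$, $\overline{\mathcal H(u_n)}=\frac1J\sum_j\mathcal H(u_n^{(j)})$, and covariances $C_n^{uu}=\frac1{J-1}\sum_j\tau_n^{(j)}\otimes\tau_n^{(j)}$, $C_n^{uz}=\frac1{J-1}\sum_j\tau_n^{(j)}\otimes(\mathcal H(u_n^{(j)})-\overline{\mathcal H(u_n)})$, $C_n^{zu}=(C_n^{uz})^{\mathsf T}$. Dropout ensemble. Fix $\lambda\in(0,1)$ ($1-\lambda$ is the dropout rate). At each step $n$ draw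 a mask $\rho_n\in\mathbb R^{d_u}$ with i.i.d. Bernoulli($\lambda$) components (value 1 with probability $\lambda$, else 0), independent across steps and of the initial ensemble; the same mask is used for all $j$. Set $\tilde\tau_n^{(j)}=\rho_n\circ\tau_n^{(j)}$ (componentwise product), $\tilde u_n^{(j)}=\overline u_n+\tilde\tau_n^{(j)}$, $\overline{\mathcal H(\tilde u_n)}=\frac1J\sum_j\mathcal H(\tilde u_n^{(j)})$, and $\tilde C_n^{uu}=\frac1{J-1}\sum_j\tilde\tau_n^{(j)}\otimes\tilde\tau_n^{(j)}$, $\tilde C_n^{uz}=\frac1{J-1}\sum_j\tilde\tau_n^{(j)}\otimes(\mathcal H(\tilde u_n^{(j)})-\overline{\mathcal H(\tilde u_n)})$, $\tilde C_n^{zz}=\frac1{J-1}\sum_j(\mathcal H(\tilde u_n^{(j)})-\overline{\mathcal H(\tilde u_n)})\otimes(\mathcal H(\tilde u_n^{(j)})-\overline{\mathcal H(\tilde u_n)})$. Linearized map. $H_n=\begin{bmatrix}G_n\\ \mathcal C_0^{-1/2}\end{bmatrix}$, where $G_n$ minimizes $\big\|C_n^{zu}(C_n^{uu})^\dagger-\begin{bmatrix}G\\ \mathcal C_0^{-1/2}\end{bmatrix}\big\|_{\rm F}^2$ over $G\in\mathbb R^{d_y\times d_u}$ with $\|G\|_2\le M_G$; here $M_G$ is a fixed constant and $\dagger$ the pseudo-inverse. DEKI iteration. With step sizes $\tilde h_n,h_n>0$, $$\overline u_{n+1}=\overline u_n+\tilde h_n\tilde C_n^{uz}(I+\tilde h_n\tilde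 C_n^{zz})^{-1}(z-\mathcal H(\overline u_n)),$$ $$\tau_{n+1}^{(j)}=\tau_n^{(j)}-h_nC_n^{uu}H_n^{\mathsf T}(I+h_nH_nC_n^{uu}H_n^{\mathsf T})^{-1}H_n\tau_n^{(j)},$$ and $u_{n+1}^{(j)}=\overline u_{n+1}+\tau_{n+1}^{(j)}$. Conditional expectation. $\mathbb E_n[\cdot]=\mathbb E[\cdot\mid\mathcal F_n]$, where $\mathcal F_n$ is the $\sigma$-algebra of the information up to the ensemble at step $n$ (initial ensemble and masks $\rho_0,\dots,\rho_{n-1}$), so $\rho_n$ is independent of $\mathcal F_n$. *)

theory Defs
  imports "HOL-Analysis.Analysis" "HOL-Probability.Probability"
begin

section \<open>Matrices\<close>

text \<open>The Frobenius norm of a matrix is the library's \<^term>\<open>norm\<close> on nested vectors.\<close>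

definition spec_norm :: "real^'n^'m \<Rightarrow> real" where
  "spec_norm A = onorm ((*v) A)"

definition psd :: "real^'n^'n \<Rightarrow> bool" where
  "psd A \<longleftrightarrow> transpose A = A \<and> (\<forall>x. 0 \<le> x \<bullet> (A *v x))"

definition pos_def :: "real^'n^'n \<Rightarrow> bool" where
  "pos_def A \<longleftrightarrow> transpose A = A \<and> (\<forall>x. x \<noteq> 0 \<longrightarrow> 0 < x \<bullet> (A *v x))"

definition loewner_le :: "real^'n^'n \<Rightarrow> real^'n^'n \<Rightarrow> bool" (infix "\<preceq>" 50) where
  "A \<preceq> B \<longleftrightarrow> psd (B - A)"

definition psd_sqrt :: "real^'n^'n \<Rightarrow> real^'n^'n" where
  "psd_sqrt A = (THE S. psd S \<and> S ** S = A)"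

definition inv_sqrt :: "real^'n^'n \<Rightarrow> real^'n^'n" where
  "inv_sqrt A = matrix_inv (psd_sqrt A)"

text \<open>Moore-Penrose pseudo-inverse, given by the four Penrose equations.\<close>

definition pinv :: "real^'n^'m \<Rightarrow> real^'m^'n" where
  "pinv A = (THE B. A ** B ** A = A \<and> B ** A ** B = B \<and>
                    transpose (A ** B) = A ** B \<and> transpose (B ** A) = B ** A)"

definition outer :: "real^'m \<Rightarrow> real^'n \<Rightarrow> real^'n^'m" where
  "outer x y = (\<chi> i k. x $ i * y $ k)"

text \<open>Block column with blocks \<open>a\<close> (top) and \<open>b\<close> (bottom); for \<open>'e = real\<close> it stacks vectors,
  for \<open>'e = real^'n\<close> it stacks matrices (which are vectors of rows).\<close>

definition stack :: "'e^'a \<Rightarrow> 'e^'b \<Rightarrow> 'e^('a + 'b)" where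
  "stack a b = (\<chi> s. case s of Inl i \<Rightarrow> a $ i | Inr k \<Rightarrow> b $ k)"

section \<open>Derivatives of scalar fields\<close>

definition gradient :: "(real^'n \<Rightarrow> real) \<Rightarrow> real^'n \<Rightarrow> real^'n" where
  "gradient f x = (THE D. GDERIV f x :> D)"

definition hessian :: "(real^'n \<Rightarrow> real) \<Rightarrow> real^'n \<Rightarrow> real^'n^'n" where
  "hessian f x = matrix (frechet_derivative (gradient f) (at x))"

definition C2_fun :: "(real^'n \<Rightarrow> real) \<Rightarrow> bool" where
  "C2_fun f \<longleftrightarrow> (\<forall>x. f differentiable (at x)) \<and> (\<forall>x. gradient f differentiable (at x)) \<and>
               continuous_on UNIV (hessian f)"

section \<open>Regularized least squares\<close>

definition reg_map :: "(real^'u \<Rightarrow> real^'y) \<Rightarrow> real^'u^'u \<Rightarrow> real^'u \<Rightarrow> real^('y + 'u)" where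
  "reg_map \<G> C0 v = stack (\<G> v) (inv_sqrt C0 *v v)"

definition reg_data :: "real^'y \<Rightarrow> real^('y + 'u::finite)" where
  "reg_data y = stack y 0"

definition loss :: "(real^'u \<Rightarrow> real^'y) \<Rightarrow> real^'u^'u \<Rightarrow> real^'y \<Rightarrow> real^'u \<Rightarrow> real" where
  "loss \<G> C0 y v = (1/2) * (norm (reg_data y - reg_map \<G> C0 v))\<^sup>2"

text \<open>For positive definite \<open>C0\<close> and continuous \<open>\<G>\<close> the loss is continuous and coercive, so this
  infimum is a minimum.\<close>

definition loss_min :: "(real^'u \<Rightarrow> real^'y) \<Rightarrow> real^'u^'u \<Rightarrow> real^'y \<Rightarrow> real" where
  "loss_min \<G> C0 y = (INF v. loss \<G> C0 y v)"

section \<open>Ensembles\<close>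

text \<open>An ensemble is a family \<open>e :: 'j \<Rightarrow> real^'u\<close>, where \<open>J = CARD('j)\<close>. In the following
  definitions \<open>\<H>\<close> is the (regularized) forward map.\<close>

definition ens_mean :: "('j::finite \<Rightarrow> real^'n) \<Rightarrow> real^'n" where
  "ens_mean e = (1 / real CARD('j)) *\<^sub>R (\<Sum>j\<in>UNIV. e j)"

definition dev :: "('j::finite \<Rightarrow> real^'n) \<Rightarrow> 'j \<Rightarrow> real^'n" where
  "dev e j = e j - ens_mean e"

definition scatter :: "('j::finite \<Rightarrow> real^'m) \<Rightarrow> ('j \<Rightarrow> real^'n) \<Rightarrow> real^'n^'m" where
  "scatter a b = (1 / (real CARD('j) - 1)) *\<^sub>R (\<Sum>j\<in>UNIV. outer (a j) (b j))"

definition C_uu :: "('j::finite \<Rightarrow> real^'u) \<Rightarrow> real^'u^'u" where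
  "C_uu e = scatter (dev e) (dev e)"

definition C_uz :: "(real^'u \<Rightarrow> real^'z) \<Rightarrow> ('j::finite \<Rightarrow> real^'u) \<Rightarrow> real^'z^'u" where
  "C_uz \<H> e = scatter (dev e) (dev (\<lambda>j. \<H> (e j)))"

definition C_zu :: "(real^'u \<Rightarrow> real^'z) \<Rightarrow> ('j::finite \<Rightarrow> real^'u) \<Rightarrow> real^'u^'z" where
  "C_zu \<H> e = transpose (C_uz \<H> e)"

text \<open>Dropout with mask \<open>r\<close>; multiplication of vectors is componentwise.\<close>

definition drop_dev :: "real^'u \<Rightarrow> ('j::finite \<Rightarrow> real^'u) \<Rightarrow> 'j \<Rightarrow> real^'u" where
  "drop_dev r e j = r * dev e j"

definition drop_ens :: "real^'u \<Rightarrow> ('j::finite \<Rightarrow> real^'u) \<Rightarrow> 'j \<Rightarrow> real^'u" where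
  "drop_ens r e j = ens_mean e + drop_dev r e j"

definition drop_C_uz :: "(real^'u \<Rightarrow> real^'z) \<Rightarrow> real^'u \<Rightarrow> ('j::finite \<Rightarrow> real^'u) \<Rightarrow> real^'z^'u" where
  "drop_C_uz \<H> r e = scatter (drop_dev r e) (dev (\<lambda>j. \<H> (drop_ens r e j)))"

definition drop_C_zz :: "(real^'u \<Rightarrow> real^'z) \<Rightarrow> real^'u \<Rightarrow> ('j::finite \<Rightarrow> real^'u) \<Rightarrow> real^'z^'z" where
  "drop_C_zz \<H> r e = scatter (dev (\<lambda>j. \<H> (drop_ens r e j))) (dev (\<lambda>j. \<H> (drop_ens r e j)))"

section \<open>The DEKI iteration\<close>

text \<open>\<open>A\<close> is the \<open>\<G>\<close>-block of the linearized map for the ensemble \<open>e\<close>: it minimizes the Frobenius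
  distance under the spectral norm bound \<open>MG\<close>. The minimizer is unique.\<close>

definition is_lin_block ::
  "(real^'u \<Rightarrow> real^'y) \<Rightarrow> real^'u^'u \<Rightarrow> real \<Rightarrow> ('j::finite \<Rightarrow> real^'u) \<Rightarrow> real^'u^'y \<Rightarrow> bool" where
  "is_lin_block \<G> C0 MG e A \<longleftrightarrow>
     is_arg_min (\<lambda>B. (norm (C_zu (reg_map \<G> C0) e ** pinv (C_uu e) - stack B (inv_sqrt C0)))\<^sup>2)
                (\<lambda>B. spec_norm B \<le> MG) A"

definition mean_step ::
  "(real^'u \<Rightarrow> real^'z) \<Rightarrow> real^'z \<Rightarrow> real \<Rightarrow> real^'u \<Rightarrow> ('j::finite \<Rightarrow> real^'u) \<Rightarrow> real^'u" where
  "mean_step \<H> z h r e = ens_mean e +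
     h *\<^sub>R ((drop_C_uz \<H> r e ** matrix_inv (mat 1 + h *\<^sub>R drop_C_zz \<H> r e)) *v (z - \<H> (ens_mean e)))"

definition dev_step ::
  "real^'u^'z \<Rightarrow> real \<Rightarrow> ('j::finite \<Rightarrow> real^'u) \<Rightarrow> 'j \<Rightarrow> real^'u" where
  "dev_step A h e j = dev e j -
     h *\<^sub>R ((C_uu e ** transpose A ** matrix_inv (mat 1 + h *\<^sub>R (A ** C_uu e ** transpose A)) ** A)
           *v dev e j)"

section \<open>Randomness\<close>

text \<open>Initial ensemble with i.i.d. standard Gaussian members and masks \<open>\<rho> n\<close> with i.i.d.
  Bernoulli(\<open>lam\<close>) components. All scalar components of \<open>u0\<close> and of all masks form a single
  independent family, so the masks are also independent across steps and of \<open>u0\<close>.\<close>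

definition deki_noise ::
  "'w measure \<Rightarrow> real \<Rightarrow> ('w \<Rightarrow> 'j::finite \<Rightarrow> real^'u) \<Rightarrow> (nat \<Rightarrow> 'w \<Rightarrow> real^'u) \<Rightarrow> bool" where
  "deki_noise Pr lam u0 \<rho> \<longleftrightarrow>
     prob_space Pr \<and>
     prob_space.indep_vars Pr (\<lambda>_. borel)
       (\<lambda>a \<omega>. case a of Inl (j, k) \<Rightarrow> u0 \<omega> j $ k | Inr (n, k) \<Rightarrow> \<rho> n \<omega> $ k) UNIV \<and>
     (\<forall>j k. distributed Pr lborel (\<lambda>\<omega>. u0 \<omega> j $ k) std_normal_density) \<and>
     (\<forall>n k. measure Pr {\<omega> \<in> space Pr. \<rho> n \<omega> $ k = 1} = lam \<and>
            measure Pr {\<omega> \<in> space Pr. \<rho> n \<omega> $ k = 0} = 1 - lam)"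

text \<open>The sigma-algebra generated by \<open>u0\<close> and \<open>\<rho> 0, \<dots>, \<rho> (n - 1)\<close>.\<close>

definition deki_filt ::
  "'w measure \<Rightarrow> ('w \<Rightarrow> 'j::finite \<Rightarrow> real^'u) \<Rightarrow> (nat \<Rightarrow> 'w \<Rightarrow> real^'u) \<Rightarrow> nat \<Rightarrow> 'w measure" where
  "deki_filt Pr u0 \<rho> n =
     vimage_algebra (space Pr) (\<lambda>\<omega>. (u0 \<omega>, \<lambda>k\<in>{..<n}. \<rho> k \<omega>))
       ((\<Pi>\<^sub>M j\<in>UNIV. borel) \<Otimes>\<^sub>M (\<Pi>\<^sub>M k\<in>{..<n}. borel))"

end

theory Submission
  imports Defs
begin

text \<open>Let \<open>T\<close> be the matrix whose columns are the deviations of the ensemble, divided by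
\<open>sqrt (J - 1)\<close>, so that the covariance is \<open>C = T T\<^sup>T\<close>. Three
effects combine: the covariance shrinks geometrically without becoming degenerate relative to
its norm, the mean performs an almost exact preconditioned gradient step, and averaging over the
dropout mask turns the preconditioner into one of full rank.

Covariance. With \<open>S = H\<^sup>T H\<close>, the next deviation matrix maps \<open>v\<close>
to \<open>T x\<close> where \<open>v = x + h T\<^sup>T S T x\<close>. As \<open>h = \<theta> /
\<parallel>C\<parallel>\<close>, the lower bound on \<open>S\<close> shrinks
\<open>\<parallel>C\<parallel>\<close> by the factor \<open>q = 1 / (1 + 2 \<theta>
\<gamma>\<^sup>2)\<close> (\<open>spec_norm_dev_step\<close>). Its transpose maps
\<open>w\<close> to \<open>T\<^sup>T x\<close> where \<open>w = x + h S C x\<close>, and the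
upper bound on \<open>S\<close> controls how fast the smallest directions can shrink
(\<open>dev_step_coercive\<close>). Together they keep \<open>sqrt \<parallel>C_n\<parallel> *
\<parallel>T_0\<^sup>T w\<parallel> \<le> \<kappa> * sqrt \<parallel>C_0\<parallel> *
\<parallel>T_n\<^sup>T w\<parallel>\<close> for all \<open>n\<close> with \<open>\<kappa> = 1 /
(1 - sqrt q)\<close>. Tested on coordinate vectors this bounds \<open>C_n(i,i) /
\<parallel>C_n\<parallel>\<close> from below by a multiple of \<open>C_0(i,i) /
\<parallel>C_0\<parallel>\<close>, which is positive almost surely because the initial members
are independent Gaussians.

Mean. The secant matrix of the dropout ensemble differs from Jacobian times deviations by
\<open>O(\<parallel>C_n\<parallel>)\<close>, by the Hessian bound. Hence the loss increases at
most by the factor \<open>1 + O(\<parallel>C_n\<parallel>)\<close> in each step, and by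
summability it stays bounded along the whole trajectory. The Jacobian need not be bounded
globally, but smoothness bounds it in terms of the loss, hence along the trajectory. So each
step decreases the loss by a fixed multiple of \<open>\<parallel>T'\<^sup>T g\<parallel>\<^sup>2
/ \<parallel>C_n\<parallel>\<close>, up to a geometrically decaying error, where
\<open>g\<close> is the gradient and \<open>T'\<close> the masked deviation matrix
(\<open>trajectory_bounds\<close>).

Dropout. A single mask leaves \<open>T'\<close> of low rank. But the mask is independent of the
past and \<open>E[r_i r_k] = \<lambda>\<^sup>2\<close> for \<open>i \<noteq> k\<close>,
\<open>E[r_i\<^sup>2] = \<lambda>\<close>, so the expected decrease contains \<open>\<lambda> (1
- \<lambda>) \<Sum>i. g_i\<^sup>2 C_n(i,i) / \<parallel>C_n\<parallel>\<close>, which by the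
first part dominates a multiple of \<open>\<parallel>g\<parallel>\<^sup>2\<close> and, by the
Polyak-Lojasiewicz inequality, of the excess loss. This gives a contraction with geometric
perturbation.

All constants depend on the initial ensemble only through finitely many bounds. On the event
where these hold with a given integer \<open>N\<close> the constants are deterministic, and
integrating over subsets of that event yields a scalar recursion
(\<open>localized_decay\<close>), from which the conditional statement follows
(\<open>conditional_decay\<close>). The events exhaust the probability space, and the constants
are chosen by the least admissible \<open>N\<close>. The additive constant absorbs the early
steps, in which the perturbation is large, so that \<open>n\<^sub>0 = 0\<close> is admissible.\<close>

section \<open>Spectral norms, resolvents and scaled deviations\<close>

declare transpose_matrix_vector [simp del]

lemma inner_transpose_mult:
  fixes A :: "real^'n^'m"
  shows "(transpose A *v x) \<bullet> y = x \<bullet> (A *v y)"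
  by (simp add: transpose_matrix_vector dot_lmul_matrix)

lemma inner_mult_transpose:
  fixes A :: "real^'n^'m"
  shows "y \<bullet> (transpose A *v x) = (A *v y) \<bullet> x"
  using inner_transpose_mult[of A x y] by (metis inner_commute)

lemma norm_mult_le_spec_norm:
  fixes A :: "real^'n^'m"
  shows "norm (A *v x) \<le> spec_norm A * norm x"
  unfolding spec_norm_def by (rule onorm) simp

lemma spec_norm_le:
  fixes A :: "real^'n^'m"
  assumes "\<And>x. norm (A *v x) \<le> b * norm x"
  shows "spec_norm A \<le> b"
  unfolding spec_norm_def by (rule onorm_le) (rule assms)

lemma spec_norm_nonneg: "0 \<le> spec_norm (A :: real^'n^'m)"
  unfolding spec_norm_def by (rule onorm_pos_le) simp

text \<open>Duality: test \<open>transpose A *v y\<close> against itself.\<close>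

lemma norm_mult_transfer:
  fixes A :: "real^'n^'m"
  assumes b: "0 \<le> b" and A: "\<And>x. norm (A *v x) \<le> b * norm x"
  shows "norm (transpose A *v y) \<le> b * norm y"
proof -
  let ?t = "transpose A *v y"
  have "norm ?t * norm ?t = ?t \<bullet> ?t" by (simp add: norm_eq_sqrt_inner)
  also have "\<dots> = y \<bullet> (A *v ?t)" by (simp add: inner_transpose_mult)
  also have "\<dots> \<le> norm y * norm (A *v ?t)" by (rule norm_cauchy_schwarz)
  also have "\<dots> \<le> norm y * (b * norm ?t)" using A by (intro mult_left_mono) auto
  finally have "norm ?t * norm ?t \<le> (b * norm y) * norm ?t" by (simp add: algebra_simps)
  then show ?thesis using b
    by (cases "norm ?t = 0") (auto simp: mult_le_cancel_right)
qed

lemma norm_gram: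
  fixes T :: "real^'j^'n"
  shows "(norm (transpose T *v w))\<^sup>2 = w \<bullet> ((T ** transpose T) *v w)"
  by (simp add: power2_norm_eq_inner inner_transpose_mult matrix_vector_mul_assoc)

lemma norm_transpose_le_gram:
  fixes T :: "real^'j^'n"
  shows "norm (transpose T *v w) \<le> sqrt (spec_norm (T ** transpose T)) * norm w"
proof (rule power2_le_imp_le)
  have "(norm (transpose T *v w))\<^sup>2 \<le> norm w * norm ((T ** transpose T) *v w)"
    unfolding norm_gram by (rule norm_cauchy_schwarz)
  also have "\<dots> \<le> norm w * (spec_norm (T ** transpose T) * norm w)"
    by (intro mult_left_mono norm_mult_le_spec_norm) auto
  finally show "(norm (transpose T *v w))\<^sup>2 \<le> (sqrt (spec_norm (T ** transpose T)) * norm w)\<^sup>2"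
    by (simp add: power_mult_distrib spec_norm_nonneg power2_eq_square algebra_simps)
qed (simp add: spec_norm_nonneg)

lemma norm_le_gram:
  fixes T :: "real^'j^'n"
  shows "norm (T *v v) \<le> sqrt (spec_norm (T ** transpose T)) * norm v"
  using norm_mult_transfer[OF _ norm_transpose_le_gram, of T v]
  by (simp add: spec_norm_nonneg)

text \<open>Together with \<open>norm_le_gram\<close> this says \<open>\<parallel>T T\<^sup>T\<parallel> =
\<parallel>T\<parallel>\<^sup>2\<close>; bounds on covariances are always obtained from bounds
on deviation matrices.\<close>

lemma gram_spec_norm_le:
  fixes T :: "real^'j^'n"
  assumes b: "0 \<le> b" and T: "\<And>v. norm (T *v v) \<le> b * norm v"
  shows "spec_norm (T ** transpose T) \<le> b\<^sup>2"
proof (rule spec_norm_le)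
  fix x
  have "norm ((T ** transpose T) *v x) = norm (T *v (transpose T *v x))"
    by (simp add: matrix_vector_mul_assoc)
  also have "\<dots> \<le> b * norm (transpose T *v x)" by (rule T)
  also have "\<dots> \<le> b * (b * norm x)"
    using b by (intro mult_left_mono norm_mult_transfer T) auto
  finally show "norm ((T ** transpose T) *v x) \<le> b\<^sup>2 * norm x"
    by (simp add: power2_eq_square algebra_simps)
qed

lemma resolvent_inverse:
  fixes Y :: "real^'j^'n"
  assumes "0 \<le> h"
  shows "invertible (mat 1 + h *\<^sub>R (Y ** transpose Y))"
proof -
  have "x = 0" if "(mat 1 + h *\<^sub>R (Y ** transpose Y)) *v x = 0" for x
  proof -
    have "x + h *\<^sub>R ((Y ** transpose Y) *v x) = 0"
      using that by (simp add: matrix_vector_mult_add_rdistrib scaleR_matrix_vector_assoc)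
    then have "x \<bullet> x + h * (norm (transpose Y *v x))\<^sup>2 = 0"
      unfolding norm_gram by (metis inner_add_right inner_scaleR_right inner_zero_right)
    then show ?thesis using assms
      by (metis add_nonneg_eq_0_iff inner_eq_zero_iff inner_ge_zero mult_nonneg_nonneg zero_le_power2)
  qed
  then have "inj ((*v) (mat 1 + h *\<^sub>R (Y ** transpose Y)))"
    by (simp add: linear_injective_0)
  then show ?thesis
    by (metis invertible_left_inverse matrix_left_invertible_injective)
qed

lemma matrix_inv_right:
  fixes A :: "real^'n^'n"
  assumes "invertible A"
  shows "A ** matrix_inv A = mat 1" "matrix_inv A ** A = mat 1"
  using someI_ex[OF assms[unfolded invertible_def]] unfolding matrix_inv_def by auto

text \<open>All inverses in the iteration are handled through the linear equation that they solve.\<close>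

lemma resolvent_apply:
  fixes Y :: "real^'j^'n" and b :: "real^'n"
  assumes "0 \<le> h"
  defines "x \<equiv> matrix_inv (mat 1 + h *\<^sub>R (Y ** transpose Y)) *v b"
  shows "x + h *\<^sub>R (Y *v (transpose Y *v x)) = b"
proof -
  have "(mat 1 + h *\<^sub>R (Y ** transpose Y)) *v x = b"
    using matrix_inv_right(1)[OF resolvent_inverse[OF assms(1), of Y]]
    by (simp add: x_def matrix_vector_mul_assoc)
  then show ?thesis
    by (simp add: matrix_vector_mult_add_rdistrib scaleR_matrix_vector_assoc matrix_vector_mul_assoc)
qed

text \<open>The normalization is chosen such that sample covariances become products of two such matrices.\<close>

definition cols :: "('j::finite \<Rightarrow> real^'n) \<Rightarrow> real^'j^'n" where
  "cols a = (\<chi> i j. a j $ i / sqrt (real CARD('j) - 1))"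

lemma scatter_cols:
  fixes a :: "'j::finite \<Rightarrow> real^'m" and b :: "'j \<Rightarrow> real^'n"
  assumes "CARD('j) \<ge> 2"
  shows "scatter a b = cols a ** transpose (cols b)"
proof -
  have "0 < real CARD('j) - 1" using assms by simp
  then have *: "x / sqrt (real CARD('j) - 1) * (y / sqrt (real CARD('j) - 1)) = x * y / (real CARD('j) - 1)" for x y
    by simp
  show ?thesis
    by (simp add: vec_eq_iff scatter_def cols_def outer_def matrix_matrix_mult_def transpose_def *
        sum_divide_distrib sum_distrib_left)
qed

lemma C_uu_gram:
  fixes e :: "'j::finite \<Rightarrow> real^'u"
  assumes "CARD('j) \<ge> 2"
  shows "C_uu e = cols (dev e) ** transpose (cols (dev e))"
  unfolding C_uu_def by (rule scatter_cols[OF assms])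

lemma cols_mult: "cols (\<lambda>j. B *v a j) = B ** cols a"
  by (simp add: vec_eq_iff cols_def matrix_vector_mult_def matrix_matrix_mult_def sum_divide_distrib)

lemma norm_gram':
  fixes A :: "real^'n^'m"
  shows "x \<bullet> ((transpose A ** A) *v x) = (norm (A *v x))\<^sup>2"
  using norm_gram[of "transpose A" x] by simp

lemma loewner_ge_norm:
  fixes A :: "real^'n^'m"
  assumes "g\<^sup>2 *\<^sub>R mat 1 \<preceq> transpose A ** A"
  shows "g\<^sup>2 * (norm x)\<^sup>2 \<le> (norm (A *v x))\<^sup>2"
proof -
  have "0 \<le> x \<bullet> ((transpose A ** A - g\<^sup>2 *\<^sub>R mat 1) *v x)"
    using assms by (simp add: loewner_le_def psd_def)
  also have "\<dots> = (norm (A *v x))\<^sup>2 - g\<^sup>2 * (norm x)\<^sup>2"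
    by (simp add: matrix_vector_mult_diff_rdistrib inner_diff_right norm_gram'
        scaleR_matrix_vector_assoc[symmetric] power2_norm_eq_inner[of x])
  finally show ?thesis by simp
qed

lemma loewner_le_norm:
  fixes A :: "real^'n^'m"
  assumes "transpose A ** A \<preceq> g\<^sup>2 *\<^sub>R mat 1" "0 \<le> g"
  shows "norm (A *v x) \<le> g * norm x"
proof (rule power2_le_imp_le)
  have "0 \<le> x \<bullet> ((g\<^sup>2 *\<^sub>R mat 1 - transpose A ** A) *v x)"
    using assms by (simp add: loewner_le_def psd_def)
  also have "\<dots> = g\<^sup>2 * (norm x)\<^sup>2 - (norm (A *v x))\<^sup>2"
    by (simp add: matrix_vector_mult_diff_rdistrib inner_diff_right norm_gram'
        scaleR_matrix_vector_assoc[symmetric] power2_norm_eq_inner[of x])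
  finally show "(norm (A *v x))\<^sup>2 \<le> (g * norm x)\<^sup>2" by (simp add: power_mult_distrib)
qed (use assms in simp)

section \<open>Covariance decay under the deviation step\<close>

lemma resolvent_transpose_apply:
  fixes Y :: "real^'j^'n" and b :: "real^'n"
  assumes "0 \<le> h"
  defines "x \<equiv> transpose (matrix_inv (mat 1 + h *\<^sub>R (Y ** transpose Y))) *v b"
  shows "x + h *\<^sub>R (Y *v (transpose Y *v x)) = b"
proof -
  let ?R = "mat 1 + h *\<^sub>R (Y ** transpose Y)"
  have sym: "transpose ?R = ?R"
    by (simp add: vec_eq_iff transpose_def mat_def matrix_matrix_mult_def mult.commute)
  have "transpose (matrix_inv ?R ** ?R) = mat 1"
    using matrix_inv_right(2)[OF resolvent_inverse[OF assms(1), of Y]] by (simp add: transpose_mat)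
  then have "?R ** transpose (matrix_inv ?R) = mat 1"
    unfolding matrix_transpose_mul sym .
  then have "?R *v x = b"
    by (simp add: x_def matrix_vector_mul_assoc)
  then show ?thesis
    by (simp add: matrix_vector_mult_add_rdistrib scaleR_matrix_vector_assoc matrix_vector_mul_assoc)
qed

lemma sum_dev: "(\<Sum>j\<in>UNIV. dev e j) = 0"
  for e :: "'j::finite \<Rightarrow> real^'n"
  by (simp add: dev_def sum_subtractf ens_mean_def sum_constant_scaleR del: sum_constant)

lemma dev_shift_centered:
  fixes f :: "'j::finite \<Rightarrow> real^'n"
  assumes "(\<Sum>j\<in>UNIV. f j) = 0"
  shows "dev (\<lambda>j. m + f j) = f" "ens_mean (\<lambda>j. m + f j) = m"
proof -
  show m: "ens_mean (\<lambda>j. m + f j) = m"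
    by (simp add: ens_mean_def sum.distrib assms sum_constant_scaleR del: sum_constant)
  show "dev (\<lambda>j. m + f j) = f"
    by (rule ext) (simp add: dev_def m)
qed

lemma sum_dev_step: "(\<Sum>j\<in>UNIV. dev_step A h e j) = 0"
  for e :: "'j::finite \<Rightarrow> real^'n"
proof -
  have "(\<Sum>j\<in>UNIV. B *v dev e j) = 0" for B :: "real^'n^'n"
    using linear_sum[OF matrix_vector_mul_linear, of B "dev e" UNIV] by (simp add: sum_dev)
  then show ?thesis
    by (simp add: dev_step_def sum_subtractf sum_dev scaleR_right.sum[symmetric])
qed

lemma matrix_mult_diff_left: "(A - B) ** C = A ** C - B ** C"
  for A B :: "real^'n^'m"
  by (simp add: vec_eq_iff matrix_matrix_mult_def algebra_simps sum_subtractf)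

lemma cols_dev_step:
  fixes A :: "real^'n^'m" and h :: real and e :: "'j::finite \<Rightarrow> real^'n"
  assumes J: "CARD('j) \<ge> 2"
  defines "T \<equiv> cols (dev e)"
  defines "Y \<equiv> A ** T"
  defines "N \<equiv> matrix_inv (mat 1 + h *\<^sub>R (Y ** transpose Y))"
  shows "cols (dev_step A h e) = T - h *\<^sub>R (T ** (transpose Y ** (N ** Y)))"
proof -
  have "A ** C_uu e ** transpose A = Y ** transpose Y"
    by (simp add: Y_def T_def C_uu_gram[OF J] matrix_transpose_mul matrix_mul_assoc)
  then have "dev_step A h e = (\<lambda>j. (mat 1 - h *\<^sub>R (C_uu e ** transpose A ** N ** A)) *v dev e j)"
    by (intro ext) (simp add: dev_step_def N_def matrix_vector_mult_diff_rdistrib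
        scaleR_matrix_vector_assoc[symmetric])
  then have "cols (dev_step A h e) = (mat 1 - h *\<^sub>R (C_uu e ** transpose A ** N ** A)) ** T"
    by (simp add: cols_mult T_def)
  also have "\<dots> = T - h *\<^sub>R (C_uu e ** transpose A ** N ** A ** T)"
    by (simp add: matrix_mult_diff_left scalar_matrix_assoc[symmetric])
  finally show ?thesis
    by (simp add: C_uu_gram[OF J] Y_def T_def matrix_transpose_mul matrix_mul_assoc)
qed

text \<open>Pushing the resolvent through \<open>A T\<close> replaces the inverse on observation space by
one on the space of ensemble coefficients: the new deviation matrix is \<open>T R\<close> with
\<open>R\<close> the inverse of \<open>I + h (A T)\<^sup>T A T\<close>.\<close>

lemma dev_step_factor:
  fixes A :: "real^'n^'m" and e :: "'j::finite \<Rightarrow> real^'n"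
  assumes J: "CARD('j) \<ge> 2" and h: "0 \<le> h"
  defines "T \<equiv> cols (dev e)"
  obtains q where "cols (dev_step A h e) *v v = T *v q"
    "v = q + h *\<^sub>R (transpose (A ** T) *v ((A ** T) *v q))"
proof -
  define Y where "Y = A ** T"
  define x where "x = matrix_inv (mat 1 + h *\<^sub>R (Y ** transpose Y)) *v (Y *v v)"
  define q where "q = v - h *\<^sub>R (transpose Y *v x)"
  have x: "x + h *\<^sub>R (Y *v (transpose Y *v x)) = Y *v v"
    unfolding x_def by (rule resolvent_apply[OF h])
  have "Y *v q = x"
    using x by (simp add: q_def matrix_vector_mult_diff_distrib matrix_vector_mult_scaleR algebra_simps)
  then have "v = q + h *\<^sub>R (transpose Y *v (Y *v q))"
    by (simp add: q_def)
  moreover have "cols (dev_step A h e) *v v = T *v q"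
    unfolding cols_dev_step[OF J] T_def[symmetric] Y_def[symmetric]
    by (simp add: q_def x_def matrix_vector_mult_diff_rdistrib matrix_vector_mult_diff_distrib
        matrix_vector_mult_scaleR scaleR_matrix_vector_assoc[symmetric] matrix_vector_mul_assoc[symmetric])
  ultimately show ?thesis using that unfolding Y_def by blast
qed

text \<open>The same identity on the state space. It expresses \<open>w\<close>, tested against the new
deviations, through the \<open>x\<close> that is tested against the old ones, and so transports
lower bounds on the covariance.\<close>

lemma dev_step_transpose_factor:
  fixes A :: "real^'n^'m" and e :: "'j::finite \<Rightarrow> real^'n"
  assumes J: "CARD('j) \<ge> 2" and h: "0 \<le> h"
  defines "T \<equiv> cols (dev e)"
  obtains x where "transpose (cols (dev_step A h e)) *v w = transpose T *v x"
    "w = x + h *\<^sub>R (transpose A *v (A *v (T *v (transpose T *v x))))"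
proof -
  define Y where "Y = A ** T"
  define z where "z = transpose (matrix_inv (mat 1 + h *\<^sub>R (Y ** transpose Y))) *v (Y *v (transpose T *v w))"
  define x where "x = w - h *\<^sub>R (transpose A *v z)"
  have z: "z + h *\<^sub>R (Y *v (transpose Y *v z)) = Y *v (transpose T *v w)"
    unfolding z_def by (rule resolvent_transpose_apply[OF h])
  have "A *v (T *v (transpose T *v x)) = z"
    using z by (simp add: x_def Y_def matrix_vector_mult_diff_distrib matrix_vector_mult_scaleR algebra_simps
        matrix_transpose_mul matrix_vector_mul_assoc[symmetric])
  then have "w = x + h *\<^sub>R (transpose A *v (A *v (T *v (transpose T *v x))))"
    by (simp add: x_def)
  moreover have sc: "transpose (c *\<^sub>R B) = c *\<^sub>R transpose B" "transpose (B - D) = transpose B - transpose D"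
    for c and B D :: "real^'j^'n"
    by (simp_all add: vec_eq_iff transpose_def)
  have "transpose (cols (dev_step A h e)) *v w = transpose T *v x"
    unfolding cols_dev_step[OF J] T_def[symmetric] Y_def[symmetric] sc
    by (simp add: x_def z_def matrix_transpose_mul matrix_vector_mult_diff_rdistrib matrix_vector_mult_diff_distrib
        matrix_vector_mult_scaleR scaleR_matrix_vector_assoc[symmetric] matrix_vector_mul_assoc[symmetric])
      (simp add: Y_def matrix_transpose_mul matrix_vector_mul_assoc[symmetric])
  ultimately show ?thesis using that by blast
qed

text \<open>Squaring \<open>v = q + h (A T)\<^sup>T A T q\<close>, the cross term is \<open>2 h \<parallel>A
T q\<parallel>\<^sup>2\<close>, which the lower bound on \<open>A\<close> turns into \<open>2 h
g\<^sup>2 \<parallel>T q\<parallel>\<^sup>2\<close>; with \<open>h = \<theta> /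
\<parallel>C\<parallel>\<close> this is a fixed multiple of \<open>\<parallel>T
q\<parallel>\<^sup>2 / \<parallel>C\<parallel>\<close>.\<close>

lemma spec_norm_dev_step:
  fixes A :: "real^'n^'m" and e e' :: "'j::finite \<Rightarrow> real^'n"
  assumes J: "CARD('j) \<ge> 2" and dev: "dev e' = dev_step A h e"
    and A: "\<And>x. g\<^sup>2 * (norm x)\<^sup>2 \<le> (norm (A *v x))\<^sup>2"
    and pos: "0 < spec_norm (C_uu e)" and h: "h = \<theta> * inverse (spec_norm (C_uu e))" and \<theta>: "0 < \<theta>"
  shows "spec_norm (C_uu e') \<le> spec_norm (C_uu e) / (1 + 2 * \<theta> * g\<^sup>2)"
proof -
  define T where "T = cols (dev e)"
  define s where "s = spec_norm (C_uu e)"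
  have s: "0 < s" "s = spec_norm (T ** transpose T)" "h = \<theta> / s"
    using pos h by (simp_all add: s_def T_def C_uu_gram[OF J] divide_inverse)
  have h0: "0 \<le> h" using s \<theta> by simp
  let ?k = "1 + 2 * \<theta> * g\<^sup>2"
  have k: "0 < ?k" using \<theta> by (simp add: add_pos_nonneg)
  define b where "b = sqrt (s / ?k)"
  have b: "0 \<le> b" "b\<^sup>2 = s / ?k" using s(1) k by (simp_all add: b_def)
  have "norm (cols (dev e') *v v) \<le> b * norm v" for v
  proof -
    obtain q where q: "cols (dev e') *v v = T *v q"
      "v = q + h *\<^sub>R (transpose (A ** T) *v ((A ** T) *v q))"
      unfolding T_def dev by (rule dev_step_factor[OF J h0])
    have Tq: "(norm (T *v q))\<^sup>2 \<le> s * (norm q)\<^sup>2"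
      using power_mono[OF norm_le_gram[of T q], of 2] s by (simp add: power_mult_distrib spec_norm_nonneg)
    define y where "y = transpose (A ** T) *v ((A ** T) *v q)"
    have "y \<bullet> q = (norm ((A ** T) *v q))\<^sup>2"
      by (simp add: y_def inner_transpose_mult power2_norm_eq_inner)
    then have "(norm v)\<^sup>2 = (norm q)\<^sup>2 + 2 * h * (norm ((A ** T) *v q))\<^sup>2 + (norm (h *\<^sub>R y))\<^sup>2"
      unfolding q(2) y_def[symmetric] power2_norm_eq_inner
      by (simp add: inner_add_left inner_add_right inner_commute)
    then have "(norm q)\<^sup>2 + 2 * h * (norm ((A ** T) *v q))\<^sup>2 \<le> (norm v)\<^sup>2" by simp
    moreover have "2 * h * (g\<^sup>2 * (norm (T *v q))\<^sup>2) \<le> 2 * h * (norm ((A ** T) *v q))\<^sup>2"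
      using A[of "T *v q"] h0 by (intro mult_left_mono) (auto simp: matrix_vector_mul_assoc)
    ultimately have 1: "(norm q)\<^sup>2 + 2 * h * (g\<^sup>2 * (norm (T *v q))\<^sup>2) \<le> (norm v)\<^sup>2" by simp
    have "(norm (T *v q))\<^sup>2 * ?k / s = (norm (T *v q))\<^sup>2 / s + 2 * h * (g\<^sup>2 * (norm (T *v q))\<^sup>2)"
      using s by (simp add: field_simps)
    also have "(norm (T *v q))\<^sup>2 / s \<le> (norm q)\<^sup>2"
      using Tq s(1) by (simp add: field_simps)
    finally have "(norm (T *v q))\<^sup>2 * ?k / s \<le> (norm v)\<^sup>2" using 1 by simp
    then have "(norm (T *v q))\<^sup>2 \<le> s / ?k * (norm v)\<^sup>2"
      using s(1) k by (simp add: field_simps)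
    then have "(norm (T *v q))\<^sup>2 \<le> (b * norm v)\<^sup>2"
      by (simp only: power_mult_distrib b)
    then show ?thesis unfolding q(1)
      using b(1) by (rule power2_le_imp_le[OF _ mult_nonneg_nonneg]) simp
  qed
  then have "spec_norm (C_uu e') \<le> b\<^sup>2"
    unfolding C_uu_gram[OF J] by (rule gram_spec_norm_le[OF b(1)])
  then show ?thesis by (simp only: b s_def)
qed

text \<open>A lower bound for the covariance, stated without an inverse: \<open>\<parallel>T\<^sup>T
w\<parallel>\<close> dominates a fixed seminorm \<open>\<parallel>P w\<parallel>\<close>. The
constant grows only additively, since \<open>w\<close> and \<open>x\<close> differ by \<open>h
A\<^sup>T A C x\<close> and \<open>\<parallel>C x\<parallel> \<le> \<parallel>T\<parallel>
\<parallel>T\<^sup>T x\<parallel>\<close>. In the application \<open>P\<close> is the transposed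
initial deviation matrix.\<close>

lemma dev_step_coercive:
  fixes A :: "real^'n^'m" and e e' :: "'j::finite \<Rightarrow> real^'n" and P :: "real^'n^'k"
  assumes J: "CARD('j) \<ge> 2" and dev: "dev e' = dev_step A h e" and h: "0 \<le> h"
    and A: "\<And>x. norm (A *v x) \<le> M * norm x" and M: "0 \<le> M"
    and P: "\<And>x. norm (P *v x) \<le> p * norm x" and p: "0 \<le> p"
    and k: "\<And>w. norm (P *v w) \<le> k * norm (transpose (cols (dev e)) *v w)"
  shows "norm (P *v w) \<le> (k + h * M\<^sup>2 * p * sqrt (spec_norm (C_uu e))) * norm (transpose (cols (dev e')) *v w)"
proof -
  define T where "T = cols (dev e)"
  define s where "s = sqrt (spec_norm (C_uu e))"
  obtain x where x: "transpose (cols (dev e')) *v w = transpose T *v x"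
    "w = x + h *\<^sub>R (transpose A *v (A *v (T *v (transpose T *v x))))"
    unfolding T_def dev by (rule dev_step_transpose_factor[OF J h])
  let ?y = "transpose T *v x"
  have At: "norm (transpose A *v z) \<le> M * norm z" for z
    by (rule norm_mult_transfer[OF M A])
  have "norm (P *v (transpose A *v (A *v (T *v ?y)))) \<le> p * (M * (M * (s * norm ?y)))"
    using norm_le_gram[of T ?y] p M
    by (intro order.trans[OF P] mult_left_mono order.trans[OF At] order.trans[OF A])
      (auto simp: s_def C_uu_gram[OF J] T_def)
  then have "h * norm (P *v (transpose A *v (A *v (T *v ?y)))) \<le> h * (p * (M * (M * (s * norm ?y))))"
    by (rule mult_left_mono[OF _ h])
  moreover have "norm (P *v w) \<le> norm (P *v x) + h * norm (P *v (transpose A *v (A *v (T *v ?y))))"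
    by (subst x(2)) (use h in \<open>simp add: matrix_vector_right_distrib matrix_vector_mult_scaleR norm_triangle_le\<close>)
  ultimately have "norm (P *v w) \<le> k * norm ?y + h * (p * (M * (M * (s * norm ?y))))"
    using k[of x] unfolding T_def by linarith
  then show ?thesis unfolding x(1) s_def by (simp add: power2_eq_square algebra_simps)
qed

section \<open>Smooth least squares\<close>

lemma has_derivative_gradient:
  fixes f :: "real^'n \<Rightarrow> real"
  assumes "f differentiable (at x)"
  shows "(f has_derivative (\<lambda>h. h \<bullet> gradient f x)) (at x)"
proof -
  obtain f' where f': "(f has_derivative f') (at x)"
    using assms by (auto simp: differentiable_def)
  then have "f' = (\<lambda>h. h \<bullet> adjoint f' 1)"
    by (auto simp: adjoint_works has_derivative_linear)
  with f' have D: "GDERIV f x :> adjoint f' 1"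
    by (simp add: gderiv_def)
  then have "gradient f x = adjoint f' 1"
    unfolding gradient_def
  proof (rule the_equality)
    fix D' assume "GDERIV f x :> D'"
    with D have "(\<lambda>h. h \<bullet> adjoint f' 1) = (\<lambda>h. h \<bullet> D')"
      unfolding gderiv_def by (rule has_derivative_unique)
    then have "\<forall>h. h \<bullet> D' = h \<bullet> adjoint f' 1" by (simp add: fun_eq_iff)
    then show "D' = adjoint f' 1" by (simp only: vector_eq_ldot)
  qed
  with D show ?thesis by (simp add: gderiv_def)
qed

lemma gradient_eqI:
  fixes f :: "real^'n \<Rightarrow> real"
  assumes f: "(f has_derivative (\<lambda>h. h \<bullet> D)) (at x)"
  shows "gradient f x = D"
proof -
  have "f differentiable (at x)" using f by (auto simp: differentiable_def)
  from has_derivative_unique[OF has_derivative_gradient[OF this] f]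
  have "\<forall>h. h \<bullet> gradient f x = h \<bullet> D" by (simp add: fun_eq_iff)
  then show ?thesis by (simp only: vector_eq_ldot)
qed

text \<open>Along the segment from \<open>x\<close> to \<open>x + d\<close> the difference of both sides is
monotone, by the Lipschitz bound.\<close>

lemma descent_inequality:
  fixes f :: "'a::real_inner \<Rightarrow> real"
  assumes f: "\<And>x. (f has_derivative (\<lambda>h. h \<bullet> g x)) (at x)"
    and L: "\<And>x y. norm (g x - g y) \<le> L * norm (x - y)"
  shows "f (x + d) \<le> f x + g x \<bullet> d + L / 2 * (norm d)\<^sup>2"
proof -
  \<comment> \<open>The difference of both sides along the segment, parametrized by \<open>t\<close>.\<close>
  define \<phi> where "\<phi> t = f (x + t *\<^sub>R d) - t * (g x \<bullet> d) - L / 2 * (norm d)\<^sup>2 * t\<^sup>2" for t :: real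
  have "\<phi> 1 \<le> \<phi> 0"
  proof (rule DERIV_nonpos_imp_nonincreasing, simp)
    fix t :: real assume t: "0 \<le> t" "t \<le> 1"
    have "((\<lambda>t. f (x + t *\<^sub>R d)) has_derivative (\<lambda>s. (s *\<^sub>R d) \<bullet> g (x + t *\<^sub>R d))) (at t)"
      by (rule has_derivative_compose[where f = "\<lambda>t. x + t *\<^sub>R d" and g = f, OF _ f])
        (auto intro!: derivative_eq_intros)
    then have "((\<lambda>t. f (x + t *\<^sub>R d)) has_field_derivative (d \<bullet> g (x + t *\<^sub>R d))) (at t)"
      by (simp add: has_field_derivative_def mult.commute[of _ "d \<bullet> _"])
    then have "(\<phi> has_field_derivative (d \<bullet> g (x + t *\<^sub>R d) - g x \<bullet> d - L * (norm d)\<^sup>2 * t)) (at t)"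
      unfolding \<phi>_def by (auto intro!: derivative_eq_intros)
    moreover have "d \<bullet> g (x + t *\<^sub>R d) - g x \<bullet> d \<le> L * (norm d)\<^sup>2 * t"
    proof -
      have "d \<bullet> g (x + t *\<^sub>R d) - g x \<bullet> d = d \<bullet> (g (x + t *\<^sub>R d) - g x)"
        by (simp add: inner_diff_right inner_commute)
      also have "\<dots> \<le> norm d * norm (g (x + t *\<^sub>R d) - g x)" by (rule norm_cauchy_schwarz)
      also have "\<dots> \<le> norm d * (L * norm (t *\<^sub>R d))"
        using L[of "x + t *\<^sub>R d" x] by (intro mult_left_mono) auto
      finally show ?thesis using t by (simp add: power2_eq_square algebra_simps)
    qed
    ultimately show "\<exists>y. (\<phi> has_field_derivative y) (at t) \<and> y \<le> 0" by force
  qed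
  then show ?thesis by (simp add: \<phi>_def)
qed

lemma gradient_lipschitz:
  fixes f :: "real^'n \<Rightarrow> real"
  assumes d: "\<And>x. gradient f differentiable (at x)" and H: "\<And>x. spec_norm (hessian f x) \<le> K"
  shows "norm (gradient f x - gradient f y) \<le> K * norm (x - y)"
proof (rule differentiable_bound[where S = UNIV and f' = "\<lambda>x. frechet_derivative (gradient f) (at x)"])
  fix x
  have *: "(gradient f has_derivative frechet_derivative (gradient f) (at x)) (at x)"
    using d[of x] by (simp add: frechet_derivative_works)
  then show "(gradient f has_derivative frechet_derivative (gradient f) (at x)) (at x within UNIV)" by simp
  show "onorm (frechet_derivative (gradient f) (at x)) \<le> K"
    using H[of x] by (simp add: spec_norm_def hessian_def matrix_vector_mul(2)[OF has_derivative_linear[OF *]])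
qed auto

text \<open>Both signs come from the descent inequality, applied to \<open>f\<close> and to \<open>-
f\<close>.\<close>

lemma quadratic_taylor_bound:
  fixes f :: "real^'n \<Rightarrow> real"
  assumes C2: "C2_fun f" and H: "\<And>x. spec_norm (hessian f x) \<le> K"
  shows "\<bar>f (x + d) - f x - gradient f x \<bullet> d\<bar> \<le> K / 2 * (norm d)\<^sup>2"
proof -
  have f: "(f has_derivative (\<lambda>h. h \<bullet> gradient f x)) (at x)" for x
    using C2 by (intro has_derivative_gradient) (simp add: C2_fun_def)
  have lip: "norm (gradient f x - gradient f y) \<le> K * norm (x - y)" for x y
    using C2 H by (intro gradient_lipschitz) (simp_all add: C2_fun_def)
  have "((\<lambda>x. - f x) has_derivative (\<lambda>h. h \<bullet> - gradient f x)) (at x)" for x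
    using has_derivative_minus[OF f] by (simp add: inner_minus_right)
  moreover have "norm (- gradient f x - - gradient f y) \<le> K * norm (x - y)" for x y
    using lip[of y x] by (simp add: norm_minus_commute)
  ultimately have "- f (x + d) \<le> - f x + - gradient f x \<bullet> d + K / 2 * (norm d)\<^sup>2"
    by (rule descent_inequality)
  with descent_inequality[OF f lip, of x d] show ?thesis by (intro abs_leI) simp_all
qed

definition jac :: "(real^'n \<Rightarrow> real^'z) \<Rightarrow> real^'n \<Rightarrow> real^'n^'z" where
  "jac F v = (\<chi> s. gradient (\<lambda>w. F w $ s) v)"

lemma jac_mult: "(jac F v *v d) $ s = gradient (\<lambda>w. F w $ s) v \<bullet> d"
  by (simp add: jac_def matrix_vector_mult_def inner_vec_def)

lemma quadratic_taylor_bound_vec: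
  fixes F :: "real^'n \<Rightarrow> real^'z"
  assumes C2: "\<And>s. C2_fun (\<lambda>v. F v $ s)" and H: "\<And>s x. spec_norm (hessian (\<lambda>v. F v $ s) x) \<le> K"
  shows "norm (F (x + d) - F x - jac F x *v d) \<le> real CARD('z) * (K / 2) * (norm d)\<^sup>2"
proof -
  have "norm (F (x + d) - F x - jac F x *v d)
      \<le> (\<Sum>s\<in>UNIV. \<bar>(F (x + d) - F x - jac F x *v d) $ s\<bar>)" by (rule norm_le_l1_cart)
  also have "\<dots> \<le> (\<Sum>s\<in>(UNIV :: 'z set). K / 2 * (norm d)\<^sup>2)"
    using quadratic_taylor_bound[OF C2 H] by (intro sum_mono) (simp add: jac_mult)
  finally show ?thesis by simp
qed

lemma has_derivative_jac:
  fixes F :: "real^'n \<Rightarrow> real^'z"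
  assumes "\<And>s. (\<lambda>v. F v $ s) differentiable (at x)"
  shows "(F has_derivative (*v) (jac F x)) (at x)"
proof (subst has_derivative_componentwise_within, intro ballI)
  fix b :: "real^'z" assume "b \<in> Basis"
  then obtain s where b: "b = axis s 1" by (auto simp: Basis_vec_def)
  have "((\<lambda>v. F v $ s) has_derivative (\<lambda>h. (jac F x *v h) $ s)) (at x)"
    using has_derivative_gradient[OF assms, of s] by (simp add: jac_mult inner_commute)
  then show "((\<lambda>v. F v \<bullet> b) has_derivative (\<lambda>h. (jac F x *v h) \<bullet> b)) (at x)"
    by (simp add: b inner_axis)
qed

lemma has_derivative_least_squares:
  fixes F :: "real^'n \<Rightarrow> real^'z"
  assumes "\<And>s. (\<lambda>v. F v $ s) differentiable (at x)"
  shows "((\<lambda>v. (1/2) * (norm (z - F v))\<^sup>2) has_derivative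
    (\<lambda>h. h \<bullet> - (transpose (jac F x) *v (z - F x)))) (at x)"
proof -
  let ?r = "z - F x"
  have "((\<lambda>v. (1/2) * ((z - F v) \<bullet> (z - F v))) has_derivative
      (\<lambda>h. (1/2) * (?r \<bullet> (0 - jac F x *v h) + (0 - jac F x *v h) \<bullet> ?r))) (at x)"
    by (intro has_derivative_mult_right has_derivative_inner has_derivative_diff has_derivative_const
        has_derivative_jac assms)
  moreover have "(1/2) * (?r \<bullet> (0 - jac F x *v h) + (0 - jac F x *v h) \<bullet> ?r)
      = h \<bullet> - (transpose (jac F x) *v ?r)" for h
  proof -
    have "(jac F x *v h) \<bullet> ?r = ?r \<bullet> (jac F x *v h)" by (rule inner_commute)
    then show ?thesis by (simp add: inner_minus_right inner_mult_transpose)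
  qed
  ultimately show ?thesis by (simp add: power2_norm_eq_inner)
qed

text \<open>The least squares loss \<open>l\<close>, its gradient \<open>g\<close>, and the two analytic
facts about them that the convergence analysis needs: a second order Taylor bound for the
forward map with Jacobian \<open>A\<close>, and the descent inequality for \<open>l\<close>.\<close>

locale smooth_least_squares =
  fixes F :: "real^'n \<Rightarrow> real^'z" and z :: "real^'z" and K L :: real
    and A :: "real^'n \<Rightarrow> real^'n^'z" and l :: "real^'n \<Rightarrow> real" and g :: "real^'n \<Rightarrow> real^'n"
  defines "l v \<equiv> (1/2) * (norm (z - F v))\<^sup>2"
    and "g v \<equiv> - (transpose (A v) *v (z - F v))"
  assumes K: "0 \<le> K" and L: "0 < L"
    and taylor: "\<And>v d. norm (F (v + d) - F v - A v *v d) \<le> K * (norm d)\<^sup>2"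
    and descent: "\<And>v d. l (v + d) \<le> l v + g v \<bullet> d + L / 2 * (norm d)\<^sup>2"
begin

lemma l_nonneg: "0 \<le> l v" by (simp add: l_def)

lemma norm_residual: "norm (z - F v) = sqrt (2 * l v)" by (simp add: l_def)

text \<open>A gradient step of length \<open>1 / L\<close> decreases the loss by
\<open>\<parallel>g\<parallel>\<^sup>2 / (2 L)\<close>, and the loss cannot become negative.\<close>

lemma norm_gradient: "norm (g v) \<le> sqrt (2 * L * l v)"
proof -
  have "0 \<le> l (v + (- 1 / L) *\<^sub>R g v)" by (rule l_nonneg)
  also have "\<dots> \<le> l v + g v \<bullet> ((- 1 / L) *\<^sub>R g v) + L / 2 * (norm ((- 1 / L) *\<^sub>R g v))\<^sup>2" by (rule descent)
  also have "\<dots> = l v - (norm (g v))\<^sup>2 / (2 * L)"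
  proof -
    define n where "n = (norm (g v))\<^sup>2"
    have 1: "g v \<bullet> ((- 1 / L) *\<^sub>R g v) = - n / L"
      unfolding n_def power2_norm_eq_inner inner_scaleR_right by simp
    have 2: "(norm ((- 1 / L) *\<^sub>R g v))\<^sup>2 = n / L\<^sup>2"
      unfolding n_def norm_scaleR power_mult_distrib by (simp add: power_divide)
    have "- n / L + L / 2 * (n / L\<^sup>2) = - n / (2 * L)"
      using L by (simp add: field_simps power2_eq_square)
    then show ?thesis unfolding 1 2 unfolding n_def[symmetric] by simp
  qed
  finally have "(norm (g v))\<^sup>2 \<le> 2 * L * l v" using L by (simp add: field_simps)
  then show ?thesis by (rule real_le_rsqrt)
qed

text \<open>A substitute for a global bound on the Jacobian, which can fail under these assumptions. The
residual norm is \<open>sqrt (2 l)\<close>, smoothness bounds its growth over a step of length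
one, and the Taylor bound compares that growth with the derivative.\<close>

lemma jac_bound: "norm (A v *v d) \<le> (2 * sqrt (2 * l v) + sqrt L + K) * norm d"
proof -
  have unit: "norm (A v *v d) \<le> 2 * sqrt (2 * l v) + sqrt L + K" if d: "norm d = 1" for d
  proof -
    have "l (v + d) \<le> l v + norm (g v) * norm d + L / 2"
      using descent[of v d] norm_cauchy_schwarz[of "g v" d] d by simp
    also have "\<dots> \<le> l v + sqrt (2 * L * l v) + L / 2" using norm_gradient[of v] d by simp
    finally have up: "l (v + d) \<le> l v + sqrt (2 * L * l v) + L / 2" .
    have "2 * l (v + d) \<le> (sqrt (2 * l v) + sqrt L)\<^sup>2"
    proof -
      have "(sqrt (2 * l v) + sqrt L)\<^sup>2 = 2 * l v + L + 2 * (sqrt (2 * l v) * sqrt L)"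
        using L l_nonneg[of v] by (simp add: power2_sum)
      moreover have "sqrt (2 * l v) * sqrt L = sqrt (2 * L * l v)"
        by (simp only: real_sqrt_mult[symmetric] mult.commute mult.left_commute)
      ultimately show ?thesis using up by linarith
    qed
    then have "sqrt (2 * l (v + d)) \<le> sqrt ((sqrt (2 * l v) + sqrt L)\<^sup>2)"
      by (rule real_sqrt_le_mono)
    also have "\<dots> = sqrt (2 * l v) + sqrt L"
      using L l_nonneg[of v] by (simp only: real_sqrt_abs) simp
    finally have "sqrt (2 * l (v + d)) \<le> sqrt (2 * l v) + sqrt L" .
    moreover have "F (v + d) - F v = (z - F v) - (z - F (v + d))" by simp
    ultimately have "norm (F (v + d) - F v) \<le> 2 * sqrt (2 * l v) + sqrt L"
      using norm_triangle_ineq4[of "z - F v" "z - F (v + d)"] by (simp add: norm_residual)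
    moreover have "norm (A v *v d) \<le> norm (F (v + d) - F v) + norm (F (v + d) - F v - A v *v d)"
      using norm_triangle_ineq4[of "F (v + d) - F v" "F (v + d) - F v - A v *v d"] by simp
    ultimately show ?thesis using taylor[of v d] d by simp
  qed
  show ?thesis
  proof (cases "d = 0")
    case False
    then have "norm (A v *v ((1 / norm d) *\<^sub>R d)) \<le> 2 * sqrt (2 * l v) + sqrt L + K"
      by (intro unit) simp
    moreover have "norm (A v *v ((1 / norm d) *\<^sub>R d)) = norm (A v *v d) / norm d"
      by (simp add: matrix_vector_mult_scaleR)
    ultimately have "norm (A v *v d) / norm d \<le> 2 * sqrt (2 * l v) + sqrt L + K"
      by (simp only:)
    then show ?thesis using False by (simp only: pos_divide_le_eq[of "norm d"] zero_less_norm_iff not_False_eq_True)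
  qed simp
qed

end

section \<open>Descent of the mean step\<close>

context smooth_least_squares
begin

text \<open>Here \<open>Tt\<close> stands for the masked deviations, \<open>Z\<close> for the deviations of
their images, \<open>sg\<^sup>2\<close> for the norm of the covariance, and \<open>c1
sg\<^sup>2\<close> bounds the linearization error \<open>Z - A Tt\<close>. Since
\<open>p\<close> solves a regularized normal equation, \<open>r \<bullet> Z p = s2\<close> for
the residual \<open>r\<close>; replacing \<open>A Tt\<close> by \<open>Z\<close> in \<open>g
\<bullet> d\<close> thus gives a decrease \<open>h s2\<close>. Half of it pays for the curvature
term, a quarter for the linearization error, and a quarter remains.\<close>

lemma kalman_step_descent:
  fixes Tt :: "real^'j^'n" and Z :: "real^'j^'z"
  assumes p: "p + h *\<^sub>R (transpose Z *v (Z *v p)) = transpose Z *v (z - F m)"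
    and sg: "0 < sg" and Tt: "\<And>v. norm (Tt *v v) \<le> sg * norm v"
    and E: "\<And>v. norm (Z *v v - A m *v (Tt *v v)) \<le> c1 * sg\<^sup>2 * norm v" and c1: "0 \<le> c1"
    and h: "h = \<mu> / sg\<^sup>2" and \<mu>: "0 < \<mu>" "\<mu> * L \<le> 1"
  defines "s2 \<equiv> (norm p)\<^sup>2 + h * (norm (Z *v p))\<^sup>2"
  shows "l (m + h *\<^sub>R (Tt *v p)) \<le> l m - h / 4 * s2 + 2 * \<mu> * c1\<^sup>2 * sg\<^sup>2 * l m"
proof -
  define d where "d = h *\<^sub>R (Tt *v p)"
  define r where "r = z - F m"
  define w where "w = Z *v p - A m *v (Tt *v p)"
  define s where "s = sqrt s2"
  have h0: "0 < h" and hs: "h * sg\<^sup>2 = \<mu>" using h \<mu> sg by auto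
  have s2: "0 \<le> s2" and s: "0 \<le> s" "s\<^sup>2 = s2" using h0 by (auto simp: s2_def s_def)
  have rr: "(norm r)\<^sup>2 = 2 * l m" by (simp add: r_def norm_residual l_nonneg)
  have ps: "norm p \<le> s" using h0 by (simp add: s_def s2_def real_le_rsqrt)
  have "p \<bullet> (transpose Z *v r) = p \<bullet> p + h * (p \<bullet> (transpose Z *v (Z *v p)))"
    unfolding r_def p[symmetric] by (simp add: inner_add_right)
  then have "(Z *v p) \<bullet> r = s2"
    unfolding inner_mult_transpose by (simp add: s2_def power2_norm_eq_inner)
  then have qp: "r \<bullet> (Z *v p) = s2" by (simp only: inner_commute)
  have "g m \<bullet> d = - h * (r \<bullet> (A m *v (Tt *v p)))"
    by (simp add: g_def d_def r_def inner_transpose_mult matrix_vector_mult_scaleR)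
  also have "r \<bullet> (A m *v (Tt *v p)) = s2 - r \<bullet> w"
    using qp by (simp add: w_def inner_diff_right)
  finally have gd: "g m \<bullet> d = - h * s2 + h * (r \<bullet> w)" by (simp add: algebra_simps)
  have "r \<bullet> w \<le> norm r * (c1 * sg\<^sup>2 * s)"
  proof -
    have "r \<bullet> w \<le> norm r * norm w" by (rule norm_cauchy_schwarz)
    also have "norm w \<le> c1 * sg\<^sup>2 * norm p" unfolding w_def by (rule E)
    also have "\<dots> \<le> c1 * sg\<^sup>2 * s" using c1 ps by (intro mult_left_mono) auto
    finally show ?thesis by (simp add: mult_left_mono)
  qed
  also have "\<dots> \<le> s2 / 4 + (c1 * sg\<^sup>2)\<^sup>2 * (norm r)\<^sup>2"
  proof -
    have "0 \<le> (s / 2 - c1 * sg\<^sup>2 * norm r)\<^sup>2" by simp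
    then show ?thesis unfolding s(2)[symmetric]
      by (simp add: power2_diff power_mult_distrib power_divide algebra_simps)
  qed
  finally have "h * (r \<bullet> w) \<le> h * (s2 / 4 + (c1 * sg\<^sup>2)\<^sup>2 * (norm r)\<^sup>2)" using h0 by simp
  also have "\<dots> = h / 4 * s2 + (h * sg\<^sup>2) * c1\<^sup>2 * sg\<^sup>2 * (2 * l m)"
    unfolding rr by (simp add: algebra_simps power2_eq_square)
  finally have rw: "h * (r \<bullet> w) \<le> h / 4 * s2 + 2 * \<mu> * c1\<^sup>2 * sg\<^sup>2 * l m" unfolding hs by simp
  have "L / 2 * (norm d)\<^sup>2 \<le> h / 2 * s2"
  proof -
    have "(norm (Tt *v p))\<^sup>2 \<le> (sg * s)\<^sup>2"
      using sg by (intro power_mono order.trans[OF Tt] mult_left_mono ps) auto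
    then have "(norm d)\<^sup>2 \<le> h\<^sup>2 * (sg * s)\<^sup>2"
      unfolding d_def norm_scaleR power_mult_distrib by (simp add: mult_left_mono)
    also have "\<dots> = h * (h * sg\<^sup>2) * s2"
      unfolding power_mult_distrib s(2) by (simp add: power2_eq_square)
    also have "\<dots> = h * \<mu> * s2" unfolding hs ..
    finally have "L / 2 * (norm d)\<^sup>2 \<le> L / 2 * (h * \<mu> * s2)" using L by simp
    also have "\<dots> = (\<mu> * L) * (h / 2 * s2)" by simp
    also have "\<dots> \<le> 1 * (h / 2 * s2)" using \<mu> h0 s2 by (intro mult_right_mono) auto
    finally show ?thesis by simp
  qed
  with descent[of m d] gd rw show ?thesis unfolding d_def by simp
qed

text \<open>The decrease \<open>s2\<close> controls the gradient as seen by the ensemble, since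
\<open>Z\<^sup>T r = p + h Z\<^sup>T Z p\<close> and \<open>Tt\<^sup>T g = - Z\<^sup>T r + (Z -
A Tt)\<^sup>T r\<close>.\<close>

lemma kalman_step_gain:
  fixes Tt :: "real^'j^'n" and Z :: "real^'j^'z"
  assumes p: "p + h *\<^sub>R (transpose Z *v (Z *v p)) = transpose Z *v (z - F m)"
    and sg: "0 < sg" and Tt: "\<And>v. norm (Tt *v v) \<le> sg * norm v"
    and E: "\<And>v. norm (Z *v v - A m *v (Tt *v v)) \<le> c1 * sg\<^sup>2 * norm v" and c1: "0 \<le> c1"
    and h: "h = \<mu> / sg\<^sup>2" and \<mu>: "0 < \<mu>"
    and a: "\<And>v. norm (A m *v v) \<le> a * norm v" "0 \<le> a"
  defines "s2 \<equiv> (norm p)\<^sup>2 + h * (norm (Z *v p))\<^sup>2"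
  defines "Q \<equiv> 1 + \<mu> * (a + c1 * sg)\<^sup>2"
  shows "(norm (transpose Tt *v g m))\<^sup>2 \<le> 4 * Q * s2 + 4 * (c1 * sg\<^sup>2)\<^sup>2 * l m"
proof -
  define r where "r = z - F m"
  define b where "b = (a + c1 * sg) * sg"
  have h0: "0 < h" and hs: "h * sg\<^sup>2 = \<mu>" using h \<mu> sg by auto
  have b: "0 \<le> b" using a c1 sg by (simp add: b_def)
  have Z: "norm (Z *v v) \<le> b * norm v" for v
  proof -
    have "norm (Z *v v) \<le> norm (A m *v (Tt *v v)) + norm (Z *v v - A m *v (Tt *v v))"
      using norm_triangle_ineq[of "A m *v (Tt *v v)" "Z *v v - A m *v (Tt *v v)"] by simp
    moreover have "norm (A m *v (Tt *v v)) \<le> a * (sg * norm v)"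
      using a(1)[of "Tt *v v"] mult_left_mono[OF Tt[of v] a(2)] by linarith
    ultimately show ?thesis using E[of v] by (simp add: b_def power2_eq_square algebra_simps)
  qed
  have Z': "norm (transpose Z *v y) \<le> b * norm y" for y by (rule norm_mult_transfer[OF b Z])
  have E': "norm (transpose (Z - A m ** Tt) *v y) \<le> c1 * sg\<^sup>2 * norm y" for y
    using E c1 by (intro norm_mult_transfer)
      (auto simp: matrix_vector_mult_diff_rdistrib matrix_vector_mul_assoc)
  have sq: "(norm (x + y))\<^sup>2 \<le> 2 * (norm x)\<^sup>2 + 2 * (norm y)\<^sup>2" for x y :: "real^'j"
  proof -
    have "(norm (x + y))\<^sup>2 \<le> (norm x + norm y)\<^sup>2" by (intro power_mono norm_triangle_ineq) auto
    also have "\<dots> \<le> 2 * (norm x)\<^sup>2 + 2 * (norm y)\<^sup>2"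
      using zero_le_power2[of "norm x - norm y"] by (simp add: power2_sum power2_diff)
    finally show ?thesis .
  qed
  have "(norm (transpose Z *v r))\<^sup>2 \<le> 2 * (norm p)\<^sup>2 + 2 * (norm (h *\<^sub>R (transpose Z *v (Z *v p))))\<^sup>2"
    unfolding r_def p[symmetric] by (rule sq)
  also have "(norm (h *\<^sub>R (transpose Z *v (Z *v p))))\<^sup>2 \<le> (h * (b * norm (Z *v p)))\<^sup>2"
    using Z'[of "Z *v p"] h0 by (intro power_mono) auto
  also have "\<dots> = (h * sg\<^sup>2) * (a + c1 * sg)\<^sup>2 * (h * (norm (Z *v p))\<^sup>2)"
    by (simp add: b_def power2_eq_square algebra_simps)
  also have "\<dots> = (Q - 1) * (h * (norm (Z *v p))\<^sup>2)" by (simp add: hs Q_def)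
  also have "2 * (norm p)\<^sup>2 + 2 * ((Q - 1) * (h * (norm (Z *v p))\<^sup>2)) \<le> 2 * Q * s2"
  proof -
    have "0 \<le> (Q - 1) * (norm p)\<^sup>2" "0 \<le> h * (norm (Z *v p))\<^sup>2" using \<mu> h0 by (auto simp: Q_def)
    then show ?thesis by (simp add: s2_def algebra_simps)
  qed
  finally have 1: "(norm (transpose Z *v r))\<^sup>2 \<le> 2 * Q * s2" by simp
  have "transpose Tt *v g m = transpose (Z - A m ** Tt) *v r + (- (transpose Z *v r))"
  proof -
    have "transpose (Z - A m ** Tt) = transpose Z - transpose Tt ** transpose (A m)"
      unfolding matrix_transpose_mul[symmetric] by (simp add: vec_eq_iff transpose_def)
    then show ?thesis
      by (simp add: matrix_vector_mult_diff_rdistrib matrix_vector_mul_assoc[symmetric] g_def r_def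
          linear_neg[OF matrix_vector_mul_linear])
  qed
  then have "(norm (transpose Tt *v g m))\<^sup>2
      \<le> 2 * (norm (transpose (Z - A m ** Tt) *v r))\<^sup>2 + 2 * (norm (- (transpose Z *v r)))\<^sup>2"
    using sq by metis
  moreover have "(norm (transpose (Z - A m ** Tt) *v r))\<^sup>2 \<le> (c1 * sg\<^sup>2)\<^sup>2 * (2 * l m)"
  proof -
    have "(norm (transpose (Z - A m ** Tt) *v r))\<^sup>2 \<le> (c1 * sg\<^sup>2 * norm r)\<^sup>2"
      by (intro power_mono E') auto
    also have "\<dots> = (c1 * sg\<^sup>2)\<^sup>2 * (2 * l m)"
      unfolding r_def norm_residual power_mult_distrib[of _ "sqrt _"] by (simp add: l_nonneg)
    finally show ?thesis .
  qed
  ultimately show ?thesis using 1 by simp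
qed

end

lemma cols_axis:
  fixes a :: "'j::finite \<Rightarrow> real^'n"
  assumes "CARD('j) \<ge> 2"
  shows "a j = sqrt (real CARD('j) - 1) *\<^sub>R (cols a *v axis j 1)"
  using assms by (simp add: vec_eq_iff cols_def matrix_vector_mul_component inner_axis)

lemma norm_cols_mult_le:
  fixes a :: "'j::finite \<Rightarrow> real^'n"
  assumes J: "CARD('j) \<ge> 2" and a: "\<And>j. norm (a j) \<le> b"
  shows "norm (cols a *v v) \<le> real CARD('j) * b * norm v"
proof -
  have s1: "1 \<le> sqrt (real CARD('j) - 1)" using J by simp
  have b: "0 \<le> b" using a[of undefined] norm_ge_zero order_trans by blast
  have "cols a *v v = (\<Sum>j\<in>UNIV. (v $ j / sqrt (real CARD('j) - 1)) *\<^sub>R a j)"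
    by (simp add: vec_eq_iff cols_def matrix_vector_mult_def mult.commute)
  also have "norm \<dots> \<le> (\<Sum>j\<in>(UNIV :: 'j set). norm v * b)"
  proof (rule sum_norm_le)
    fix j
    have "\<bar>v $ j / sqrt (real CARD('j) - 1)\<bar> \<le> \<bar>v $ j\<bar> / 1"
      unfolding abs_divide using s1 by (intro divide_left_mono) auto
    also have "\<dots> \<le> norm v" by (simp add: component_le_norm_cart)
    finally show "norm ((v $ j / sqrt (real CARD('j) - 1)) *\<^sub>R a j) \<le> norm v * b"
      unfolding norm_scaleR real_norm_def[symmetric] using a b by (intro mult_mono) auto
  qed
  finally show ?thesis by (simp add: mult.commute mult.left_commute)
qed

text \<open>Centring commutes with linear maps, so in the deviations of the images only the Taylor
remainders \<open>R\<close> differ from the linear prediction.\<close>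

lemma dev_linear_part:
  fixes f t :: "'j::finite \<Rightarrow> real^'n" and B :: "real^'n^'z"
  assumes "(\<Sum>j\<in>UNIV. t j) = 0"
  shows "dev (\<lambda>j. c + B *v t j + R j) = (\<lambda>j. B *v t j + dev R j)"
proof -
  have "(\<Sum>j\<in>UNIV. B *v t j) = 0"
    using linear_sum[OF matrix_vector_mul_linear, of B t UNIV] assms by simp
  then have "ens_mean (\<lambda>j. c + B *v t j + R j) = c + ens_mean R"
    by (simp add: ens_mean_def sum.distrib sum_constant_scaleR scaleR_add_right del: sum_constant)
  then show ?thesis by (simp add: dev_def fun_eq_iff)
qed

lemma norm_dev_le:
  fixes R :: "'j::finite \<Rightarrow> real^'n"
  assumes R: "\<And>j. norm (R j) \<le> b"
  shows "norm (dev R j) \<le> 2 * b"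
proof -
  have "norm (\<Sum>j\<in>UNIV. R j) \<le> (\<Sum>j\<in>(UNIV :: 'j set). b)" by (intro sum_norm_le R)
  then have "norm (ens_mean R) \<le> b" by (simp add: ens_mean_def divide_simps mult.commute)
  then show ?thesis using R[of j] norm_triangle_ineq4[of "R j" "ens_mean R"] by (simp add: dev_def)
qed

lemma sum_drop_dev: "(\<Sum>j\<in>UNIV. drop_dev r e j) = 0"
  for e :: "'j::finite \<Rightarrow> real^'n"
  by (simp add: drop_dev_def sum_distrib_left[symmetric] sum_dev)

lemma drop_cols_mult: "cols (drop_dev r e) *v v = r * (cols (dev e) *v v)"
  by (simp add: vec_eq_iff cols_def drop_dev_def matrix_vector_mult_def sum_distrib_left algebra_simps)

text \<open>Masking cannot enlarge deviations, so all bounds for the ensemble hold for the dropout ensemble.\<close>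

lemma norm_mask_mult_le:
  fixes r x :: "real^'n"
  assumes "\<And>i. r $ i = 0 \<or> r $ i = 1"
  shows "norm (r * x) \<le> norm x"
proof (rule norm_le_componentwise_cart)
  fix i show "norm ((r * x) $ i) \<le> norm (x $ i)" using assms[of i] by auto
qed

lemma mean_step_resolvent:
  fixes e :: "'j::finite \<Rightarrow> real^'n" and F :: "real^'n \<Rightarrow> real^'z" and r :: "real^'n"
  assumes J: "CARD('j) \<ge> 2" and h: "0 \<le> h"
  defines "Z \<equiv> cols (dev (\<lambda>j. F (drop_ens r e j)))"
  obtains p where "p + h *\<^sub>R (transpose Z *v (Z *v p)) = transpose Z *v (z - F (ens_mean e))"
    "mean_step F z h r e = ens_mean e + h *\<^sub>R (cols (drop_dev r e) *v p)"
proof -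
  define x where "x = matrix_inv (mat 1 + h *\<^sub>R (Z ** transpose Z)) *v (z - F (ens_mean e))"
  define p where "p = transpose Z *v x"
  have "x + h *\<^sub>R (Z *v p) = z - F (ens_mean e)"
    unfolding x_def p_def by (rule resolvent_apply[OF h])
  then have "transpose Z *v (x + h *\<^sub>R (Z *v p)) = transpose Z *v (z - F (ens_mean e))" by simp
  then have "p + h *\<^sub>R (transpose Z *v (Z *v p)) = transpose Z *v (z - F (ens_mean e))"
    by (simp add: matrix_vector_right_distrib matrix_vector_mult_scaleR p_def[symmetric])
  moreover have "mean_step F z h r e = ens_mean e + h *\<^sub>R (cols (drop_dev r e) *v p)"
    by (simp add: mean_step_def drop_C_uz_def drop_C_zz_def scatter_cols[OF J] Z_def[symmetric]
        p_def x_def matrix_vector_mul_assoc[symmetric])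
  ultimately show ?thesis by (rule that)
qed

context smooth_least_squares
begin

text \<open>The first bound needs no control of the Jacobian. It is used to bound the loss, hence the
Jacobian, along the trajectory, which then makes the second bound, with a definite decrease,
available.\<close>

lemma mean_step_bounds:
  fixes e :: "'j::finite \<Rightarrow> real^'n"
  assumes J: "CARD('j) \<ge> 2" and r: "\<And>i. r $ i = 0 \<or> r $ i = 1"
    and pos: "0 < spec_norm (C_uu e)" and h: "h = \<mu> * inverse (spec_norm (C_uu e))"
    and \<mu>: "0 < \<mu>" "\<mu> * L \<le> 1"
  defines "m \<equiv> ens_mean e" and "c1 \<equiv> 2 * K * (real CARD('j))\<^sup>2" and "s \<equiv> spec_norm (C_uu e)"
  shows "l (mean_step F z h r e) \<le> (1 + 2 * \<mu> * c1\<^sup>2 * s) * l m"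
    and "0 \<le> a \<Longrightarrow> (\<And>v. norm (A m *v v) \<le> a * norm v) \<Longrightarrow>
      l (mean_step F z h r e) \<le> l m + 3 * \<mu> * c1\<^sup>2 * s * l m
        - \<mu> / (16 * (1 + \<mu> * (a + c1 * sqrt s)\<^sup>2)) * ((norm (transpose (cols (drop_dev r e)) *v g m))\<^sup>2 / s)"
proof -
  define sg where "sg = sqrt s"
  define Tt where "Tt = cols (drop_dev r e)"
  define Z where "Z = cols (dev (\<lambda>j. F (drop_ens r e j)))"
  have sg: "0 < sg" "sg\<^sup>2 = s" using pos by (simp_all add: sg_def s_def)
  have h': "h = \<mu> / sg\<^sup>2" using h sg by (simp add: s_def divide_inverse)
  have h0: "0 \<le> h" using h' \<mu> by simp
  have c1: "0 \<le> c1" using K by (simp add: c1_def)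
  have Tt: "norm (Tt *v v) \<le> sg * norm v" for v
  proof -
    have "norm (Tt *v v) \<le> norm (cols (dev e) *v v)"
      unfolding Tt_def drop_cols_mult by (rule norm_mask_mult_le[OF r])
    also have "\<dots> \<le> sg * norm v"
      unfolding sg_def s_def C_uu_gram[OF J] by (rule norm_le_gram)
    finally show ?thesis .
  qed
  define R where "R j = F (m + drop_dev r e j) - F m - A m *v drop_dev r e j" for j
  have R: "norm (R j) \<le> K * real CARD('j) * s" for j
  proof -
    have "norm (Tt *v axis j 1) \<le> sg" using Tt[of "axis j 1"] by (simp add: norm_axis_1)
    then have "(norm (Tt *v axis j 1))\<^sup>2 \<le> s" unfolding sg(2)[symmetric] by (intro power_mono) auto
    moreover have "(norm (drop_dev r e j))\<^sup>2 = (real CARD('j) - 1) * (norm (Tt *v axis j 1))\<^sup>2"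
      using J by (subst cols_axis[OF J]) (simp add: Tt_def power_mult_distrib)
    ultimately have "(norm (drop_dev r e j))\<^sup>2 \<le> real CARD('j) * s"
      using J by (auto intro!: mult_mono)
    then have "K * (norm (drop_dev r e j))\<^sup>2 \<le> K * (real CARD('j) * s)" by (rule mult_left_mono[OF _ K])
    with taylor[of m "drop_dev r e j"] show ?thesis by (simp add: R_def mult.assoc)
  qed
  have "(\<lambda>j. F (drop_ens r e j)) = (\<lambda>j. F m + A m *v drop_dev r e j + R j)"
    by (simp add: R_def drop_ens_def m_def)
  then have dev: "dev (\<lambda>j. F (drop_ens r e j)) = (\<lambda>j. A m *v drop_dev r e j + dev R j)"
    using dev_linear_part[OF sum_drop_dev] by simp
  have "Z = A m ** Tt + cols (dev R)"
    unfolding Z_def dev Tt_def cols_mult[symmetric] by (simp add: vec_eq_iff cols_def add_divide_distrib)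
  then have ZE: "Z *v v - A m *v (Tt *v v) = cols (dev R) *v v" for v
    by (simp add: matrix_vector_mult_add_rdistrib matrix_vector_mul_assoc)
  have E: "norm (Z *v v - A m *v (Tt *v v)) \<le> c1 * sg\<^sup>2 * norm v" for v
  proof -
    have "norm (dev R j) \<le> 2 * (K * real CARD('j) * s)" for j by (rule norm_dev_le[OF R])
    then have "norm (cols (dev R) *v v) \<le> real CARD('j) * (2 * (K * real CARD('j) * s)) * norm v"
      by (rule norm_cols_mult_le[OF J])
    then show ?thesis
      unfolding ZE sg(2) by (simp add: c1_def power2_eq_square mult.assoc mult.left_commute)
  qed
  obtain p where p: "p + h *\<^sub>R (transpose Z *v (Z *v p)) = transpose Z *v (z - F m)"
    and step: "mean_step F z h r e = m + h *\<^sub>R (Tt *v p)"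
    unfolding Z_def m_def Tt_def by (rule mean_step_resolvent[OF J h0])
  define s2 where "s2 = (norm p)\<^sup>2 + h * (norm (Z *v p))\<^sup>2"
  have s2: "0 \<le> s2" using h0 by (simp add: s2_def)
  have up: "l (mean_step F z h r e) \<le> l m - h / 4 * s2 + 2 * \<mu> * c1\<^sup>2 * s * l m"
    using kalman_step_descent[OF p sg(1) Tt E c1 h' \<mu>] by (simp add: step s2_def sg)
  show "l (mean_step F z h r e) \<le> (1 + 2 * \<mu> * c1\<^sup>2 * s) * l m"
  proof -
    have "0 \<le> h / 4 * s2" using h0 s2 by simp
    with up show ?thesis by (simp add: algebra_simps)
  qed
  show "l (mean_step F z h r e) \<le> l m + 3 * \<mu> * c1\<^sup>2 * s * l m
      - \<mu> / (16 * (1 + \<mu> * (a + c1 * sqrt s)\<^sup>2)) * ((norm (transpose (cols (drop_dev r e)) *v g m))\<^sup>2 / s)"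
    if a: "0 \<le> a" "\<And>v. norm (A m *v v) \<le> a * norm v"
  proof -
    define Q where "Q = 1 + \<mu> * (a + c1 * sg)\<^sup>2"
    define G where "G = (norm (transpose Tt *v g m))\<^sup>2"
    have Q: "1 \<le> Q" using \<mu> by (simp add: Q_def)
    have "G \<le> 4 * Q * s2 + 4 * (c1 * sg\<^sup>2)\<^sup>2 * l m"
      unfolding G_def Q_def s2_def by (rule kalman_step_gain[OF p sg(1) Tt E c1 h' \<mu>(1) a(2,1)])
    then have "h / (16 * Q) * G \<le> h / (16 * Q) * (4 * Q * s2 + 4 * (c1 * sg\<^sup>2)\<^sup>2 * l m)"
      using h0 Q by (intro mult_left_mono) auto
    also have "\<dots> = h / 4 * s2 + (h * sg\<^sup>2) * c1\<^sup>2 * sg\<^sup>2 * l m / (4 * Q)"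
      using Q by (simp add: field_simps power2_eq_square)
    also have "h * sg\<^sup>2 = \<mu>" using h' sg(1) by simp
    also have "\<mu> * c1\<^sup>2 * sg\<^sup>2 * l m / (4 * Q) \<le> \<mu> * c1\<^sup>2 * sg\<^sup>2 * l m / 1"
      using Q \<mu> l_nonneg[of m] by (intro divide_left_mono) auto
    finally have "h / (16 * Q) * G \<le> h / 4 * s2 + \<mu> * c1\<^sup>2 * s * l m" by (simp add: sg)
    moreover have "h / (16 * Q) * G = \<mu> / (16 * Q) * (G / s)" by (simp add: h' sg)
    ultimately show ?thesis using up
      unfolding Q_def[symmetric] G_def[symmetric] sg_def[symmetric] Tt_def[symmetric] by simp
  qed
qed

end

section \<open>Bounds along a trajectory\<close>

lemma spec_norm_gram_diag:
  fixes T :: "real^'j^'n"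
  shows "(norm (transpose T *v axis i 1))\<^sup>2 = (T ** transpose T) $ i $ i"
  unfolding norm_gram by (simp add: matrix_vector_mult_basis column_def inner_axis')

lemma matrix_entry_le_spec_norm: "\<bar>C $ i $ k\<bar> \<le> spec_norm C"
  for C :: "real^'n^'m"
proof -
  have "\<bar>C $ i $ k\<bar> = \<bar>(C *v axis k 1) $ i\<bar>" by (simp add: matrix_vector_mult_basis column_def)
  also have "\<dots> \<le> norm (C *v axis k 1)" by (rule component_le_norm_cart)
  also have "\<dots> \<le> spec_norm C" using norm_mult_le_spec_norm[of C "axis k 1"] by (simp add: norm_axis_1)
  finally show ?thesis .
qed

context smooth_least_squares
begin

text \<open>All four claims rest on one induction. The relative lower bound on the covariance survives
because \<open>sqrt \<parallel>C\<parallel>\<close> shrinks by \<open>sqrt q\<close> while the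
coercivity constant, measured in units of \<open>sqrt \<parallel>C_0\<parallel> / sqrt
\<parallel>C\<parallel>\<close>, grows by at most one per step: \<open>\<kappa> = 1 / (1 - sqrt
q)\<close> satisfies \<open>sqrt q (\<kappa> + 1) \<le> \<kappa>\<close>. The loss is multiplied
by at most \<open>1 + 2 \<mu> c1\<^sup>2 N q\<^sup>n\<close> in step \<open>n\<close>, and these
factors have a finite product.\<close>

lemma trajectory_bounds:
  fixes e :: "nat \<Rightarrow> 'j::finite \<Rightarrow> real^'n" and r :: "nat \<Rightarrow> real^'n" and B :: "nat \<Rightarrow> real^'n^'z"
    and h h' :: "nat \<Rightarrow> real"
  assumes J: "CARD('j) \<ge> 2"
    and iter: "\<And>n. e (Suc n) = (\<lambda>j. mean_step F z (h' n) (r n) (e n) + dev_step (B n) (h n) (e n) j)"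
    and h: "\<And>n. h n = \<theta> * inverse (spec_norm (C_uu (e n)))"
    and h': "\<And>n. h' n = \<mu> * inverse (spec_norm (C_uu (e n)))"
    and r: "\<And>n i. r n $ i = 0 \<or> r n $ i = 1"
    and B: "\<And>n x. \<gamma>\<^sup>2 * (norm x)\<^sup>2 \<le> (norm (B n *v x))\<^sup>2" "\<And>n x. norm (B n *v x) \<le> M * norm x"
    and \<gamma>: "0 < \<gamma>" and M: "0 \<le> M" and \<theta>: "0 < \<theta>" "\<theta> * M\<^sup>2 \<le> 1" and \<mu>: "0 < \<mu>" "\<mu> * L \<le> 1"
    and s0: "0 < spec_norm (C_uu (e 0))" "spec_norm (C_uu (e 0)) \<le> N"
      "\<And>i. spec_norm (C_uu (e 0)) \<le> N * C_uu (e 0) $ i $ i"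
    and l0: "l (ens_mean (e 0)) \<le> N"
  defines "q \<equiv> 1 / (1 + 2 * \<theta> * \<gamma>\<^sup>2)" and "c1 \<equiv> 2 * K * (real CARD('j))\<^sup>2"
  defines "\<Lambda> \<equiv> N * exp (2 * \<mu> * c1\<^sup>2 * N / (1 - q))"
  defines "a \<equiv> 2 * sqrt (2 * \<Lambda>) + sqrt L + K"
  shows "0 < spec_norm (C_uu (e n))" (is "?pos n")
    and "spec_norm (C_uu (e n)) \<le> (1 / (1 - sqrt q))\<^sup>2 * N * C_uu (e n) $ i $ i"
    and "l (ens_mean (e n)) \<le> \<Lambda>"
    and "l (ens_mean (e (Suc n))) \<le> l (ens_mean (e n)) + 3 * \<mu> * c1\<^sup>2 * N * \<Lambda> * q ^ n
        - \<mu> / (16 * (1 + \<mu> * (a + c1 * sqrt N)\<^sup>2))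
          * ((norm (transpose (cols (drop_dev (r n) (e n))) *v g (ens_mean (e n))))\<^sup>2
             / spec_norm (C_uu (e n)))"
proof -
  define s where "s n = spec_norm (C_uu (e n))" for n
  define T where "T n = cols (dev (e n))" for n
  define m where "m n = ens_mean (e n)" for n
  define \<kappa> where "\<kappa> = 1 / (1 - sqrt q)"
  have "0 < 2 * \<theta> * \<gamma>\<^sup>2" using \<theta> \<gamma> by simp
  then have q: "0 < q" "q < 1" by (simp_all add: q_def)
  then have sq: "0 < sqrt q" "sqrt q < 1" by simp_all
  have \<kappa>: "0 < \<kappa>" "sqrt q * (\<kappa> + 1) \<le> \<kappa>" "1 \<le> \<kappa>"
  proof -
    show "0 < \<kappa>" "1 \<le> \<kappa>" using sq by (simp_all add: \<kappa>_def)
    have "\<kappa> * (1 - sqrt q) = 1" using sq by (simp add: \<kappa>_def)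
    then have "\<kappa> = 1 + sqrt q * \<kappa>" by (simp add: algebra_simps)
    moreover have "sqrt q * (\<kappa> + 1) = sqrt q * \<kappa> + sqrt q" by (simp add: algebra_simps)
    ultimately show "sqrt q * (\<kappa> + 1) \<le> \<kappa>" using sq by linarith
  qed
  have c1: "0 \<le> c1" using K by (simp add: c1_def)
  have N: "0 < N" using s0 by simp
  have dev: "dev (e (Suc n)) = dev_step (B n) (h n) (e n)"
    and mean: "m (Suc n) = mean_step F z (h' n) (r n) (e n)" for n
    unfolding m_def iter by (rule dev_shift_centered[OF sum_dev_step])+
  have diag: "C_uu (e n) $ i $ i = (norm (transpose (T n) *v axis i 1))\<^sup>2" for n i
    unfolding T_def C_uu_gram[OF J] spec_norm_gram_diag ..
  have d0: "0 < C_uu (e 0) $ i $ i" for i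
    using less_le_trans[OF s0(1) s0(3)[of i]] N by (simp add: zero_less_mult_iff)
  define E where "E n = N * exp (2 * \<mu> * c1\<^sup>2 * N * (\<Sum>k<n. q ^ k))" for n
  have inv: "0 < s n \<and> s n \<le> N * q ^ n \<and> l (m n) \<le> E n \<and>
      (\<forall>w. sqrt (s n) * norm (transpose (T 0) *v w) \<le> \<kappa> * sqrt (s 0) * norm (transpose (T n) *v w))" for n
  proof (induction n)
    case 0
    have "sqrt (s 0) * norm (transpose (T 0) *v w) \<le> \<kappa> * sqrt (s 0) * norm (transpose (T 0) *v w)" for w
      using \<kappa>(3) s0(1) by (intro mult_right_mono) (auto simp: s_def)
    then show ?case using s0 l0 by (simp add: s_def m_def E_def)
  next
    case (Suc n)
    then have IH: "0 < s n" "s n \<le> N * q ^ n" "l (m n) \<le> E n"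
      "\<And>w. sqrt (s n) * norm (transpose (T 0) *v w) \<le> \<kappa> * sqrt (s 0) * norm (transpose (T n) *v w)"
      by auto
    have hn: "h n = \<theta> / s n" using h[of n] by (simp add: s_def divide_inverse)
    have contr: "s (Suc n) \<le> q * s n"
      using spec_norm_dev_step[OF J dev B(1) _ h \<theta>(1)] IH(1) by (simp add: s_def q_def)
    \<comment> \<open>The constant grows by at most one because \<open>h n = \<theta> / s n\<close> and
       \<open>\<theta> * M\<^sup>2 \<le> 1\<close>.\<close>
    have main: "sqrt (s n) * norm (transpose (T 0) *v w)
        \<le> (\<kappa> + 1) * sqrt (s 0) * norm (transpose (T (Suc n)) *v w)" for w
    proof -
      have P: "norm (transpose (T 0) *v x) \<le> sqrt (s 0) * norm x" for x
        unfolding s_def T_def C_uu_gram[OF J] by (rule norm_transpose_le_gram)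
      have k: "norm (transpose (T 0) *v x) \<le> \<kappa> * sqrt (s 0) / sqrt (s n) * norm (transpose (cols (dev (e n))) *v x)" for x
        using IH(4)[of x] IH(1) by (simp add: T_def field_simps)
      have "norm (transpose (T 0) *v w)
          \<le> (\<kappa> * sqrt (s 0) / sqrt (s n) + h n * M\<^sup>2 * sqrt (s 0) * sqrt (s n)) * norm (transpose (T (Suc n)) *v w)"
        using dev_step_coercive[OF J dev _ B(2) M P _ k, of w] IH(1) s0(1) hn \<theta> by (simp add: s_def T_def)
      then have "sqrt (s n) * norm (transpose (T 0) *v w)
          \<le> sqrt (s n) * ((\<kappa> * sqrt (s 0) / sqrt (s n) + h n * M\<^sup>2 * sqrt (s 0) * sqrt (s n))
             * norm (transpose (T (Suc n)) *v w))"
        using IH(1) by (intro mult_left_mono) auto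
      also have "\<dots> = (\<kappa> + h n * M\<^sup>2 * (sqrt (s n) * sqrt (s n))) * sqrt (s 0) * norm (transpose (T (Suc n)) *v w)"
        using IH(1) by (simp add: algebra_simps)
      also have "h n * M\<^sup>2 * (sqrt (s n) * sqrt (s n)) = \<theta> * M\<^sup>2"
        using IH(1) by (simp add: hn)
      also have "(\<kappa> + \<theta> * M\<^sup>2) * sqrt (s 0) * norm (transpose (T (Suc n)) *v w)
          \<le> (\<kappa> + 1) * sqrt (s 0) * norm (transpose (T (Suc n)) *v w)"
        using \<theta>(2) s0(1) by (intro mult_right_mono) (auto simp: s_def)
      finally show ?thesis .
    qed
    have pos: "0 < s (Suc n)"
    proof -
      fix i
      have "0 < norm (transpose (T 0) *v axis i 1)" using d0[of i] by (simp add: diag)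
      then have "0 < sqrt (s n) * norm (transpose (T 0) *v axis i 1)" using IH(1) by simp
      then have "norm (transpose (T (Suc n)) *v axis i 1) \<noteq> 0" using main[of "axis i 1"] by auto
      then have "0 < C_uu (e (Suc n)) $ i $ i" by (simp add: diag)
      then show ?thesis unfolding s_def by (rule less_le_trans) (rule order_trans[OF abs_ge_self matrix_entry_le_spec_norm])
    qed
    have coer: "sqrt (s (Suc n)) * norm (transpose (T 0) *v w) \<le> \<kappa> * sqrt (s 0) * norm (transpose (T (Suc n)) *v w)" for w
    proof -
      have "sqrt (s (Suc n)) \<le> sqrt q * sqrt (s n)"
        using contr by (simp flip: real_sqrt_mult)
      then have "sqrt (s (Suc n)) * norm (transpose (T 0) *v w) \<le> sqrt q * sqrt (s n) * norm (transpose (T 0) *v w)"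
        by (intro mult_right_mono) auto
      also have "\<dots> = sqrt q * (sqrt (s n) * norm (transpose (T 0) *v w))" by simp
      also have "\<dots> \<le> sqrt q * ((\<kappa> + 1) * sqrt (s 0) * norm (transpose (T (Suc n)) *v w))"
        using sq by (intro mult_left_mono main) auto
      also have "\<dots> = (sqrt q * (\<kappa> + 1)) * (sqrt (s 0) * norm (transpose (T (Suc n)) *v w))" by simp
      also have "\<dots> \<le> \<kappa> * (sqrt (s 0) * norm (transpose (T (Suc n)) *v w))"
        using \<kappa> s0(1) by (intro mult_right_mono) (auto simp: s_def)
      finally show ?thesis by simp
    qed
    have "q * s n \<le> q * (N * q ^ n)" using IH(2) q by (intro mult_left_mono) auto
    with contr have le: "s (Suc n) \<le> N * q ^ Suc n" by (simp add: mult.left_commute)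
    have "l (m (Suc n)) \<le> (1 + 2 * \<mu> * c1\<^sup>2 * s n) * l (m n)"
      unfolding mean unfolding s_def m_def c1_def
      by (rule mean_step_bounds(1)[OF J r _ h' \<mu>]) (use IH(1) in \<open>simp add: s_def\<close>)
    also have "\<dots> \<le> exp (2 * \<mu> * c1\<^sup>2 * N * q ^ n) * E n"
    proof (rule mult_mono)
      have "2 * \<mu> * c1\<^sup>2 * s n \<le> 2 * \<mu> * c1\<^sup>2 * (N * q ^ n)"
        using IH(2) \<mu> by (intro mult_left_mono) auto
      then show "1 + 2 * \<mu> * c1\<^sup>2 * s n \<le> exp (2 * \<mu> * c1\<^sup>2 * N * q ^ n)"
        using exp_ge_add_one_self[of "2 * \<mu> * c1\<^sup>2 * N * q ^ n"] by (simp only: mult.assoc)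
    qed (use IH(3) l_nonneg in auto)
    also have "\<dots> = E (Suc n)"
      by (simp add: E_def exp_add algebra_simps)
    finally show ?case using pos le coer by simp
  qed
  have E: "E n \<le> \<Lambda>" for n
  proof -
    have "(\<Sum>k<n. q ^ k) = (1 - q ^ n) / (1 - q)" using q by (simp add: sum_gp_strict)
    also have "\<dots> \<le> 1 / (1 - q)" using q by (intro divide_right_mono) auto
    finally have "2 * \<mu> * c1\<^sup>2 * N * (\<Sum>k<n. q ^ k) \<le> 2 * \<mu> * c1\<^sup>2 * N * (1 / (1 - q))"
      using \<mu> N by (intro mult_left_mono) auto
    then show ?thesis using N by (simp add: E_def \<Lambda>_def)
  qed
  show "?pos n" using inv[of n] by (simp add: s_def)
  show l: "l (ens_mean (e n)) \<le> \<Lambda>"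
    using inv[of n] E[of n] unfolding m_def by linarith
  show "spec_norm (C_uu (e n)) \<le> (1 / (1 - sqrt q))\<^sup>2 * N * C_uu (e n) $ i $ i"
  proof -
    have "(sqrt (s n) * norm (transpose (T 0) *v axis i 1))\<^sup>2 \<le> (\<kappa> * sqrt (s 0) * norm (transpose (T n) *v axis i 1))\<^sup>2"
      using inv[of n] by (intro power_mono) auto
    then have "s n * C_uu (e 0) $ i $ i \<le> \<kappa>\<^sup>2 * s 0 * C_uu (e n) $ i $ i"
      using inv[of n] inv[of 0] by (simp add: power_mult_distrib diag)
    also have "\<dots> \<le> \<kappa>\<^sup>2 * (N * C_uu (e 0) $ i $ i) * C_uu (e n) $ i $ i"
      using s0(3)[of i] by (intro mult_right_mono mult_left_mono) (auto simp: s_def diag)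
    also have "\<dots> = \<kappa>\<^sup>2 * N * C_uu (e n) $ i $ i * C_uu (e 0) $ i $ i" by simp
    finally show ?thesis using d0[of i] by (simp add: s_def \<kappa>_def)
  qed
  show "l (ens_mean (e (Suc n))) \<le> l (ens_mean (e n)) + 3 * \<mu> * c1\<^sup>2 * N * \<Lambda> * q ^ n
        - \<mu> / (16 * (1 + \<mu> * (a + c1 * sqrt N)\<^sup>2))
          * ((norm (transpose (cols (drop_dev (r n) (e n))) *v g (ens_mean (e n))))\<^sup>2
             / spec_norm (C_uu (e n)))"
  proof -
    define G where "G = (norm (transpose (cols (drop_dev (r n) (e n))) *v g (m n)))\<^sup>2 / s n"
    have sn: "0 < s n" "s n \<le> N * q ^ n" using inv[of n] by auto
    have G: "0 \<le> G" using sn by (simp add: G_def)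
    have a0: "0 \<le> a" using N K L by (simp add: a_def \<Lambda>_def)
    have a: "norm (A (m n) *v v) \<le> a * norm v" for v
    proof -
      have "2 * sqrt (2 * l (m n)) + sqrt L + K \<le> a" using l by (simp add: a_def m_def)
      then show ?thesis
        using jac_bound[of "m n" v] mult_right_mono[of _ a "norm v"] by (meson norm_ge_zero order_trans)
    qed
    have "l (m (Suc n)) \<le> l (m n) + 3 * \<mu> * c1\<^sup>2 * s n * l (m n) - \<mu> / (16 * (1 + \<mu> * (a + c1 * sqrt (s n))\<^sup>2)) * G"
      unfolding mean unfolding G_def m_def s_def c1_def
      by (rule mean_step_bounds(2)[OF J r _ h' \<mu> a0 a[unfolded m_def]]) (use sn in \<open>simp add: s_def\<close>)
    moreover have "3 * \<mu> * c1\<^sup>2 * s n * l (m n) \<le> 3 * \<mu> * c1\<^sup>2 * N * \<Lambda> * q ^ n"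
    proof -
      have "s n * l (m n) \<le> (N * q ^ n) * \<Lambda>" using sn l l_nonneg by (intro mult_mono) (auto simp: m_def)
      then have "3 * \<mu> * c1\<^sup>2 * (s n * l (m n)) \<le> 3 * \<mu> * c1\<^sup>2 * ((N * q ^ n) * \<Lambda>)"
        using \<mu> by (intro mult_left_mono) auto
      then show ?thesis by (simp add: mult.assoc mult.left_commute mult.commute)
    qed
    moreover have "\<mu> / (16 * (1 + \<mu> * (a + c1 * sqrt N)\<^sup>2)) * G \<le> \<mu> / (16 * (1 + \<mu> * (a + c1 * sqrt (s n))\<^sup>2)) * G"
    proof (rule mult_right_mono[OF divide_left_mono G])
      have "q ^ n \<le> 1" using q by (simp add: power_le_one)
      then have "N * q ^ n \<le> N * 1" using N by (intro mult_left_mono) auto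
      then have "sqrt (s n) \<le> sqrt N" using sn by simp
      then have "(a + c1 * sqrt (s n))\<^sup>2 \<le> (a + c1 * sqrt N)\<^sup>2"
        using a0 c1 sn by (intro power_mono add_mono mult_left_mono) auto
      then show "16 * (1 + \<mu> * (a + c1 * sqrt (s n))\<^sup>2) \<le> 16 * (1 + \<mu> * (a + c1 * sqrt N)\<^sup>2)"
        using \<mu> by simp
      show "0 < 16 * (1 + \<mu> * (a + c1 * sqrt N)\<^sup>2) * (16 * (1 + \<mu> * (a + c1 * sqrt (s n))\<^sup>2))"
        using \<mu> by (intro mult_pos_pos) (auto intro: add_pos_nonneg)
    qed (use \<mu> in auto)
    ultimately show ?thesis unfolding G_def m_def s_def by linarith
  qed
qed

end

section \<open>Pseudo-inverses and measurable inversion\<close>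

lemma continuous_on_matrix_mult:
  fixes f :: "'a::topological_space \<Rightarrow> real^'n^'m" and g :: "'a \<Rightarrow> real^'k^'n"
  assumes "continuous_on S f" "continuous_on S g"
  shows "continuous_on S (\<lambda>x. f x ** g x)"
  unfolding matrix_matrix_mult_def
  by (intro continuous_on_vec_lambda continuous_intros continuous_on_component assms)

lemma continuous_on_transpose:
  fixes f :: "'a::topological_space \<Rightarrow> real^'n^'m"
  assumes "continuous_on S f"
  shows "continuous_on S (\<lambda>x. transpose (f x))"
  unfolding transpose_def by (intro continuous_on_vec_lambda continuous_intros continuous_on_component assms)

text \<open>The preimage of a compact set is a projection of a closed set along a compact factor, hence
closed, and every open set is a countable union of compact ones. This yields measurability of
inversion and pseudo-inversion, the latter being discontinuous, from their defining equations
alone.\<close>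

lemma closed_graph_borel_measurable:
  fixes f :: "'a::euclidean_space \<Rightarrow> 'b::euclidean_space"
  assumes "closed {(y, x). y = f x}"
  shows "f \<in> borel_measurable borel"
proof (rule borel_measurableI)
  fix S :: "'b set" assume "open S"
  then obtain C :: "nat \<Rightarrow> 'b set" where C: "\<And>n. compact (C n)" "S = (\<Union>n. C n)"
    by (metis open_Union_compact_subsets)
  have "f -` C n = {x. \<exists>y. y \<in> C n \<and> (y, x) \<in> {(y, x). y = f x}}" for n by auto
  then have "closed (f -` C n)" for n
    using closed_compact_projection[OF C(1) assms] by simp
  then have "(\<Union>n. f -` C n) \<in> sets borel" by (intro sets.countable_UN) auto
  then show "f -` S \<inter> space borel \<in> sets borel" by (simp add: C(2) vimage_Union vimage_UN)
qed

lemma borel_measurable_resolvent: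
  "(\<lambda>Y :: real^'m^'n. matrix_inv (mat 1 + Y ** transpose Y)) \<in> borel_measurable borel"
proof (rule closed_graph_borel_measurable)
  have inv: "invertible (mat 1 + Y ** transpose Y)" for Y :: "real^'m^'n"
    using resolvent_inverse[of 1 Y] by simp
  have "B = matrix_inv (mat 1 + Y ** transpose Y) \<longleftrightarrow> (mat 1 + Y ** transpose Y) ** B = mat 1"
    for B :: "real^'n^'n" and Y :: "real^'m^'n"
    using matrix_inv_right[OF inv[of Y]] by (metis matrix_mul_assoc matrix_mul_lid matrix_mul_rid)
  then have "{(B, Y). B = matrix_inv (mat 1 + Y ** transpose Y)}
      = {p :: (real^'n^'n) \<times> (real^'m^'n). (mat 1 + snd p ** transpose (snd p)) ** fst p = mat 1}"
    by auto
  also have "closed \<dots>"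
    by (intro closed_Collect_eq continuous_on_matrix_mult continuous_on_transpose continuous_intros)
  finally show "closed {(B :: real^'n^'n, Y :: real^'m^'n). B = matrix_inv (mat 1 + Y ** transpose Y)}" .
qed

definition penrose :: "real^'n^'m \<Rightarrow> real^'m^'n \<Rightarrow> bool" where
  "penrose A B \<longleftrightarrow> A ** B ** A = A \<and> B ** A ** B = B \<and>
     transpose (A ** B) = A ** B \<and> transpose (B ** A) = B ** A"

lemma penrose_unique:
  assumes B: "penrose A B" and B': "penrose A B'"
  shows "B = B'"
proof -
  have "A ** B = (A ** B') ** (A ** B)"
    using B' by (simp add: penrose_def matrix_mul_assoc)
  also have "\<dots> = transpose ((A ** B) ** (A ** B'))"
    using B B' by (simp add: penrose_def matrix_transpose_mul[of "A ** B" "A ** B'"])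
  also have "(A ** B) ** (A ** B') = A ** B'"
    using B by (simp add: penrose_def matrix_mul_assoc)
  also have "transpose (A ** B') = A ** B'" using B' by (simp add: penrose_def)
  finally have 1: "A ** B = A ** B'" .
  have "B ** A = (B ** A) ** (B' ** A)"
    using B' by (simp add: penrose_def matrix_mul_assoc[symmetric])
  also have "\<dots> = transpose ((B' ** A) ** (B ** A))"
    using B B' by (simp add: penrose_def matrix_transpose_mul[of "B' ** A" "B ** A"])
  also have "(B' ** A) ** (B ** A) = B' ** A"
    using B by (simp add: penrose_def matrix_mul_assoc[symmetric])
  also have "transpose (B' ** A) = B' ** A" using B' by (simp add: penrose_def)
  finally have 2: "B ** A = B' ** A" .
  have "B = B ** A ** B" using B by (simp add: penrose_def)
  also have "\<dots> = B' ** (A ** B)" by (simp add: 2 matrix_mul_assoc)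
  also have "\<dots> = B' ** A ** B'" by (simp add: 1 matrix_mul_assoc)
  also have "\<dots> = B'" using B' by (simp add: penrose_def)
  finally show ?thesis .
qed

lemma orthogonal_projector_exists:
  fixes S :: "(real^'n) set"
  assumes "subspace S"
  obtains Q :: "real^'n^'n" where "transpose Q = Q" "\<And>x. x \<in> S \<Longrightarrow> Q *v x = x" "\<And>x. Q *v x \<in> S"
proof -
  obtain B where B: "B \<subseteq> S" "pairwise orthogonal B" "\<And>x. x \<in> B \<Longrightarrow> norm x = 1"
    "independent B" "span B = S"
    using orthonormal_basis_subspace[OF assms] by metis
  have fin: "finite B" using B(4) by (rule independent_imp_finite)
  define Q :: "real^'n^'n" where "Q = (\<Sum>b\<in>B. outer b b)"
  have Qx: "Q *v x = (\<Sum>b\<in>B. (b \<bullet> x) *\<^sub>R b)" for x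
    by (simp add: Q_def vec_eq_iff matrix_vector_mult_def outer_def inner_vec_def sum_distrib_right
        sum_distrib_left mult.commute mult.left_commute) (intro allI sum.swap)
  have "Q *v x = x" if "x \<in> S" for x
  proof -
    have "x \<in> span B" using that B(5) by simp
    then show ?thesis
    proof (induction rule: span_induct_alt)
      case (step c b y)
      have "Q *v b = (\<Sum>b'\<in>B. if b' = b then b else 0)" unfolding Qx
        using B(2) B(3)[OF step(1)] step(1)
        by (intro sum.cong refl) (auto simp: pairwise_def orthogonal_def norm_eq_1)
      also have "\<dots> = b" using step(1) fin by simp
      finally show ?case using step(2)
        by (simp add: matrix_vector_right_distrib matrix_vector_mult_scaleR)
    qed simp
  qed
  moreover have "Q *v x \<in> S" for x
    unfolding Qx using B(1) assms by (intro subspace_sum subspace_scale) auto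
  moreover have "transpose Q = Q"
    by (simp add: Q_def vec_eq_iff transpose_def outer_def mult.commute)
  ultimately show ?thesis using that by blast
qed

text \<open>With \<open>Q\<close> the orthogonal projector onto the kernel of \<open>C\<close>, the matrix
\<open>C + Q\<close> is invertible, and its inverse minus \<open>Q\<close> satisfies the Penrose
equations.\<close>

lemma penrose_gram_exists:
  fixes T :: "real^'j^'n"
  shows "\<exists>B. penrose (T ** transpose T) B"
proof -
  define C where "C = T ** transpose T"
  have Ct: "transpose C = C" by (simp add: C_def matrix_transpose_mul)
  have ker2: "C *v x = 0" if "C *v (C *v x) = 0" for x
  proof -
    have "(C *v x) \<bullet> (C *v x) = x \<bullet> (C *v (C *v x))"
      using inner_transpose_mult[of C x "C *v x"] by (simp add: Ct)
    then show ?thesis using that by simp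
  qed
  have "subspace {x. C *v x = 0}"
    by (simp add: subspace_def matrix_vector_right_distrib matrix_vector_mult_scaleR)
  then obtain Q where Q: "transpose Q = Q" "\<And>x. C *v x = 0 \<Longrightarrow> Q *v x = x" "\<And>x. C *v (Q *v x) = 0"
    by (rule orthogonal_projector_exists) auto
  have CQ: "C ** Q = 0" using Q(3) by (simp add: matrix_eq matrix_vector_mul_assoc)
  have "transpose (C ** Q) = 0" unfolding CQ by (simp add: vec_eq_iff transpose_def)
  then have QC: "Q ** C = 0" by (simp add: matrix_transpose_mul Ct Q(1))
  have QQ: "Q ** Q = Q" using Q(2,3) by (simp add: matrix_eq matrix_vector_mul_assoc[symmetric])
  have "x = 0" if x: "(C + Q) *v x = 0" for x
  proof -
    \<comment> \<open>Applying \<open>C\<close> once more removes \<open>Q x\<close>, and \<open>C\<close> and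
       \<open>C\<^sup>2\<close> have the same kernel.\<close>
    have "C *v ((C + Q) *v x) = 0" using x by simp
    then have "C *v (C *v x) = 0"
      by (simp add: matrix_vector_mult_add_rdistrib matrix_vector_right_distrib Q(3))
    then have "C *v x = 0" by (rule ker2)
    with x Q(2)[OF this] show ?thesis by (simp add: matrix_vector_mult_add_rdistrib)
  qed
  then have "inj ((*v) (C + Q))" by (simp add: linear_injective_0)
  then have "invertible (C + Q)"
    by (metis invertible_left_inverse matrix_left_invertible_injective)
  then obtain R where R: "(C + Q) ** R = mat 1" "R ** (C + Q) = mat 1" by (auto simp: invertible_def)
  have ma: "(Y + Z) ** X = Y ** X + Z ** X" for X Y Z :: "real^'n^'n"
    by (simp add: vec_eq_iff matrix_matrix_mult_def algebra_simps sum.distrib)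
  have RQ: "R ** Q = Q"
  proof -
    have "R ** Q = R ** ((C + Q) ** Q)" by (simp add: ma CQ QQ)
    then show ?thesis by (simp add: matrix_mul_assoc R)
  qed
  have QR: "Q ** R = Q"
  proof -
    have "Q ** R = (Q ** (C + Q)) ** R" by (simp add: matrix_add_ldistrib QC QQ)
    then show ?thesis by (simp add: matrix_mul_assoc[symmetric] R)
  qed
  have md: "X ** (Y - Z) = X ** Y - X ** Z" for X Y Z :: "real^'n^'n"
    by (simp add: vec_eq_iff matrix_matrix_mult_def algebra_simps sum_subtractf)
  have CR: "C ** R = mat 1 - Q" using R(1) QR by (simp add: ma eq_diff_eq)
  have RC: "R ** C = mat 1 - Q" using R(2) RQ by (simp add: matrix_add_ldistrib eq_diff_eq)
  have CB: "C ** (R - Q) = mat 1 - Q" by (simp add: md CR CQ)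
  have BC: "(R - Q) ** C = mat 1 - Q" by (simp add: matrix_mult_diff_left RC QC)
  have "penrose C (R - Q)"
    unfolding penrose_def CB BC using Q(1)
    by (simp add: matrix_mult_diff_left md QC QR QQ CQ transpose_mat)
      (simp add: vec_eq_iff transpose_def mat_def)
  then show ?thesis unfolding C_def by blast
qed

lemma pinv_gram_iff:
  fixes T :: "real^'j^'n"
  shows "B = pinv (T ** transpose T) \<longleftrightarrow> penrose (T ** transpose T) B"
proof -
  have "\<exists>!B. penrose (T ** transpose T) B"
    using penrose_gram_exists penrose_unique by blast
  from theI'[OF this] show ?thesis
    unfolding pinv_def penrose_def[symmetric] using penrose_unique by blast
qed

lemma borel_measurable_pinv_gram:
  "(\<lambda>T :: real^'j^'n. pinv (T ** transpose T)) \<in> borel_measurable borel"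
proof (rule closed_graph_borel_measurable)
  have "{(B, T). B = pinv (T ** transpose T)}
      = {p :: (real^'n^'n) \<times> (real^'j^'n). penrose (snd p ** transpose (snd p)) (fst p)}"
    by (auto simp: pinv_gram_iff)
  also have "closed \<dots>" unfolding penrose_def
    by (intro closed_Collect_conj closed_Collect_eq continuous_on_matrix_mult continuous_on_transpose
        continuous_intros)
  finally show "closed {(B :: real^'n^'n, T :: real^'j^'n). B = pinv (T ** transpose T)}" .
qed

section \<open>Measurability of the iteration\<close>

lemma borel_measurable_vecI:
  fixes f :: "'w \<Rightarrow> 'b::euclidean_space^'n"
  assumes "\<And>i. (\<lambda>x. f x $ i) \<in> borel_measurable N"
  shows "f \<in> borel_measurable N"
proof (rule borel_measurable_euclidean_space[THEN iffD2], rule ballI)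
  fix b :: "'b^'n" assume "b \<in> Basis"
  then obtain i u where "b = axis i u" by (auto simp: Basis_vec_def)
  then have "(\<lambda>x. f x \<bullet> b) = (\<lambda>x. (f x $ i) \<bullet> u)" by (simp add: inner_axis)
  then show "(\<lambda>x. f x \<bullet> b) \<in> borel_measurable N" using assms by simp
qed

lemma borel_measurable_component:
  fixes f :: "'w \<Rightarrow> 'b::euclidean_space^'n"
  assumes "f \<in> borel_measurable N"
  shows "(\<lambda>x. f x $ i) \<in> borel_measurable N"
  by (rule borel_measurable_continuous_on[OF _ assms]) (intro continuous_on_component continuous_intros)

lemma borel_measurable_matrix_mult:
  fixes f :: "'w \<Rightarrow> real^'n^'m" and g :: "'w \<Rightarrow> real^'k^'n"
  assumes "f \<in> borel_measurable N" "g \<in> borel_measurable N"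
  shows "(\<lambda>x. f x ** g x) \<in> borel_measurable N"
  unfolding matrix_matrix_mult_def
  by (intro borel_measurable_vecI, simp only: vec_lambda_beta)
    (intro borel_measurable_sum borel_measurable_times borel_measurable_component assms)

lemma borel_measurable_matrix_vector_mult:
  fixes f :: "'w \<Rightarrow> real^'n^'m" and g :: "'w \<Rightarrow> real^'n"
  assumes "f \<in> borel_measurable N" "g \<in> borel_measurable N"
  shows "(\<lambda>x. f x *v g x) \<in> borel_measurable N"
  unfolding matrix_vector_mult_def
  by (intro borel_measurable_vecI, simp only: vec_lambda_beta)
    (intro borel_measurable_sum borel_measurable_times borel_measurable_component assms)

lemma borel_measurable_transpose:
  fixes f :: "'w \<Rightarrow> real^'n^'m"
  assumes "f \<in> borel_measurable N"
  shows "(\<lambda>x. transpose (f x)) \<in> borel_measurable N"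
  unfolding transpose_def
  by (intro borel_measurable_vecI, simp only: vec_lambda_beta) (intro borel_measurable_component assms)

lemma borel_measurable_vec_times:
  fixes f g :: "'w \<Rightarrow> real^'n"
  assumes "f \<in> borel_measurable N" "g \<in> borel_measurable N"
  shows "(\<lambda>x. f x * g x) \<in> borel_measurable N"
  by (intro borel_measurable_vecI, simp only: vector_mult_component)
    (intro borel_measurable_times borel_measurable_component assms)

lemma borel_measurable_cols:
  fixes f :: "'w \<Rightarrow> 'j::finite \<Rightarrow> real^'n"
  assumes "\<And>j. (\<lambda>x. f x j) \<in> borel_measurable N"
  shows "(\<lambda>x. cols (f x)) \<in> borel_measurable N"
  unfolding cols_def
  by (intro borel_measurable_vecI, simp only: vec_lambda_beta)
    (intro borel_measurable_divide borel_measurable_const borel_measurable_component assms)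

lemma borel_measurable_ens_mean:
  fixes f :: "'w \<Rightarrow> 'j::finite \<Rightarrow> real^'n"
  assumes "\<And>j. (\<lambda>x. f x j) \<in> borel_measurable N"
  shows "(\<lambda>x. ens_mean (f x)) \<in> borel_measurable N"
  unfolding ens_mean_def using assms by measurable

lemma borel_measurable_dev:
  fixes f :: "'w \<Rightarrow> 'j::finite \<Rightarrow> real^'n"
  assumes "\<And>j. (\<lambda>x. f x j) \<in> borel_measurable N"
  shows "(\<lambda>x. dev (f x) j) \<in> borel_measurable N"
  unfolding dev_def using assms borel_measurable_ens_mean[OF assms] by (intro borel_measurable_diff)

text \<open>Convexity yields continuity of the spectral norm as well as convexity of its balls.\<close>

lemma convex_on_spec_norm: "convex_on UNIV (spec_norm :: real^'n^'m \<Rightarrow> real)"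
proof -
  have "spec_norm (t *\<^sub>R A + s *\<^sub>R B) \<le> t * spec_norm A + s * spec_norm B"
    if "0 \<le> t" "0 \<le> s" for A B :: "real^'n^'m" and s t
  proof (rule spec_norm_le)
    fix x
    have "norm ((t *\<^sub>R A + s *\<^sub>R B) *v x) \<le> t * norm (A *v x) + s * norm (B *v x)"
      using that norm_triangle_ineq[of "t *\<^sub>R (A *v x)" "s *\<^sub>R (B *v x)"]
      by (simp add: matrix_vector_mult_add_rdistrib scaleR_matrix_vector_assoc[symmetric])
    also have "\<dots> \<le> t * (spec_norm A * norm x) + s * (spec_norm B * norm x)"
      using that by (intro add_mono mult_left_mono norm_mult_le_spec_norm)
    finally show "norm ((t *\<^sub>R A + s *\<^sub>R B) *v x) \<le> (t * spec_norm A + s * spec_norm B) * norm x"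
      by (simp add: algebra_simps)
  qed
  then show ?thesis by (intro convex_onI) auto
qed

lemma continuous_on_spec_norm: "continuous_on UNIV (spec_norm :: real^'n^'m \<Rightarrow> real)"
  by (rule convex_on_continuous[OF open_UNIV convex_on_spec_norm])

lemma spec_norm_ball:
  shows "closed {B :: real^'n^'m. spec_norm B \<le> b}" "convex {B :: real^'n^'m. spec_norm B \<le> b}"
proof -
  show "closed {B :: real^'n^'m. spec_norm B \<le> b}"
    by (intro closed_Collect_le continuous_on_spec_norm continuous_on_const)
  show "convex {B :: real^'n^'m. spec_norm B \<le> b}"
  proof (rule convexI)
    fix B B' :: "real^'n^'m" and t s :: real
    assume *: "B \<in> {B. spec_norm B \<le> b}" "B' \<in> {B. spec_norm B \<le> b}" "0 \<le> t" "0 \<le> s" "t + s = 1"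
    have "spec_norm (t *\<^sub>R B + s *\<^sub>R B') \<le> t * spec_norm B + s * spec_norm B'"
      using convex_on_spec_norm * unfolding convex_on_def by blast
    also have "\<dots> \<le> t * b + s * b" using * by (intro add_mono mult_left_mono) auto
    also have "\<dots> = b" using *(5) by (simp flip: distrib_right)
    finally show "t *\<^sub>R B + s *\<^sub>R B' \<in> {B. spec_norm B \<le> b}" by simp
  qed
qed

lemma borel_measurable_C_uu:
  fixes f :: "'w \<Rightarrow> 'j::finite \<Rightarrow> real^'n"
  assumes J: "CARD('j) \<ge> 2" and f: "\<And>j. (\<lambda>x. f x j) \<in> borel_measurable N"
  shows "(\<lambda>x. C_uu (f x)) \<in> borel_measurable N"
  unfolding C_uu_gram[OF J]
  by (intro borel_measurable_matrix_mult borel_measurable_transpose borel_measurable_cols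
      borel_measurable_dev f)

lemma borel_measurable_resolvent_scaled:
  fixes Y :: "'w \<Rightarrow> real^'m^'n" and h :: "'w \<Rightarrow> real"
  assumes h: "h \<in> borel_measurable N" "\<And>x. 0 \<le> h x" and Y: "Y \<in> borel_measurable N"
  shows "(\<lambda>x. matrix_inv (mat 1 + h x *\<^sub>R (Y x ** transpose (Y x)))) \<in> borel_measurable N"
proof -
  have "(c *\<^sub>R X) ** transpose (c *\<^sub>R X) = (c * c) *\<^sub>R (X ** transpose X)" for c and X :: "real^'m^'n"
    by (simp add: vec_eq_iff matrix_matrix_mult_def transpose_def sum_distrib_left algebra_simps)
  then have "h x *\<^sub>R (Y x ** transpose (Y x)) = (sqrt (h x) *\<^sub>R Y x) ** transpose (sqrt (h x) *\<^sub>R Y x)" for x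
    using h(2)[of x] by simp
  moreover have "(\<lambda>x. sqrt (h x) *\<^sub>R Y x) \<in> borel_measurable N" using h(1) Y by measurable
  ultimately show ?thesis
    using measurable_compose[OF _ borel_measurable_resolvent] by simp
qed

lemma borel_measurable_drop_ens:
  fixes e :: "'w \<Rightarrow> 'j::finite \<Rightarrow> real^'n"
  assumes "\<And>j. (\<lambda>x. e x j) \<in> borel_measurable N" "r \<in> borel_measurable N"
  shows "(\<lambda>x. drop_dev (r x) (e x) j) \<in> borel_measurable N"
    and "(\<lambda>x. drop_ens (r x) (e x) j) \<in> borel_measurable N"
  unfolding drop_ens_def drop_dev_def
  by (intro borel_measurable_add borel_measurable_vec_times borel_measurable_dev borel_measurable_ens_mean assms)+

lemma borel_measurable_mean_step:
  fixes e :: "'w \<Rightarrow> 'j::finite \<Rightarrow> real^'n" and F :: "real^'n \<Rightarrow> real^'z"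
  assumes J: "CARD('j) \<ge> 2" and e: "\<And>j. (\<lambda>x. e x j) \<in> borel_measurable N"
    and r: "r \<in> borel_measurable N" and h: "h \<in> borel_measurable N" "\<And>x. 0 \<le> h x"
    and F: "continuous_on UNIV F"
  shows "(\<lambda>x. mean_step F z (h x) (r x) (e x)) \<in> borel_measurable N"
  unfolding mean_step_def drop_C_uz_def drop_C_zz_def scatter_cols[OF J]
  by (intro borel_measurable_add borel_measurable_scaleR borel_measurable_matrix_vector_mult
      borel_measurable_matrix_mult borel_measurable_transpose borel_measurable_resolvent_scaled
      borel_measurable_cols borel_measurable_dev borel_measurable_continuous_on[OF F]
      borel_measurable_drop_ens borel_measurable_ens_mean borel_measurable_diff borel_measurable_const
      e r h)

lemma borel_measurable_dev_step:
  fixes e :: "'w \<Rightarrow> 'j::finite \<Rightarrow> real^'n" and A :: "'w \<Rightarrow> real^'n^'m"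
  assumes J: "CARD('j) \<ge> 2" and e: "\<And>j. (\<lambda>x. e x j) \<in> borel_measurable N"
    and A: "A \<in> borel_measurable N" and h: "h \<in> borel_measurable N" "\<And>x. 0 \<le> h x"
  shows "(\<lambda>x. dev_step (A x) (h x) (e x) j) \<in> borel_measurable N"
proof -
  have "A x ** C_uu (e x) ** transpose (A x) = (A x ** cols (dev (e x))) ** transpose (A x ** cols (dev (e x)))" for x
    by (simp add: C_uu_gram[OF J] matrix_transpose_mul matrix_mul_assoc)
  then show ?thesis
    unfolding dev_step_def
    by (simp only:) (intro borel_measurable_diff borel_measurable_scaleR borel_measurable_matrix_vector_mult
      borel_measurable_matrix_mult borel_measurable_transpose borel_measurable_resolvent_scaled
      borel_measurable_cols borel_measurable_dev borel_measurable_C_uu e A h J)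
qed

lemma norm_diff_stack:
  fixes X :: "real^'n^('y::finite + 'z::finite)"
  shows "(norm (X - stack B R))\<^sup>2
    = (norm ((\<chi> i. X $ Inl i) - B))\<^sup>2 + (norm ((\<chi> k. X $ Inr k) - R))\<^sup>2"
proof -
  have sq: "(norm (V :: real^'n^'k))\<^sup>2 = (\<Sum>i\<in>UNIV. V $ i \<bullet> V $ i)" for V
    by (simp add: power2_norm_eq_inner inner_vec_def)
  have "(\<Sum>s\<in>(UNIV :: ('y + 'z) set). f s) = (\<Sum>i\<in>UNIV. f (Inl i)) + (\<Sum>k\<in>UNIV. f (Inr k))" for f :: "_ \<Rightarrow> real"
    unfolding UNIV_sum by (subst sum.union_disjoint) (auto simp: sum.reindex)
  then show ?thesis unfolding sq by (simp add: stack_def)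
qed

text \<open>The lower block does not depend on the candidate, so the minimization is the projection of the
upper block onto a closed convex ball. Being unique and continuous in the data, the minimizer is
measurable.\<close>

lemma is_lin_block_closest_point:
  fixes e :: "'j::finite \<Rightarrow> real^'u" and G :: "real^'u \<Rightarrow> real^'y"
  assumes "is_lin_block G C0 MG e A"
  shows "A = closest_point {B. spec_norm B \<le> MG} (\<chi> i. (C_zu (reg_map G C0) e ** pinv (C_uu e)) $ Inl i)"
    and "spec_norm A \<le> MG"
proof -
  let ?X = "C_zu (reg_map G C0) e ** pinv (C_uu e)"
  have A: "spec_norm A \<le> MG" and min: "\<And>B. spec_norm B \<le> MG \<Longrightarrow>
      (norm (?X - stack A (inv_sqrt C0)))\<^sup>2 \<le> (norm (?X - stack B (inv_sqrt C0)))\<^sup>2"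
    using assms by (auto simp: is_lin_block_def is_arg_min_linorder)
  show "spec_norm A \<le> MG" by (rule A)
  show "A = closest_point {B. spec_norm B \<le> MG} (\<chi> i. ?X $ Inl i)"
  proof (rule closest_point_unique[OF spec_norm_ball(2,1)])
    show "\<forall>B\<in>{B. spec_norm B \<le> MG}. dist (\<chi> i. ?X $ Inl i) A \<le> dist (\<chi> i. ?X $ Inl i) B"
    proof safe
      fix B :: "real^'u^'y" assume "spec_norm B \<le> MG"
      from min[OF this] have "(norm ((\<chi> i. ?X $ Inl i) - A))\<^sup>2 \<le> (norm ((\<chi> i. ?X $ Inl i) - B))\<^sup>2"
        unfolding norm_diff_stack by simp
      then show "dist (\<chi> i. ?X $ Inl i) A \<le> dist (\<chi> i. ?X $ Inl i) B"
        unfolding dist_norm by (rule power2_le_imp_le) simp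
    qed
  qed (use A in simp)
qed

lemma borel_measurable_lin_block:
  fixes e :: "'w \<Rightarrow> 'j::finite \<Rightarrow> real^'u" and A :: "'w \<Rightarrow> real^'u^'y"
  assumes J: "CARD('j) \<ge> 2" and e: "\<And>j. (\<lambda>x. e x j) \<in> borel_measurable N"
    and F: "continuous_on UNIV (reg_map G C0)"
    and A: "\<And>x. x \<in> space N \<Longrightarrow> is_lin_block G C0 MG (e x) (A x)"
  shows "A \<in> borel_measurable N"
proof (cases "space N = {}")
  case False
  let ?S = "{B :: real^'u^'y. spec_norm B \<le> MG}"
  let ?X = "\<lambda>x. C_zu (reg_map G C0) (e x) ** pinv (C_uu (e x))"
  from False obtain x where "x \<in> space N" by auto
  from is_lin_block_closest_point(2)[OF A[OF this]] have ne: "?S \<noteq> {}" by auto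
  have "(\<lambda>x. pinv (C_uu (e x))) \<in> borel_measurable N"
    unfolding C_uu_gram[OF J]
    by (rule measurable_compose[OF _ borel_measurable_pinv_gram]) (intro borel_measurable_cols borel_measurable_dev e)
  then have X: "?X \<in> borel_measurable N"
    unfolding C_zu_def C_uz_def scatter_cols[OF J]
    by (intro borel_measurable_matrix_mult borel_measurable_transpose borel_measurable_cols
        borel_measurable_dev borel_measurable_continuous_on[OF F] e)
  have "(\<lambda>x. \<chi> i. ?X x $ Inl i) \<in> borel_measurable N"
    by (rule borel_measurable_vecI, simp only: vec_lambda_beta) (rule borel_measurable_component[OF X])
  then have "(\<lambda>x. closest_point ?S (\<chi> i. ?X x $ Inl i)) \<in> borel_measurable N"
    by (rule borel_measurable_continuous_on[OF continuous_on_closest_point[OF spec_norm_ball(2,1) ne]])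
  then show ?thesis
    using is_lin_block_closest_point(1)[OF A] by (subst measurable_cong) auto
qed (simp add: measurable_def)

lemma borel_measurable_stack:
  fixes f :: "'w \<Rightarrow> real^'n^'y" and R :: "real^'n^'z"
  assumes "f \<in> borel_measurable N"
  shows "(\<lambda>x. stack (f x) R) \<in> borel_measurable N"
proof (rule borel_measurable_vecI)
  fix s show "(\<lambda>x. stack (f x) R $ s) \<in> borel_measurable N"
    using assms by (cases s) (simp_all add: stack_def borel_measurable_component)
qed

section \<open>Independence, conditional expectation and scalar recursions\<close>

definition generated_algebra :: "'w measure \<Rightarrow> ('a \<Rightarrow> 'w \<Rightarrow> real) \<Rightarrow> 'a set \<Rightarrow> 'w measure" where
  "generated_algebra P X A = vimage_algebra (space P) (\<lambda>\<omega>. \<lambda>a\<in>A. X a \<omega>) (\<Pi>\<^sub>M a\<in>A. borel)"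

lemma space_generated_algebra [simp]: "space (generated_algebra P X A) = space P"
  by (simp add: generated_algebra_def)

lemma restrict_measurable_generated_algebra:
  "(\<lambda>\<omega>. \<lambda>a\<in>A. X a \<omega>) \<in> generated_algebra P X A \<rightarrow>\<^sub>M (\<Pi>\<^sub>M a\<in>A. borel)"
  unfolding generated_algebra_def by (rule measurable_vimage_algebra1) (auto simp: space_PiM)

lemma component_measurable_generated_algebra:
  assumes "a \<in> A"
  shows "X a \<in> borel_measurable (generated_algebra P X A)"
  using measurable_compose[OF restrict_measurable_generated_algebra measurable_component_singleton[OF assms]] assms
  by simp

lemma sets_generated_algebra:
  "sets (generated_algebra P X A) = {(\<lambda>\<omega>. \<lambda>a\<in>A. X a \<omega>) -` S \<inter> space P | S. S \<in> sets (\<Pi>\<^sub>M a\<in>A. borel)}"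
  unfolding generated_algebra_def by (rule sets_vimage_algebra2) (auto simp: space_PiM)

lemma subalgebra_generated_algebra:
  assumes "\<And>a. X a \<in> borel_measurable P"
  shows "subalgebra P (generated_algebra P X A)"
proof -
  have "(\<lambda>\<omega>. \<lambda>a\<in>A. X a \<omega>) \<in> P \<rightarrow>\<^sub>M (\<Pi>\<^sub>M a\<in>A. borel)" by (intro measurable_restrict assms)
  then show ?thesis by (auto simp: subalgebra_def sets_generated_algebra intro: measurable_sets)
qed

text \<open>Functions of disjoint groups of an independent family are independent; measurability with
respect to the generated sigma-algebra replaces an explicit factorization through the group.\<close>

lemma (in prob_space) indep_vars_integral_mult:
  fixes X :: "'i \<Rightarrow> 'a \<Rightarrow> real" and V W :: "'a \<Rightarrow> real"
  assumes ind: "indep_vars (\<lambda>_. borel) X UNIV" and AB: "A \<inter> B = {}"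
    and V: "V \<in> borel_measurable (generated_algebra M X A)" "integrable M V"
    and W: "W \<in> borel_measurable (generated_algebra M X B)" "integrable M W"
  shows "integrable M (\<lambda>\<omega>. V \<omega> * W \<omega>)" "(\<integral>\<omega>. V \<omega> * W \<omega> \<partial>M) = (\<integral>\<omega>. V \<omega> \<partial>M) * (\<integral>\<omega>. W \<omega> \<partial>M)"
proof -
  have gen: "sigma_sets (space M) {Y -` S \<inter> space M |S. S \<in> sets borel}
      \<subseteq> sigma_sets (space M) {(\<lambda>\<omega>. \<lambda>a\<in>C. X a \<omega>) -` S \<inter> space M |S. S \<in> sets (\<Pi>\<^sub>M a\<in>C. borel)}"
    if "Y \<in> borel_measurable (generated_algebra M X C)" for Y :: "'a \<Rightarrow> real" and C
    unfolding sets_generated_algebra[symmetric]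
    using measurable_sets[OF that] by (intro sigma_sets_mono') auto
  have "indep_set
      (sigma_sets (space M) {(\<lambda>\<omega>. \<lambda>a\<in>A. X a \<omega>) -` S \<inter> space M |S. S \<in> sets (\<Pi>\<^sub>M a\<in>A. borel)})
      (sigma_sets (space M) {(\<lambda>\<omega>. \<lambda>a\<in>B. X a \<omega>) -` S \<inter> space M |S. S \<in> sets (\<Pi>\<^sub>M a\<in>B. borel)})"
    using indep_var_restrict[OF ind AB subset_UNIV subset_UNIV] unfolding indep_var_eq by simp
  then have "indep_set (sigma_sets (space M) {V -` S \<inter> space M |S. S \<in> sets borel})
      (sigma_sets (space M) {W -` S \<inter> space M |S. S \<in> sets borel})"
    unfolding indep_sets2_eq using gen[OF V(1)] gen[OF W(1)] by blast
  then have "indep_var borel V borel W"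
    unfolding indep_var_eq using V(2) W(2) by auto
  from indep_var_integrable[OF this V(2) W(2)] indep_var_lebesgue_integral[OF this V(2) W(2)]
  show "integrable M (\<lambda>\<omega>. V \<omega> * W \<omega>)" "(\<integral>\<omega>. V \<omega> * W \<omega> \<partial>M) = (\<integral>\<omega>. V \<omega> \<partial>M) * (\<integral>\<omega>. W \<omega> \<partial>M)" .
qed

text \<open>Test on the set where the inequality fails. Integrability is localized to subsets of
\<open>A\<close> because the loss is known to be bounded only on events that control the initial
ensemble.\<close>

lemma (in sigma_finite_subalgebra) real_cond_exp_leI:
  fixes f g :: "'a \<Rightarrow> real"
  assumes A: "A \<in> sets F" and f: "f \<in> borel_measurable M" and g: "g \<in> borel_measurable F"
    and int: "\<And>B. B \<in> sets F \<Longrightarrow> B \<subseteq> A \<Longrightarrow> integrable M (\<lambda>x. indicator B x * f x)"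
      "\<And>B. B \<in> sets F \<Longrightarrow> B \<subseteq> A \<Longrightarrow> integrable M (\<lambda>x. indicator B x * g x)"
    and le: "\<And>B. B \<in> sets F \<Longrightarrow> B \<subseteq> A \<Longrightarrow> (\<integral>x. indicator B x * f x \<partial>M) \<le> (\<integral>x. indicator B x * g x \<partial>M)"
  shows "AE x in M. x \<in> A \<longrightarrow> real_cond_exp M F f x \<le> g x"
proof -
  let ?c = "real_cond_exp M F f"
  define B where "B = {x \<in> space F. x \<in> A \<and> g x < ?c x}"
  have c: "?c \<in> borel_measurable F" by (rule borel_measurable_cond_exp)
  have B: "B \<in> sets F" unfolding B_def using A g c by measurable
  have BA: "B \<subseteq> A" by (auto simp: B_def)
  have iB: "indicator B \<in> borel_measurable F" using B by simp
  have ic: "integrable M (\<lambda>x. indicator B x * ?c x)"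
    and eq: "(\<integral>x. indicator B x * ?c x \<partial>M) = (\<integral>x. indicator B x * f x \<partial>M)"
    using real_cond_exp_intg[OF int(1)[OF B BA] iB f] by auto
  have int': "integrable M (\<lambda>x. indicator B x * ?c x - indicator B x * g x)"
    using ic int(2)[OF B BA] by (rule Bochner_Integration.integrable_diff)
  have pos: "0 \<le> indicator B x * ?c x - indicator B x * g x" for x
    by (auto simp: B_def indicator_def)
  have "(\<integral>x. indicator B x * ?c x - indicator B x * g x \<partial>M) \<le> 0"
    using Bochner_Integration.integral_diff[OF ic int(2)[OF B BA]] eq le[OF B BA] by simp
  moreover have "0 \<le> (\<integral>x. indicator B x * ?c x - indicator B x * g x \<partial>M)"
    using pos by (intro Bochner_Integration.integral_nonneg)
  ultimately have "AE x in M. indicator B x * ?c x - indicator B x * g x = 0"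
    using integral_nonneg_eq_0_iff_AE[OF int'] pos by simp
  then show ?thesis
  proof (rule AE_mp, intro AE_I2 impI)
    fix x assume "x \<in> space M" "indicator B x * ?c x - indicator B x * g x = 0" "x \<in> A"
    then show "?c x \<le> g x"
      using subalg by (cases "x \<in> B") (auto simp: B_def subalgebra_def)
  qed
qed

text \<open>By induction the stronger bound with \<open>D / (t - q) * q ^ n\<close> subtracted on the right.\<close>

lemma perturbed_contraction:
  fixes y :: "nat \<Rightarrow> real"
  assumes y: "\<And>n. 0 \<le> y n" "\<And>n. y (Suc n) \<le> (1 - b) * y n + D * q ^ n"
    and b: "1 - b \<le> t" and q: "0 \<le> q" "q < t" and D: "0 \<le> D"
  shows "y n \<le> t ^ n * (y 0 + D / (t - q))"
proof -
  have "y n \<le> t ^ n * (y 0 + D / (t - q)) - D / (t - q) * q ^ n"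
  proof (induction n)
    case (Suc n)
    have "y (Suc n) \<le> t * y n + D * q ^ n"
      using y(2)[of n] mult_right_mono[OF b y(1)[of n]] by linarith
    also have "t * y n \<le> t * (t ^ n * (y 0 + D / (t - q)) - D / (t - q) * q ^ n)"
      using Suc q by (intro mult_left_mono) auto
    also have "t * (t ^ n * (y 0 + D / (t - q)) - D / (t - q) * q ^ n) + D * q ^ n
        = t ^ Suc n * (y 0 + D / (t - q)) - D / (t - q) * q ^ Suc n"
    proof -
      define E where "E = D / (t - q)"
      have "E * (t - q) = D" using q by (simp add: E_def)
      then have "D * q ^ n = E * t * q ^ n - E * q * q ^ n" by (simp add: left_diff_distrib flip: \<open>_ = D\<close>) (simp add: algebra_simps)
      then show ?thesis unfolding E_def[symmetric] by (simp add: algebra_simps)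
    qed
    finally show ?case by simp
  qed simp
  also have "\<dots> \<le> t ^ n * (y 0 + D / (t - q))" using D q by simp
  finally show ?thesis .
qed

text \<open>The difference is again Gaussian, so it has no atom at zero.\<close>

lemma (in prob_space) standard_normal_not_equal:
  assumes "indep_var borel X borel Y"
    "distributed M lborel X std_normal_density" "distributed M lborel Y std_normal_density"
  shows "AE \<omega> in M. X \<omega> \<noteq> Y \<omega>"
proof -
  have D: "distributed M lborel (\<lambda>\<omega>. X \<omega> - Y \<omega>) (normal_density (0 - 0) (sqrt (1\<^sup>2 + 1\<^sup>2)))"
    using assms by (intro diff_indep_normal) auto
  have "AE x in lborel. 0 < ennreal (normal_density (0 - 0) (sqrt (1\<^sup>2 + 1\<^sup>2)) x) \<longrightarrow> x \<noteq> (0 :: real)"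
    using AE_lborel_singleton[of "0 :: real"] by eventually_elim simp
  then have "AE \<omega> in M. X \<omega> - Y \<omega> \<noteq> 0"
    by (subst distributed_AE2[OF D]) auto
  then show ?thesis by eventually_elim simp
qed

lemma norm_drop_cols_transpose:
  fixes e :: "'j::finite \<Rightarrow> real^'n"
  assumes J: "CARD('j) \<ge> 2"
  shows "(norm (transpose (cols (drop_dev r e)) *v v))\<^sup>2
    = (\<Sum>i\<in>UNIV. \<Sum>k\<in>UNIV. (r $ i * r $ k) * (v $ i * v $ k * C_uu e $ i $ k))"
proof -
  have "(cols (drop_dev r e) ** transpose (cols (drop_dev r e))) $ i $ k = (r $ i * r $ k) * C_uu e $ i $ k" for i k
    by (simp add: C_uu_gram[OF J] matrix_matrix_mult_def transpose_def cols_def drop_dev_def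
        sum_distrib_left algebra_simps)
  then show ?thesis
    unfolding norm_gram by (simp add: inner_vec_def matrix_vector_mult_def sum_distrib_left algebra_simps)
qed

lemma norm_cols_transpose:
  fixes e :: "'j::finite \<Rightarrow> real^'n"
  assumes J: "CARD('j) \<ge> 2"
  shows "(norm (transpose (cols (dev e)) *v v))\<^sup>2 = (\<Sum>i\<in>UNIV. \<Sum>k\<in>UNIV. v $ i * v $ k * C_uu e $ i $ k)"
proof -
  have "drop_dev 1 e = dev e" by (simp add: fun_eq_iff drop_dev_def)
  then show ?thesis using norm_drop_cols_transpose[OF J, of 1 e v] by simp
qed

section \<open>The random iteration\<close>

definition noise :: "('w \<Rightarrow> 'j::finite \<Rightarrow> real^'n) \<Rightarrow> (nat \<Rightarrow> 'w \<Rightarrow> real^'n) \<Rightarrow> ('j \<times> 'n) + (nat \<times> 'n) \<Rightarrow> 'w \<Rightarrow> real" where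
  "noise u0 \<rho> a \<omega> = (case a of Inl (j, k) \<Rightarrow> u0 \<omega> j $ k | Inr (n, k) \<Rightarrow> \<rho> n \<omega> $ k)"

text \<open>The random iteration, with the linearized maps \<open>B\<close> entering only through their
bounds and through the fact that they are measurable functions of the ensemble;
\<open>lm\<close> is any lower bound of the loss satisfying the Polyak-Lojasiewicz inequality.\<close>

locale deki_process = smooth_least_squares F z K L A l g + prob_space Pr
  for F :: "real^'n \<Rightarrow> real^'z" and z and K L :: real and A and l :: "real^'n \<Rightarrow> real" and g
    and Pr :: "'w measure" +
  fixes u :: "nat \<Rightarrow> 'w \<Rightarrow> 'j::finite \<Rightarrow> real^'n" and \<rho> :: "nat \<Rightarrow> 'w \<Rightarrow> real^'n"
    and B :: "nat \<Rightarrow> 'w \<Rightarrow> real^'n^'z" and h h' :: "nat \<Rightarrow> 'w \<Rightarrow> real"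
    and lam \<gamma> M c \<theta> \<mu> lm :: real
  assumes J: "CARD('j) \<ge> 2"
    and indep: "indep_vars (\<lambda>_. borel) (noise (u 0) \<rho>) UNIV"
    and gauss: "\<And>j k. distributed Pr lborel (\<lambda>\<omega>. u 0 \<omega> j $ k) std_normal_density"
    and mask: "\<And>n k. prob {\<omega> \<in> space Pr. \<rho> n \<omega> $ k = 1} = lam"
      "\<And>n k. prob {\<omega> \<in> space Pr. \<rho> n \<omega> $ k = 0} = 1 - lam"
    and iter: "\<And>n \<omega>. \<omega> \<in> space Pr \<Longrightarrow>
      u (Suc n) \<omega> = (\<lambda>j. mean_step F z (h' n \<omega>) (\<rho> n \<omega>) (u n \<omega>) + dev_step (B n \<omega>) (h n \<omega>) (u n \<omega>) j)"
    and h: "\<And>n \<omega>. \<omega> \<in> space Pr \<Longrightarrow> h n \<omega> = \<theta> * inverse (spec_norm (C_uu (u n \<omega>)))"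
    and h': "\<And>n \<omega>. \<omega> \<in> space Pr \<Longrightarrow> h' n \<omega> = \<mu> * inverse (spec_norm (C_uu (u n \<omega>)))"
    and B_measurable: "\<And>n N. space N = space Pr \<Longrightarrow> (\<And>j. (\<lambda>\<omega>. u n \<omega> j) \<in> borel_measurable N) \<Longrightarrow>
      B n \<in> borel_measurable N"
    and B_bounds: "AE \<omega> in Pr. \<forall>n x. \<gamma>\<^sup>2 * (norm x)\<^sup>2 \<le> (norm (B n \<omega> *v x))\<^sup>2 \<and> norm (B n \<omega> *v x) \<le> M * norm x"
    and \<gamma>: "0 < \<gamma>" and M: "0 \<le> M" and \<theta>: "0 < \<theta>" "\<theta> * M\<^sup>2 \<le> 1" and \<mu>: "0 < \<mu>" "\<mu> * L \<le> 1"
    and lam: "0 < lam" "lam < 1"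
    and F_cont: "continuous_on UNIV F" and g_cont: "continuous_on UNIV g" and l_cont: "continuous_on UNIV l"
    and lm: "\<And>v. lm \<le> l v" and PL: "0 < c" "\<And>v. c * (l v - lm) \<le> (norm (g v))\<^sup>2"
begin

lemma noise_measurable: "noise (u 0) \<rho> a \<in> borel_measurable Pr"
  using indep by (simp add: indep_vars_def2)

text \<open>The step sizes and matrices are given only on the space of \<open>Pr\<close>; off it they are
replaced by their defining expressions, which are measurable everywhere.\<close>

lemma u_measurable_gen:
  assumes N: "space N = space Pr" and u0: "\<And>j. (\<lambda>\<omega>. u 0 \<omega> j) \<in> borel_measurable N"
    and \<rho>: "\<And>m. m < n \<Longrightarrow> \<rho> m \<in> borel_measurable N"
  shows "(\<lambda>\<omega>. u n \<omega> j) \<in> borel_measurable N"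
  using \<rho>
proof (induction n arbitrary: j)
  case (Suc n)
  then have un: "(\<lambda>\<omega>. u n \<omega> j) \<in> borel_measurable N" for j by simp
  have hh: "(\<lambda>\<omega>. c * inverse (spec_norm (C_uu (u n \<omega>)))) \<in> borel_measurable N" for c
    using borel_measurable_continuous_on[OF continuous_on_spec_norm borel_measurable_C_uu[OF J un]]
    by measurable
  have pos: "0 \<le> c * inverse (spec_norm (C_uu (u n \<omega>)))" if "0 \<le> c" for c \<omega>
    using that by (simp add: spec_norm_nonneg)
  have "(\<lambda>\<omega>. mean_step F z (\<mu> * inverse (spec_norm (C_uu (u n \<omega>)))) (\<rho> n \<omega>) (u n \<omega>)
      + dev_step (B n \<omega>) (\<theta> * inverse (spec_norm (C_uu (u n \<omega>)))) (u n \<omega>) j) \<in> borel_measurable N"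
    using \<mu> \<theta>
    by (intro borel_measurable_add borel_measurable_mean_step[OF J un _ hh _ F_cont]
        borel_measurable_dev_step[OF J un B_measurable[OF N un] hh] Suc.prems pos) auto
  moreover have "(\<lambda>\<omega>. u (Suc n) \<omega> j) \<in> borel_measurable N \<longleftrightarrow>
    (\<lambda>\<omega>. mean_step F z (\<mu> * inverse (spec_norm (C_uu (u n \<omega>)))) (\<rho> n \<omega>) (u n \<omega>)
      + dev_step (B n \<omega>) (\<theta> * inverse (spec_norm (C_uu (u n \<omega>)))) (u n \<omega>) j) \<in> borel_measurable N"
    by (rule measurable_cong) (simp add: N iter h h')
  ultimately show ?case by simp
qed (rule u0)

text \<open>This contains the information up to the ensemble at step \<open>n\<close>. It is generated by
the scalar noise variables, which makes independence from the next mask immediate.\<close>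

definition past :: "nat \<Rightarrow> 'w measure" where
  "past n = generated_algebra Pr (noise (u 0) \<rho>) (range Inl \<union> {Inr (m, k) | m k. m < n})"

lemma space_past [simp]: "space (past n) = space Pr"
  by (simp add: past_def)

lemma subalgebra_past: "subalgebra Pr (past n)"
  unfolding past_def by (rule subalgebra_generated_algebra) (rule noise_measurable)

lemma u0_measurable_past: "(\<lambda>\<omega>. u 0 \<omega> j) \<in> borel_measurable (past n)"
proof (rule borel_measurable_vecI)
  fix i
  have "noise (u 0) \<rho> (Inl (j, i)) \<in> borel_measurable (past n)"
    unfolding past_def by (rule component_measurable_generated_algebra) simp
  then show "(\<lambda>\<omega>. u 0 \<omega> j $ i) \<in> borel_measurable (past n)" by (simp add: noise_def[abs_def])
qed

lemma mask_measurable_past: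
  assumes "m < n" shows "\<rho> m \<in> borel_measurable (past n)"
proof (rule borel_measurable_vecI)
  fix i
  have "noise (u 0) \<rho> (Inr (m, i)) \<in> borel_measurable (past n)"
    unfolding past_def by (rule component_measurable_generated_algebra) (use assms in auto)
  then show "(\<lambda>\<omega>. \<rho> m \<omega> $ i) \<in> borel_measurable (past n)" by (simp add: noise_def[abs_def])
qed

lemma u_measurable_past: "(\<lambda>\<omega>. u n \<omega> j) \<in> borel_measurable (past n)"
  by (rule u_measurable_gen[OF space_past u0_measurable_past mask_measurable_past])

lemma measurable_from_past: "f \<in> borel_measurable (past n) \<Longrightarrow> f \<in> borel_measurable Pr"
  by (rule measurable_from_subalg[OF subalgebra_past])

definition initial_algebra :: "'w measure" where "initial_algebra = deki_filt Pr (u 0) \<rho> 0"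

lemma space_initial [simp]: "space initial_algebra = space Pr"
  by (simp add: initial_algebra_def deki_filt_def)

lemma sets_initial_past: "sets initial_algebra \<subseteq> sets (past n)"
  unfolding initial_algebra_def deki_filt_def
proof (rule sets_image_in_sets)
  show "(\<lambda>\<omega>. (u 0 \<omega>, \<lambda>k\<in>{..<0}. \<rho> k \<omega>)) \<in> past n \<rightarrow>\<^sub>M (\<Pi>\<^sub>M j\<in>UNIV. borel) \<Otimes>\<^sub>M (\<Pi>\<^sub>M k\<in>{..<0}. borel)"
  proof (rule measurable_Pair)
    have "(\<lambda>\<omega>. \<lambda>j\<in>UNIV. u 0 \<omega> j) \<in> past n \<rightarrow>\<^sub>M (\<Pi>\<^sub>M j\<in>UNIV. borel)"
      by (rule measurable_restrict) (rule u0_measurable_past)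
    then show "u 0 \<in> past n \<rightarrow>\<^sub>M (\<Pi>\<^sub>M j\<in>UNIV. borel)" by (simp add: restrict_UNIV)
    show "(\<lambda>\<omega>. \<lambda>k\<in>{..<0}. \<rho> k \<omega>) \<in> past n \<rightarrow>\<^sub>M (\<Pi>\<^sub>M k\<in>{..<0}. borel)"
      by (rule measurable_restrict) simp
  qed
qed simp

lemma subalgebra_initial: "subalgebra Pr initial_algebra"
  using sets_initial_past subalgebra_past by (auto simp: subalgebra_def)

lemma u0_measurable_initial: "(\<lambda>\<omega>. u 0 \<omega> j) \<in> borel_measurable initial_algebra"
proof -
  have "(\<lambda>\<omega>. (u 0 \<omega>, \<lambda>k\<in>{..<0}. \<rho> k \<omega>)) \<in> initial_algebra \<rightarrow>\<^sub>M (\<Pi>\<^sub>M j\<in>UNIV. borel) \<Otimes>\<^sub>M (\<Pi>\<^sub>M k\<in>{..<0}. borel)"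
    unfolding initial_algebra_def deki_filt_def
    by (rule measurable_vimage_algebra1) (auto simp: space_pair_measure space_PiM)
  from measurable_compose[OF measurable_compose[OF this measurable_fst] measurable_component_singleton[of j]]
  show ?thesis by simp
qed

text \<open>The bounds on the initial ensemble on which all later constants depend. On this event the
constants are deterministic functions of \<open>N\<close>.\<close>

definition well_spread :: "real \<Rightarrow> ('j \<Rightarrow> real^'n) \<Rightarrow> bool" where
  "well_spread N e \<longleftrightarrow> 0 < spec_norm (C_uu e) \<and> spec_norm (C_uu e) \<le> N \<and>
     (\<forall>i. spec_norm (C_uu e) \<le> N * C_uu e $ i $ i) \<and> l (ens_mean e) \<le> N"

lemma well_spread_measurable: "{\<omega> \<in> space Pr. well_spread N (u 0 \<omega>)} \<in> sets initial_algebra"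
proof -
  have s: "(\<lambda>\<omega>. spec_norm (C_uu (u 0 \<omega>))) \<in> borel_measurable initial_algebra"
    by (intro borel_measurable_continuous_on[OF continuous_on_spec_norm] borel_measurable_C_uu J u0_measurable_initial)
  have C: "(\<lambda>\<omega>. C_uu (u 0 \<omega>) $ i $ i) \<in> borel_measurable initial_algebra" for i
    by (intro borel_measurable_component borel_measurable_C_uu J u0_measurable_initial)
  have l: "(\<lambda>\<omega>. l (ens_mean (u 0 \<omega>))) \<in> borel_measurable initial_algebra"
    by (intro borel_measurable_continuous_on[OF l_cont] borel_measurable_ens_mean u0_measurable_initial)
  have "{\<omega> \<in> space initial_algebra. well_spread N (u 0 \<omega>)} \<in> sets initial_algebra"
    unfolding well_spread_def using s C l by measurable
  then show ?thesis by simp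
qed

lemma AE_mask: "AE \<omega> in Pr. \<forall>n k. \<rho> n \<omega> $ k = 0 \<or> \<rho> n \<omega> $ k = 1"
proof -
  have "AE \<omega> in Pr. \<rho> n \<omega> $ k = 0 \<or> \<rho> n \<omega> $ k = 1" for n k
  proof -
    have [measurable]: "(\<lambda>\<omega>. \<rho> n \<omega> $ k) \<in> borel_measurable Pr"
      using noise_measurable[of "Inr (n, k)"] by (simp add: noise_def[abs_def])
    have "prob ({\<omega> \<in> space Pr. \<rho> n \<omega> $ k = 1} \<union> {\<omega> \<in> space Pr. \<rho> n \<omega> $ k = 0}) = lam + (1 - lam)"
      by (subst finite_measure_Union) (auto simp: mask)
    then have "AE \<omega> in Pr. \<omega> \<in> {\<omega> \<in> space Pr. \<rho> n \<omega> $ k = 1} \<union> {\<omega> \<in> space Pr. \<rho> n \<omega> $ k = 0}"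
      by (subst prob_eq_1[symmetric]) auto
    then show ?thesis by eventually_elim auto
  qed
  then show ?thesis by (simp add: AE_all_countable)
qed

text \<open>For each coordinate two initial members differ almost surely, so all diagonal entries of the
initial covariance are positive and some \<open>N\<close> is large enough.\<close>

lemma AE_well_spread: "AE \<omega> in Pr. \<exists>k. well_spread (real (Suc k)) (u 0 \<omega>)"
proof -
  obtain j j' :: 'j where jj: "j \<noteq> j'"
    using J by (metis One_nat_def card_le_Suc0_iff_eq finite UNIV_I not_less_eq_eq numeral_2_eq_2)
  have "AE \<omega> in Pr. u 0 \<omega> j $ i \<noteq> u 0 \<omega> j' $ i" for i
  proof (rule standard_normal_not_equal[OF _ gauss gauss])
    have "indep_var borel (noise (u 0) \<rho> (Inl (j, i))) borel (noise (u 0) \<rho> (Inl (j', i)))"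
      using indep_var_compose[OF indep_var_restrict[OF indep, of "{Inl (j, i)}" "{Inl (j', i)}"],
          of "\<lambda>f. f (Inl (j, i))" borel "\<lambda>f. f (Inl (j', i))" borel] jj
      by (simp add: comp_def)
    then show "indep_var borel (\<lambda>\<omega>. u 0 \<omega> j $ i) borel (\<lambda>\<omega>. u 0 \<omega> j' $ i)"
      by (simp add: noise_def[abs_def])
  qed
  then have "AE \<omega> in Pr. \<forall>i. u 0 \<omega> j $ i \<noteq> u 0 \<omega> j' $ i" by (simp add: AE_all_countable)
  then show ?thesis
  proof (rule AE_mp, intro AE_I2 impI)
    fix \<omega> assume ne: "\<forall>i. u 0 \<omega> j $ i \<noteq> u 0 \<omega> j' $ i"
    let ?e = "u 0 \<omega>" and ?C = "C_uu (u 0 \<omega>)"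
    have diag: "0 < ?C $ i $ i" for i
    proof -
      have "transpose (cols (dev ?e)) *v axis i 1 \<noteq> 0"
      proof
        assume "transpose (cols (dev ?e)) *v axis i 1 = 0"
        then have "\<forall>j. cols (dev ?e) $ i $ j = 0"
          by (simp add: vec_eq_iff matrix_vector_mult_basis column_def transpose_def)
        then have "dev ?e j $ i = 0" "dev ?e j' $ i = 0" using J by (auto simp: cols_def)
        then have "u 0 \<omega> j $ i = u 0 \<omega> j' $ i" by (simp add: dev_def)
        then show False using ne by blast
      qed
      then have "0 < (norm (transpose (cols (dev ?e)) *v axis i 1))\<^sup>2" by simp
      then show ?thesis unfolding spec_norm_gram_diag C_uu_gram[OF J] .
    qed
    define s where "s = spec_norm ?C"
    \<comment> \<open>The sum serves as an upper bound for the largest ratio.\<close>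
    obtain k :: nat where k: "max (max s (l (ens_mean ?e))) (\<Sum>i\<in>UNIV. s / ?C $ i $ i) \<le> real k"
      using real_arch_simple by blast
    have s: "0 < s" unfolding s_def by (rule less_le_trans[OF diag order_trans[OF abs_ge_self matrix_entry_le_spec_norm]])
    have "s \<le> real (Suc k) * ?C $ i $ i" for i
    proof -
      have "s / ?C $ i $ i \<le> (\<Sum>i\<in>UNIV. s / ?C $ i $ i)"
        using s diag by (intro member_le_sum) (auto intro: less_imp_le)
      also have "\<dots> \<le> real (Suc k)" using k by simp
      finally show ?thesis using diag[of i] by (simp only: pos_divide_le_eq)
    qed
    then show "\<exists>k. well_spread (real (Suc k)) ?e"
      using s k by (intro exI[of _ k]) (auto simp: well_spread_def s_def)
  qed
qed

lemma trajectory_constants: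
  assumes N: "0 < N"
  obtains q \<kappa> \<Lambda> b D where "0 < q" "q < 1" "0 < \<kappa>" "0 < b" "0 \<le> D"
    "AE \<omega> in Pr. well_spread N (u 0 \<omega>) \<longrightarrow> (\<forall>n. 0 < spec_norm (C_uu (u n \<omega>)) \<and>
      (\<forall>i. spec_norm (C_uu (u n \<omega>)) \<le> \<kappa> * C_uu (u n \<omega>) $ i $ i) \<and> l (ens_mean (u n \<omega>)) \<le> \<Lambda> \<and>
      l (ens_mean (u (Suc n) \<omega>)) \<le> l (ens_mean (u n \<omega>)) + D * q ^ n
        - b * ((norm (transpose (cols (drop_dev (\<rho> n \<omega>) (u n \<omega>))) *v g (ens_mean (u n \<omega>))))\<^sup>2
               / spec_norm (C_uu (u n \<omega>))))"
proof -
  define q where "q = 1 / (1 + 2 * \<theta> * \<gamma>\<^sup>2)"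
  define c1 where "c1 = 2 * K * (real CARD('j))\<^sup>2"
  define \<Lambda> where "\<Lambda> = N * exp (2 * \<mu> * c1\<^sup>2 * N / (1 - q))"
  define a where "a = 2 * sqrt (2 * \<Lambda>) + sqrt L + K"
  have "0 < 2 * \<theta> * \<gamma>\<^sup>2" using \<theta> \<gamma> by simp
  then have q: "0 < q" "q < 1" by (simp_all add: q_def)
  have \<Lambda>: "0 < \<Lambda>" using N by (simp add: \<Lambda>_def)
  have "AE \<omega> in Pr. \<omega> \<in> space Pr" by (rule AE_space)
  with AE_mask B_bounds have path: "AE \<omega> in Pr. well_spread N (u 0 \<omega>) \<longrightarrow> (\<forall>n. 0 < spec_norm (C_uu (u n \<omega>)) \<and>
      (\<forall>i. spec_norm (C_uu (u n \<omega>)) \<le> ((1 / (1 - sqrt q))\<^sup>2 * N) * C_uu (u n \<omega>) $ i $ i) \<and> l (ens_mean (u n \<omega>)) \<le> \<Lambda> \<and>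
      l (ens_mean (u (Suc n) \<omega>)) \<le> l (ens_mean (u n \<omega>)) + (3 * \<mu> * c1\<^sup>2 * N * \<Lambda>) * q ^ n
        - (\<mu> / (16 * (1 + \<mu> * (a + c1 * sqrt N)\<^sup>2)))
          * ((norm (transpose (cols (drop_dev (\<rho> n \<omega>) (u n \<omega>))) *v g (ens_mean (u n \<omega>))))\<^sup>2
               / spec_norm (C_uu (u n \<omega>))))"
  proof eventually_elim
    case (elim \<omega>)
    have r: "\<rho> n \<omega> $ i = 0 \<or> \<rho> n \<omega> $ i = 1" for n i using elim(1) by blast
    have B: "\<gamma>\<^sup>2 * (norm x)\<^sup>2 \<le> (norm (B n \<omega> *v x))\<^sup>2" "norm (B n \<omega> *v x) \<le> M * norm x" for n x
      using elim(2) by auto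
    show ?case
    proof (intro impI allI conjI)
      assume "well_spread N (u 0 \<omega>)"
      then have G: "0 < spec_norm (C_uu (u 0 \<omega>))" "spec_norm (C_uu (u 0 \<omega>)) \<le> N"
        "spec_norm (C_uu (u 0 \<omega>)) \<le> N * C_uu (u 0 \<omega>) $ i $ i" "l (ens_mean (u 0 \<omega>)) \<le> N" for i
        by (auto simp: well_spread_def)
      note tb = trajectory_bounds[where e = "\<lambda>n. u n \<omega>" and r = "\<lambda>n. \<rho> n \<omega>" and B = "\<lambda>n. B n \<omega>"
          and h = "\<lambda>n. h n \<omega>" and h' = "\<lambda>n. h' n \<omega>" and \<theta> = \<theta> and \<mu> = \<mu> and \<gamma> = \<gamma> and M = M and N = N,
          OF J iter[OF elim(3)] h[OF elim(3)] h'[OF elim(3)] r B \<gamma> M \<theta> \<mu> G, folded q_def c1_def,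
          folded \<Lambda>_def, folded a_def]
      show "0 < spec_norm (C_uu (u n \<omega>))" for n by (rule tb(1))
      show "spec_norm (C_uu (u n \<omega>)) \<le> ((1 / (1 - sqrt q))\<^sup>2 * N) * C_uu (u n \<omega>) $ i $ i" for n i
        by (rule tb(2))
      show "l (ens_mean (u n \<omega>)) \<le> \<Lambda>" for n by (rule tb(3))
      show "l (ens_mean (u (Suc n) \<omega>)) \<le> l (ens_mean (u n \<omega>)) + (3 * \<mu> * c1\<^sup>2 * N * \<Lambda>) * q ^ n
        - (\<mu> / (16 * (1 + \<mu> * (a + c1 * sqrt N)\<^sup>2)))
          * ((norm (transpose (cols (drop_dev (\<rho> n \<omega>) (u n \<omega>))) *v g (ens_mean (u n \<omega>))))\<^sup>2
               / spec_norm (C_uu (u n \<omega>)))" for n by (rule tb(4))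
    qed
  qed
  show ?thesis
  proof (rule that[OF q _ _ _ path])
    show "0 < (1 / (1 - sqrt q))\<^sup>2 * N" using q N by simp
    show "0 < \<mu> / (16 * (1 + \<mu> * (a + c1 * sqrt N)\<^sup>2))"
      using \<mu> by (intro divide_pos_pos mult_pos_pos add_pos_nonneg) auto
    show "0 \<le> 3 * \<mu> * c1\<^sup>2 * N * \<Lambda>" using \<mu> N \<Lambda> by simp
  qed
qed

lemma mask_measurable: "(\<lambda>\<omega>. \<rho> n \<omega> $ k) \<in> borel_measurable Pr"
  using noise_measurable[of "Inr (n, k)"] by (simp add: noise_def[abs_def])

lemma integrable_mask: "integrable Pr (\<lambda>\<omega>. \<rho> n \<omega> $ k)"
proof (rule integrable_const_bound[of _ 1])
  show "AE \<omega> in Pr. norm (\<rho> n \<omega> $ k) \<le> 1"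
    using AE_mask
  proof eventually_elim
    case (elim \<omega>)
    then have "\<rho> n \<omega> $ k = 0 \<or> \<rho> n \<omega> $ k = 1" by blast
    then show ?case by auto
  qed
qed (rule mask_measurable)

lemma expectation_mask: "(\<integral>\<omega>. \<rho> n \<omega> $ k \<partial>Pr) = lam"
proof -
  have [measurable]: "(\<lambda>\<omega>. \<rho> n \<omega> $ k) \<in> borel_measurable Pr" by (rule mask_measurable)
  have "(\<integral>\<omega>. \<rho> n \<omega> $ k \<partial>Pr) = (\<integral>\<omega>. indicator {\<omega> \<in> space Pr. \<rho> n \<omega> $ k = 1} \<omega> \<partial>Pr)"
  proof (rule integral_cong_AE)
    have "AE \<omega> in Pr. \<omega> \<in> space Pr" by (rule AE_space)
    with AE_mask show "AE \<omega> in Pr. \<rho> n \<omega> $ k = indicator {\<omega> \<in> space Pr. \<rho> n \<omega> $ k = 1} \<omega>"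
    proof eventually_elim
      case (elim \<omega>)
      then have "\<rho> n \<omega> $ k = 0 \<or> \<rho> n \<omega> $ k = 1" by blast
      then show ?case using elim(2) by auto
    qed
  qed measurable
  also have "\<dots> = lam" using mask(1)[of n k] by simp
  finally show ?thesis .
qed

text \<open>The whole effect of dropout on the mean: diagonal pairs have weight \<open>lam\<close>, all
others only \<open>lam\<^sup>2\<close>, which leaves a surplus \<open>lam - lam\<^sup>2\<close>
on the diagonal.\<close>

lemma mask_pair:
  assumes W: "W \<in> borel_measurable (past n)" "integrable Pr W"
  shows "integrable Pr (\<lambda>\<omega>. (\<rho> n \<omega> $ i * \<rho> n \<omega> $ k) * W \<omega>)"
    and "(\<integral>\<omega>. (\<rho> n \<omega> $ i * \<rho> n \<omega> $ k) * W \<omega> \<partial>Pr) = (if i = k then lam else lam\<^sup>2) * (\<integral>\<omega>. W \<omega> \<partial>Pr)"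
proof -
  let ?X = "noise (u 0) \<rho>"
  let ?V = "\<lambda>\<omega>. \<rho> n \<omega> $ i * \<rho> n \<omega> $ k"
  have comp: "(\<lambda>\<omega>. \<rho> n \<omega> $ k) \<in> borel_measurable (generated_algebra Pr ?X C)" if "Inr (n, k) \<in> C" for k C
    using component_measurable_generated_algebra[OF that, of ?X Pr] by (simp add: noise_def[abs_def])
  have V: "integrable Pr ?V \<and> (\<integral>\<omega>. ?V \<omega> \<partial>Pr) = (if i = k then lam else lam\<^sup>2)"
  proof (cases "i = k")
    case True
    have ae: "AE \<omega> in Pr. ?V \<omega> = \<rho> n \<omega> $ k"
      using AE_mask
    proof eventually_elim
      case (elim \<omega>)
      then have "\<rho> n \<omega> $ k = 0 \<or> \<rho> n \<omega> $ k = 1" by blast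
      then show ?case using True by auto
    qed
    have m: "?V \<in> borel_measurable Pr" using mask_measurable by measurable
    show ?thesis
      using integrable_cong_AE[OF m mask_measurable ae] integral_cong_AE[OF m mask_measurable ae] True
      by (simp add: integrable_mask expectation_mask)
  next
    case False
    then show ?thesis
      using indep_vars_integral_mult[OF indep, of "{Inr (n, i)}" "{Inr (n, k)}",
          OF _ comp integrable_mask comp integrable_mask]
      by (simp add: expectation_mask power2_eq_square)
  qed
  have Vm: "?V \<in> borel_measurable (generated_algebra Pr ?X {Inr (n, k) | k. True})"
    by (intro borel_measurable_times comp) auto
  have disj: "{Inr (n, k) | k. True} \<inter> (range Inl \<union> {Inr (m, k) | m k. m < n}) = {}" by auto
  note mult = indep_vars_integral_mult[OF indep disj Vm conjunct1[OF V] W[unfolded past_def]]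
  show "integrable Pr (\<lambda>\<omega>. ?V \<omega> * W \<omega>)" by (rule mult(1))
  show "(\<integral>\<omega>. ?V \<omega> * W \<omega> \<partial>Pr) = (if i = k then lam else lam\<^sup>2) * (\<integral>\<omega>. W \<omega> \<partial>Pr)"
    using mult(2) V by simp
qed

lemma l_measurable_past: "(\<lambda>\<omega>. l (ens_mean (u n \<omega>))) \<in> borel_measurable (past n)"
  by (intro borel_measurable_continuous_on[OF l_cont] borel_measurable_ens_mean u_measurable_past)

text \<open>Integrating the pathwise bounds over an event \<open>S\<close> of the initial sigma-algebra
gives a scalar recursion. With \<open>W i k = g_i g_k C(i,k) / \<parallel>C\<parallel>\<close>,
the expected decrease is \<open>lam\<^sup>2\<close> times the sum of all \<open>W i k\<close>,
which is nonnegative as a quadratic form of the covariance, plus \<open>lam -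
lam\<^sup>2\<close> times the sum of the \<open>W i i\<close>, which dominates the excess loss.
The rate and the constant do not depend on \<open>S\<close>.\<close>

lemma localized_decay:
  assumes N: "0 < N"
  shows "\<exists>\<beta> C. 0 < \<beta> \<and> \<beta> < 1 \<and> (\<forall>S\<in>sets initial_algebra. S \<subseteq> {\<omega> \<in> space Pr. well_spread N (u 0 \<omega>)} \<longrightarrow> (\<forall>n.
    integrable Pr (\<lambda>\<omega>. indicator S \<omega> * (l (ens_mean (u n \<omega>)) - lm)) \<and>
    (\<integral>\<omega>. indicator S \<omega> * (l (ens_mean (u n \<omega>)) - lm) \<partial>Pr)
      \<le> (1 - \<beta>) ^ n * (\<integral>\<omega>. indicator S \<omega> * (l (ens_mean (u 0 \<omega>)) - lm + C) \<partial>Pr)))"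
proof -
  obtain q \<kappa> \<Lambda> b D where q: "0 < q" "q < 1" and \<kappa>: "0 < \<kappa>" and b: "0 < b" and D: "0 \<le> D"
    and path: "AE \<omega> in Pr. well_spread N (u 0 \<omega>) \<longrightarrow> (\<forall>n. 0 < spec_norm (C_uu (u n \<omega>)) \<and>
      (\<forall>i. spec_norm (C_uu (u n \<omega>)) \<le> \<kappa> * C_uu (u n \<omega>) $ i $ i) \<and> l (ens_mean (u n \<omega>)) \<le> \<Lambda> \<and>
      l (ens_mean (u (Suc n) \<omega>)) \<le> l (ens_mean (u n \<omega>)) + D * q ^ n
        - b * ((norm (transpose (cols (drop_dev (\<rho> n \<omega>) (u n \<omega>))) *v g (ens_mean (u n \<omega>))))\<^sup>2
               / spec_norm (C_uu (u n \<omega>))))"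
    by (rule trajectory_constants[OF N])
  define \<delta> where "\<delta> = b * (lam - lam\<^sup>2) * (c / \<kappa>)"
  \<comment> \<open>The rate must exceed both the contraction factor and the decay rate \<open>q\<close> of
     the perturbation, strictly in the second case.\<close>
  define t where "t = max (1 - \<delta>) ((1 + q) / 2)"
  have "lam\<^sup>2 < lam" using lam by (simp add: power2_eq_square)
  then have \<delta>: "0 < \<delta>" using b \<kappa> PL(1) by (simp add: \<delta>_def)
  have t: "q < t" "t < 1" "0 < t" "1 - \<delta> \<le> t" using q \<delta> by (auto simp: t_def less_max_iff_disj)
  have "integrable Pr (\<lambda>\<omega>. indicator S \<omega> * (l (ens_mean (u n \<omega>)) - lm)) \<and>
    (\<integral>\<omega>. indicator S \<omega> * (l (ens_mean (u n \<omega>)) - lm) \<partial>Pr)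
      \<le> t ^ n * (\<integral>\<omega>. indicator S \<omega> * (l (ens_mean (u 0 \<omega>)) - lm + D / (t - q)) \<partial>Pr)"
    if S: "S \<in> sets initial_algebra" "S \<subseteq> {\<omega> \<in> space Pr. well_spread N (u 0 \<omega>)}" for S n
  proof -
    define m where "m n \<omega> = ens_mean (u n \<omega>)" for n \<omega>
    define C where "C n \<omega> = C_uu (u n \<omega>)" for n \<omega>
    define f where "f n \<omega> = indicator S \<omega> * (l (m n \<omega>) - lm)" for n \<omega>
    define W where "W n i k \<omega> = indicator S \<omega> * (g (m n \<omega>) $ i * g (m n \<omega>) $ k * C n \<omega> $ i $ k / spec_norm (C n \<omega>))" for n i k \<omega>
    have ae: "AE \<omega> in Pr. \<omega> \<in> S \<longrightarrow> (\<forall>n. 0 < spec_norm (C n \<omega>) \<and>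
      (\<forall>i. spec_norm (C n \<omega>) \<le> \<kappa> * C n \<omega> $ i $ i) \<and> l (m n \<omega>) \<le> \<Lambda> \<and>
      l (m (Suc n) \<omega>) \<le> l (m n \<omega>) + D * q ^ n
        - b * ((norm (transpose (cols (drop_dev (\<rho> n \<omega>) (u n \<omega>))) *v g (m n \<omega>)))\<^sup>2 / spec_norm (C n \<omega>)))"
      using path unfolding m_def C_def
    proof eventually_elim
      case (elim \<omega>)
      show ?case by (rule impI, rule elim[THEN mp]) (use S(2) in blast)
    qed
    have SP: "S \<in> sets (past n)" for n using S(1) sets_initial_past by blast
    then have iS: "indicator S \<in> borel_measurable (past n)" for n by simp
    have SPr: "S \<in> sets Pr" using S(1) subalgebra_initial by (auto simp: subalgebra_def)
    have S_int: "integrable Pr (indicator S :: 'w \<Rightarrow> real)"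
      using SPr by (intro integrable_real_indicator) (simp_all add: emeasure_eq_measure)
    have f_past: "f n \<in> borel_measurable (past n)" for n
      unfolding f_def m_def using iS[of n] l_measurable_past[of n] by measurable
    have gm: "(\<lambda>\<omega>. g (m n \<omega>)) \<in> borel_measurable (past n)" for n
      unfolding m_def by (intro borel_measurable_continuous_on[OF g_cont] borel_measurable_ens_mean u_measurable_past)
    have Cm: "(\<lambda>\<omega>. C n \<omega>) \<in> borel_measurable (past n)" for n
      unfolding C_def by (intro borel_measurable_C_uu J u_measurable_past)
    have W_past: "W n i k \<in> borel_measurable (past n)" for n i k
      unfolding W_def
      by (intro borel_measurable_times borel_measurable_divide iS borel_measurable_component gm Cm
          borel_measurable_continuous_on[OF continuous_on_spec_norm])
    have f_int: "integrable Pr (f n)" for n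
    proof (rule integrable_const_bound[of _ "\<bar>\<Lambda> - lm\<bar>"])
      show "AE \<omega> in Pr. norm (f n \<omega>) \<le> \<bar>\<Lambda> - lm\<bar>"
        using ae
      proof eventually_elim
        case (elim \<omega>)
        show ?case
        proof (cases "\<omega> \<in> S")
          case True
          with elim have "l (m n \<omega>) \<le> \<Lambda>" by blast
          then show ?thesis using True lm[of "m n \<omega>"] by (simp add: f_def)
        qed (simp add: f_def)
      qed
    qed (rule measurable_from_past[OF f_past])
    have W_int: "integrable Pr (W n i k)" for n i k
    proof (rule integrable_const_bound[of _ "2 * L * \<bar>\<Lambda>\<bar>"])
      show "AE \<omega> in Pr. norm (W n i k \<omega>) \<le> 2 * L * \<bar>\<Lambda>\<bar>"
        using ae
      proof eventually_elim
        case (elim \<omega>)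
        show ?case
        proof (cases "\<omega> \<in> S")
          case True
          with elim have s: "0 < spec_norm (C n \<omega>)" "l (m n \<omega>) \<le> \<Lambda>" by blast+
          let ?g = "g (m n \<omega>)"
          have "\<bar>?g $ i * ?g $ k\<bar> \<le> norm ?g * norm ?g"
            unfolding abs_mult by (intro mult_mono component_le_norm_cart) auto
          also have "\<dots> \<le> 2 * L * l (m n \<omega>)"
            using power_mono[OF norm_gradient[of "m n \<omega>"], of 2] L l_nonneg[of "m n \<omega>"]
            by (simp add: power2_eq_square)
          also have "\<dots> \<le> 2 * L * \<bar>\<Lambda>\<bar>" using s L by simp
          finally have 1: "\<bar>?g $ i * ?g $ k\<bar> \<le> 2 * L * \<bar>\<Lambda>\<bar>" .
          have 2: "\<bar>C n \<omega> $ i $ k\<bar> / spec_norm (C n \<omega>) \<le> 1"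
            using matrix_entry_le_spec_norm[of "C n \<omega>" i k] s by simp
          have "norm (W n i k \<omega>) = \<bar>?g $ i * ?g $ k\<bar> * (\<bar>C n \<omega> $ i $ k\<bar> / spec_norm (C n \<omega>))"
            using True s by (simp add: W_def abs_mult)
          also have "\<dots> \<le> 2 * L * \<bar>\<Lambda>\<bar> * 1" using 1 2 s by (intro mult_mono) auto
          finally show ?thesis by simp
        qed (use L in \<open>simp add: W_def\<close>)
      qed
    qed (rule measurable_from_past[OF W_past])
    have step: "(\<integral>\<omega>. f (Suc n) \<omega> \<partial>Pr) \<le> (1 - \<delta>) * (\<integral>\<omega>. f n \<omega> \<partial>Pr) + (D * prob S) * q ^ n" for n
    proof -
      let ?E = "\<lambda>i k. \<integral>\<omega>. W n i k \<omega> \<partial>Pr"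
      let ?R = "\<lambda>\<omega>. \<Sum>i\<in>UNIV. \<Sum>k\<in>UNIV. (\<rho> n \<omega> $ i * \<rho> n \<omega> $ k) * W n i k \<omega>"
      have R_int: "integrable Pr ?R"
        by (intro Bochner_Integration.integrable_sum mask_pair(1)[OF W_past W_int])
      have I_int: "integrable Pr (\<lambda>\<omega>. indicator S \<omega> * (D * q ^ n))"
        by (rule integrable_mult_left[OF S_int])
      have "(\<integral>\<omega>. f (Suc n) \<omega> \<partial>Pr) \<le> (\<integral>\<omega>. f n \<omega> + indicator S \<omega> * (D * q ^ n) - b * ?R \<omega> \<partial>Pr)"
      proof (rule integral_mono_AE)
        show "integrable Pr (\<lambda>\<omega>. f n \<omega> + indicator S \<omega> * (D * q ^ n) - b * ?R \<omega>)"
          by (intro Bochner_Integration.integrable_diff Bochner_Integration.integrable_add f_int I_int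
              integrable_mult_right R_int)
        show "AE \<omega> in Pr. f (Suc n) \<omega> \<le> f n \<omega> + indicator S \<omega> * (D * q ^ n) - b * ?R \<omega>"
          using ae
        proof eventually_elim
          case (elim \<omega>)
          show ?case
          proof (cases "\<omega> \<in> S")
            case True
            have "?R \<omega> = (norm (transpose (cols (drop_dev (\<rho> n \<omega>) (u n \<omega>))) *v g (m n \<omega>)))\<^sup>2 / spec_norm (C n \<omega>)"
              unfolding norm_drop_cols_transpose[OF J] using True
              by (simp add: W_def C_def sum_divide_distrib)
            moreover have "l (m (Suc n) \<omega>) \<le> l (m n \<omega>) + D * q ^ n
                - b * ((norm (transpose (cols (drop_dev (\<rho> n \<omega>) (u n \<omega>))) *v g (m n \<omega>)))\<^sup>2 / spec_norm (C n \<omega>))"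
              using elim True by blast
            ultimately show ?thesis using True by (simp add: f_def)
          qed (simp add: f_def W_def)
        qed
      qed (rule f_int)
      also have "\<dots> = (\<integral>\<omega>. f n \<omega> \<partial>Pr) + prob S * (D * q ^ n) - b * (\<integral>\<omega>. ?R \<omega> \<partial>Pr)"
        using f_int I_int R_int SPr
        by (simp add: Bochner_Integration.integral_diff Bochner_Integration.integral_add)
      also have "(\<integral>\<omega>. ?R \<omega> \<partial>Pr) = (\<Sum>i\<in>UNIV. \<Sum>k\<in>UNIV. (if i = k then lam else lam\<^sup>2) * ?E i k)"
        by (simp add: Bochner_Integration.integral_sum mask_pair[OF W_past W_int] Bochner_Integration.integrable_sum)
      also have "\<dots> = lam\<^sup>2 * (\<Sum>i\<in>UNIV. \<Sum>k\<in>UNIV. ?E i k) + (lam - lam\<^sup>2) * (\<Sum>i\<in>UNIV. ?E i i)"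
      proof -
        have "(if i = k then lam else lam\<^sup>2) * x = lam\<^sup>2 * x + (if i = k then (lam - lam\<^sup>2) * x else 0)" for i k :: 'n and x
          by (simp add: algebra_simps)
        then show ?thesis by (simp add: sum.distrib sum_distrib_left)
      qed
      finally have up: "(\<integral>\<omega>. f (Suc n) \<omega> \<partial>Pr) \<le> (\<integral>\<omega>. f n \<omega> \<partial>Pr) + prob S * (D * q ^ n)
          - b * (lam\<^sup>2 * (\<Sum>i\<in>UNIV. \<Sum>k\<in>UNIV. ?E i k) + (lam - lam\<^sup>2) * (\<Sum>i\<in>UNIV. ?E i i))" .
      \<comment> \<open>The full sum is the squared norm of the unmasked \<open>T\<^sup>T g\<close>, up to a
         factor.\<close>
      have "(\<Sum>i\<in>UNIV. \<Sum>k\<in>UNIV. ?E i k) = (\<integral>\<omega>. (\<Sum>i\<in>UNIV. \<Sum>k\<in>UNIV. W n i k \<omega>) \<partial>Pr)"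
        by (simp add: Bochner_Integration.integral_sum W_int Bochner_Integration.integrable_sum)
      also have "\<dots> \<ge> 0"
      proof (rule Bochner_Integration.integral_nonneg)
        fix \<omega>
        have "(\<Sum>i\<in>UNIV. \<Sum>k\<in>UNIV. W n i k \<omega>)
            = indicator S \<omega> * ((norm (transpose (cols (dev (u n \<omega>))) *v g (m n \<omega>)))\<^sup>2 / spec_norm (C n \<omega>))"
          unfolding norm_cols_transpose[OF J] by (simp add: W_def C_def sum_divide_distrib sum_distrib_left)
        then show "0 \<le> (\<Sum>i\<in>UNIV. \<Sum>k\<in>UNIV. W n i k \<omega>)" by (simp add: spec_norm_nonneg)
      qed
      finally have E1: "0 \<le> (\<Sum>i\<in>UNIV. \<Sum>k\<in>UNIV. ?E i k)" .
      have "c / \<kappa> * (\<integral>\<omega>. f n \<omega> \<partial>Pr) = (\<integral>\<omega>. c / \<kappa> * f n \<omega> \<partial>Pr)" by simp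
      also have "\<dots> \<le> (\<integral>\<omega>. (\<Sum>i\<in>UNIV. W n i i \<omega>) \<partial>Pr)"
      proof (rule integral_mono_AE)
        show "AE \<omega> in Pr. c / \<kappa> * f n \<omega> \<le> (\<Sum>i\<in>UNIV. W n i i \<omega>)"
          using ae
        proof eventually_elim
          case (elim \<omega>)
          show ?case
          proof (cases "\<omega> \<in> S")
            case True
            then have s: "0 < spec_norm (C n \<omega>)" "\<And>i. spec_norm (C n \<omega>) \<le> \<kappa> * C n \<omega> $ i $ i"
              using elim by blast+
            let ?g = "g (m n \<omega>)"
            have "c / \<kappa> * f n \<omega> = (c * (l (m n \<omega>) - lm)) / \<kappa>" using True by (simp add: f_def)
            also have "\<dots> \<le> (norm ?g)\<^sup>2 / \<kappa>" using PL(2)[of "m n \<omega>"] \<kappa> by (intro divide_right_mono) auto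
            also have "\<dots> = (\<Sum>i\<in>UNIV. ?g $ i * ?g $ i * (1 / \<kappa>))"
              by (simp add: power2_norm_eq_inner inner_vec_def sum_divide_distrib)
            also have "\<dots> \<le> (\<Sum>i\<in>UNIV. ?g $ i * ?g $ i * (C n \<omega> $ i $ i / spec_norm (C n \<omega>)))"
            proof (intro sum_mono mult_left_mono)
              fix i show "1 / \<kappa> \<le> C n \<omega> $ i $ i / spec_norm (C n \<omega>)"
                using s(1) s(2)[of i] \<kappa> by (simp add: field_simps)
            qed simp
            also have "\<dots> = (\<Sum>i\<in>UNIV. W n i i \<omega>)" using True by (simp add: W_def)
            finally show ?thesis .
          qed (simp add: f_def W_def)
        qed
        show "integrable Pr (\<lambda>\<omega>. c / \<kappa> * f n \<omega>)" by (intro integrable_mult_right f_int)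
        show "integrable Pr (\<lambda>\<omega>. \<Sum>i\<in>UNIV. W n i i \<omega>)" by (intro Bochner_Integration.integrable_sum W_int)
      qed
      also have "\<dots> = (\<Sum>i\<in>UNIV. ?E i i)" by (simp add: Bochner_Integration.integral_sum W_int)
      finally have E2: "c / \<kappa> * (\<integral>\<omega>. f n \<omega> \<partial>Pr) \<le> (\<Sum>i\<in>UNIV. ?E i i)" .
      have "b * ((lam - lam\<^sup>2) * (c / \<kappa> * (\<integral>\<omega>. f n \<omega> \<partial>Pr)))
          \<le> b * (lam\<^sup>2 * (\<Sum>i\<in>UNIV. \<Sum>k\<in>UNIV. ?E i k) + (lam - lam\<^sup>2) * (\<Sum>i\<in>UNIV. ?E i i))"
        using b E1 \<open>lam\<^sup>2 < lam\<close> mult_left_mono[OF E2, of "lam - lam\<^sup>2"]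
        by (intro mult_left_mono) (auto intro: add_increasing)
      then have "\<delta> * (\<integral>\<omega>. f n \<omega> \<partial>Pr)
          \<le> b * (lam\<^sup>2 * (\<Sum>i\<in>UNIV. \<Sum>k\<in>UNIV. ?E i k) + (lam - lam\<^sup>2) * (\<Sum>i\<in>UNIV. ?E i i))"
        by (simp only: \<delta>_def mult.assoc)
      moreover have "(1 - \<delta>) * (\<integral>\<omega>. f n \<omega> \<partial>Pr) = (\<integral>\<omega>. f n \<omega> \<partial>Pr) - \<delta> * (\<integral>\<omega>. f n \<omega> \<partial>Pr)"
        "(D * prob S) * q ^ n = prob S * (D * q ^ n)" by (simp_all add: algebra_simps)
      ultimately show ?thesis using up by linarith
    qed
    have f_nonneg: "0 \<le> (\<integral>\<omega>. f n \<omega> \<partial>Pr)" for n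
      using lm by (intro Bochner_Integration.integral_nonneg) (simp add: f_def)
    have "(\<integral>\<omega>. f n \<omega> \<partial>Pr) \<le> t ^ n * ((\<integral>\<omega>. f 0 \<omega> \<partial>Pr) + (D * prob S) / (t - q))"
      using q D t by (intro perturbed_contraction[where b = \<delta>] f_nonneg step) auto
    also have "(\<integral>\<omega>. f 0 \<omega> \<partial>Pr) + (D * prob S) / (t - q) = (\<integral>\<omega>. indicator S \<omega> * (l (m 0 \<omega>) - lm + D / (t - q)) \<partial>Pr)"
    proof -
      have "(\<integral>\<omega>. indicator S \<omega> * (l (m 0 \<omega>) - lm + D / (t - q)) \<partial>Pr)
          = (\<integral>\<omega>. f 0 \<omega> + indicator S \<omega> * (D / (t - q)) \<partial>Pr)"
        by (simp add: f_def distrib_left)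
      also have "\<dots> = (\<integral>\<omega>. f 0 \<omega> \<partial>Pr) + (\<integral>\<omega>. indicator S \<omega> * (D / (t - q)) \<partial>Pr)"
        by (intro Bochner_Integration.integral_add f_int integrable_mult_left S_int)
      finally show ?thesis using SPr by (simp add: mult.commute)
    qed
    finally show ?thesis using f_int[of n] unfolding f_def m_def by simp
  qed
  then show ?thesis using t by (intro exI[of _ "1 - t"] exI[of _ "D / (t - q)"]) auto
qed

text \<open>Validity of the integrated bound on all events in the initial sigma-algebra is the conditional
bound.\<close>

lemma conditional_decay:
  assumes N: "0 < N"
  shows "\<exists>\<beta> C. 0 < \<beta> \<and> \<beta> < 1 \<and> (AE \<omega> in Pr. well_spread N (u 0 \<omega>) \<longrightarrow> (\<forall>n.
    real_cond_exp Pr initial_algebra (\<lambda>\<omega>. l (ens_mean (u n \<omega>))) \<omega> - lm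
      \<le> (1 - \<beta>) ^ n * (l (ens_mean (u 0 \<omega>)) - lm + C)))"
proof -
  obtain \<beta> C where \<beta>: "0 < \<beta>" "\<beta> < 1" and ex: "\<forall>S\<in>sets initial_algebra. S \<subseteq> {\<omega> \<in> space Pr. well_spread N (u 0 \<omega>)} \<longrightarrow> (\<forall>n.
    integrable Pr (\<lambda>\<omega>. indicator S \<omega> * (l (ens_mean (u n \<omega>)) - lm)) \<and>
    (\<integral>\<omega>. indicator S \<omega> * (l (ens_mean (u n \<omega>)) - lm) \<partial>Pr)
      \<le> (1 - \<beta>) ^ n * (\<integral>\<omega>. indicator S \<omega> * (l (ens_mean (u 0 \<omega>)) - lm + C) \<partial>Pr))"
    using localized_decay[OF N] by (elim exE conjE) (rule that)
  have decay: "integrable Pr (\<lambda>\<omega>. indicator S \<omega> * (l (ens_mean (u n \<omega>)) - lm))"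
    "(\<integral>\<omega>. indicator S \<omega> * (l (ens_mean (u n \<omega>)) - lm) \<partial>Pr)
      \<le> (1 - \<beta>) ^ n * (\<integral>\<omega>. indicator S \<omega> * (l (ens_mean (u 0 \<omega>)) - lm + C) \<partial>Pr)"
    if "S \<in> sets initial_algebra" "S \<subseteq> {\<omega> \<in> space Pr. well_spread N (u 0 \<omega>)}" for S n
    using ex[rule_format, OF that, of n] by blast+
  interpret I: sigma_finite_subalgebra Pr initial_algebra
    by (intro finite_measure_subalgebra_is_sigma_finite finite_measure_subalgebra.intro
        finite_measure_subalgebra_axioms.intro subalgebra_initial finite_measure_axioms)
  let ?A = "{\<omega> \<in> space Pr. well_spread N (u 0 \<omega>)}"
  let ?l = "\<lambda>n \<omega>. l (ens_mean (u n \<omega>))"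
  have l0: "?l 0 \<in> borel_measurable initial_algebra"
    by (intro borel_measurable_continuous_on[OF l_cont] borel_measurable_ens_mean u0_measurable_initial)
  have "AE \<omega> in Pr. \<omega> \<in> ?A \<longrightarrow> real_cond_exp Pr initial_algebra (?l n) \<omega> \<le> lm + (1 - \<beta>) ^ n * (?l 0 \<omega> - lm + C)" for n
  proof (rule I.real_cond_exp_leI[OF well_spread_measurable measurable_from_past[OF l_measurable_past]])
    show "(\<lambda>\<omega>. lm + (1 - \<beta>) ^ n * (?l 0 \<omega> - lm + C)) \<in> borel_measurable initial_algebra"
      using l0 by measurable
    fix S assume S: "S \<in> sets initial_algebra" "S \<subseteq> ?A"
    have SPr: "S \<in> sets Pr" using S(1) subalgebra_initial by (auto simp: subalgebra_def)
    have iS: "integrable Pr (\<lambda>\<omega>. indicator S \<omega> * x)" for x :: real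
      using SPr by (intro integrable_mult_left integrable_real_indicator) (simp_all add: emeasure_eq_measure)
    have il: "integrable Pr (\<lambda>\<omega>. indicator S \<omega> * (?l n \<omega> - lm))" for n
      by (rule decay(1)[OF S])
    have "integrable Pr (\<lambda>\<omega>. indicator S \<omega> * (?l n \<omega> - lm) + indicator S \<omega> * lm)"
      by (intro Bochner_Integration.integrable_add il iS)
    then show "integrable Pr (\<lambda>\<omega>. indicator S \<omega> * ?l n \<omega>)" by (simp add: algebra_simps)
    have i0: "integrable Pr (\<lambda>\<omega>. indicator S \<omega> * (?l 0 \<omega> - lm + C))"
      using Bochner_Integration.integrable_add[OF il[of 0] iS[of C]] by (simp add: algebra_simps)
    have eq: "indicator S \<omega> * (lm + (1 - \<beta>) ^ n * (?l 0 \<omega> - lm + C))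
        = indicator S \<omega> * lm + (1 - \<beta>) ^ n * (indicator S \<omega> * (?l 0 \<omega> - lm + C))" for \<omega>
      by (simp add: distrib_left mult.left_commute)
    show "integrable Pr (\<lambda>\<omega>. indicator S \<omega> * (lm + (1 - \<beta>) ^ n * (?l 0 \<omega> - lm + C)))"
      unfolding eq by (intro Bochner_Integration.integrable_add iS integrable_mult_right i0)
    have "(\<integral>\<omega>. indicator S \<omega> * ?l n \<omega> \<partial>Pr)
        = (\<integral>\<omega>. indicator S \<omega> * lm + indicator S \<omega> * (?l n \<omega> - lm) \<partial>Pr)"
      by (simp add: algebra_simps)
    also have "\<dots> = (\<integral>\<omega>. indicator S \<omega> * lm \<partial>Pr) + (\<integral>\<omega>. indicator S \<omega> * (?l n \<omega> - lm) \<partial>Pr)"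
      by (intro Bochner_Integration.integral_add iS il)
    also have "\<dots> \<le> (\<integral>\<omega>. indicator S \<omega> * lm \<partial>Pr)
        + (1 - \<beta>) ^ n * (\<integral>\<omega>. indicator S \<omega> * (?l 0 \<omega> - lm + C) \<partial>Pr)"
      by (intro add_left_mono decay(2)[OF S])
    also have "\<dots> = (\<integral>\<omega>. indicator S \<omega> * (lm + (1 - \<beta>) ^ n * (?l 0 \<omega> - lm + C)) \<partial>Pr)"
      unfolding eq by (subst Bochner_Integration.integral_add[OF iS integrable_mult_right[OF i0]]) simp
    finally show "(\<integral>\<omega>. indicator S \<omega> * ?l n \<omega> \<partial>Pr)
        \<le> (\<integral>\<omega>. indicator S \<omega> * (lm + (1 - \<beta>) ^ n * (?l 0 \<omega> - lm + C)) \<partial>Pr)" .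
  qed
  then have ae: "AE \<omega> in Pr. \<forall>n. \<omega> \<in> ?A \<longrightarrow> real_cond_exp Pr initial_algebra (?l n) \<omega> \<le> lm + (1 - \<beta>) ^ n * (?l 0 \<omega> - lm + C)"
    unfolding AE_all_countable by blast
  have "AE \<omega> in Pr. \<omega> \<in> space Pr" by (rule AE_space)
  with ae have "AE \<omega> in Pr. well_spread N (u 0 \<omega>) \<longrightarrow>
      (\<forall>n. real_cond_exp Pr initial_algebra (?l n) \<omega> - lm \<le> (1 - \<beta>) ^ n * (?l 0 \<omega> - lm + C))"
  proof eventually_elim
    case (elim \<omega>)
    show ?case
    proof (intro impI allI)
      fix n assume "well_spread N (u 0 \<omega>)"
      then have "real_cond_exp Pr initial_algebra (?l n) \<omega> \<le> lm + (1 - \<beta>) ^ n * (?l 0 \<omega> - lm + C)"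
        using elim by blast
      then show "real_cond_exp Pr initial_algebra (?l n) \<omega> - lm \<le> (1 - \<beta>) ^ n * (?l 0 \<omega> - lm + C)" by simp
    qed
  qed
  with \<beta> show ?thesis by blast
qed

text \<open>The events indexed by \<open>N\<close> cover almost all outcomes; the constants for an ensemble
are those of the first event that contains it.\<close>

theorem linear_convergence:
  "\<exists>(\<beta> :: ('j \<Rightarrow> real^'n) \<Rightarrow> real) (C :: ('j \<Rightarrow> real^'n) \<Rightarrow> real). (\<forall>e. 0 < \<beta> e \<and> \<beta> e < 1) \<and>
    (AE \<omega> in Pr. \<forall>n. real_cond_exp Pr (deki_filt Pr (u 0) \<rho> 0) (\<lambda>\<omega>. l (ens_mean (u n \<omega>))) \<omega> - lm
      \<le> (1 - \<beta> (u 0 \<omega>)) ^ n * (l (ens_mean (u 0 \<omega>)) - lm + C (u 0 \<omega>)))"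
proof -
  let ?l = "\<lambda>n \<omega>. l (ens_mean (u n \<omega>))"
  have "\<forall>k. \<exists>\<beta> C. 0 < \<beta> \<and> \<beta> < 1 \<and> (AE \<omega> in Pr. well_spread (real (Suc k)) (u 0 \<omega>) \<longrightarrow>
      (\<forall>n. real_cond_exp Pr initial_algebra (?l n) \<omega> - lm \<le> (1 - \<beta>) ^ n * (?l 0 \<omega> - lm + C)))"
    by (intro allI conditional_decay) simp
  then have "\<exists>\<beta> C. \<forall>k. 0 < \<beta> k \<and> \<beta> k < 1 \<and> (AE \<omega> in Pr. well_spread (real (Suc k)) (u 0 \<omega>) \<longrightarrow>
      (\<forall>n. real_cond_exp Pr initial_algebra (?l n) \<omega> - lm \<le> (1 - \<beta> k) ^ n * (?l 0 \<omega> - lm + C k)))"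
    unfolding choice_iff .
  then obtain \<beta> C where \<beta>: "\<And>k :: nat. 0 < \<beta> k \<and> \<beta> k < 1"
    and ae: "\<And>k. AE \<omega> in Pr. well_spread (real (Suc k)) (u 0 \<omega>) \<longrightarrow>
      (\<forall>n. real_cond_exp Pr initial_algebra (?l n) \<omega> - lm \<le> (1 - \<beta> k) ^ n * (?l 0 \<omega> - lm + C k))"
    by blast
  define idx where "idx e = (LEAST k. well_spread (real (Suc k)) e)" for e
  have "AE \<omega> in Pr. \<forall>k. well_spread (real (Suc k)) (u 0 \<omega>) \<longrightarrow>
      (\<forall>n. real_cond_exp Pr initial_algebra (?l n) \<omega> - lm \<le> (1 - \<beta> k) ^ n * (?l 0 \<omega> - lm + C k))"
    unfolding AE_all_countable using ae by blast
  with AE_well_spread have "AE \<omega> in Pr. \<forall>n. real_cond_exp Pr initial_algebra (?l n) \<omega> - lm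
      \<le> (1 - \<beta> (idx (u 0 \<omega>))) ^ n * (?l 0 \<omega> - lm + C (idx (u 0 \<omega>)))"
  proof eventually_elim
    case (elim \<omega>)
    have "well_spread (real (Suc (idx (u 0 \<omega>)))) (u 0 \<omega>)" unfolding idx_def by (rule LeastI_ex[OF elim(1)])
    then show ?case using elim(2) by blast
  qed
  with \<beta> show ?thesis
    unfolding initial_algebra_def
    by (intro exI[of _ "\<lambda>e. \<beta> (idx e)"] exI[of _ "\<lambda>e. C (idx e)"]) simp
qed

end

section \<open>Linear convergence\<close>

theorem theorem3p7:
  fixes \<G> :: "real^'u \<Rightarrow> real^'y" and y :: "real^'y" and C0 :: "real^'u^'u"
    and MG lam Hb \<gamma> M L c \<theta> \<mu> :: real
    and Pr :: "'w measure"
    and \<rho> :: "nat \<Rightarrow> 'w \<Rightarrow> real^'u"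
    and u :: "nat \<Rightarrow> 'w \<Rightarrow> 'j::finite \<Rightarrow> real^'u"
    and Gn :: "nat \<Rightarrow> 'w \<Rightarrow> real^'u^'y"
    and Hn :: "nat \<Rightarrow> 'w \<Rightarrow> real^'u^('y + 'u)"
    and h h' :: "nat \<Rightarrow> 'w \<Rightarrow> real"
  assumes J: "CARD('j) \<ge> 2"
    and C0: "pos_def C0"
    and lam: "0 < lam" "lam < 1"
    and noise: "deki_noise Pr lam (u 0) \<rho>"
    and Gn: "\<And>n \<omega>. \<omega> \<in> space Pr \<Longrightarrow> is_lin_block \<G> C0 MG (u n \<omega>) (Gn n \<omega>)"
    and Hn: "\<And>n \<omega>. \<omega> \<in> space Pr \<Longrightarrow> Hn n \<omega> = stack (Gn n \<omega>) (inv_sqrt C0)"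
    and iter: "\<And>n \<omega> j. \<omega> \<in> space Pr \<Longrightarrow>
        u (Suc n) \<omega> j = mean_step (reg_map \<G> C0) (reg_data y) (h' n \<omega>) (\<rho> n \<omega>) (u n \<omega>)
                        + dev_step (Hn n \<omega>) (h n \<omega>) (u n \<omega>) j"
    and h: "\<And>n \<omega>. \<omega> \<in> space Pr \<Longrightarrow> h n \<omega> = \<theta> * inverse (spec_norm (C_uu (u n \<omega>)))"
    and h': "\<And>n \<omega>. \<omega> \<in> space Pr \<Longrightarrow> h' n \<omega> = \<mu> * inverse (spec_norm (C_uu (u n \<omega>)))"
    and C2: "\<And>s. C2_fun (\<lambda>v. reg_map \<G> C0 v $ s)"
    and Hb: "Hb > 0"
      "\<And>v. sqrt (\<Sum>s\<in>UNIV. (spec_norm (hessian (\<lambda>w. reg_map \<G> C0 w $ s) v))\<^sup>2) \<le> Hb"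
    and Hn_bounds: "0 < \<gamma>" "\<gamma> \<le> M"
      "AE \<omega> in Pr. \<forall>n. \<gamma>\<^sup>2 *\<^sub>R mat 1 \<preceq> transpose (Hn n \<omega>) ** Hn n \<omega> \<and>
                       transpose (Hn n \<omega>) ** Hn n \<omega> \<preceq> M\<^sup>2 *\<^sub>R mat 1"
    and L_smooth: "L > 0"
      "\<And>v w. norm (gradient (loss \<G> C0 y) v - gradient (loss \<G> C0 y) w) \<le> L * norm (v - w)"
    and PL: "c > 0"
      "\<And>v. (norm (gradient (loss \<G> C0 y) v))\<^sup>2 \<ge> c * (loss \<G> C0 y v - loss_min \<G> C0 y)"
    and \<theta>: "0 < \<theta>" "\<theta> \<le> inverse (M\<^sup>2)"
    and \<mu>: "0 < \<mu>" "\<mu> \<le> inverse L"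
  shows "\<exists>(n0 :: ('j \<Rightarrow> real^'u) \<Rightarrow> nat) (\<beta> :: ('j \<Rightarrow> real^'u) \<Rightarrow> real) (C\<^sub>2 :: ('j \<Rightarrow> real^'u) \<Rightarrow> real).
    (\<forall>e. 0 < \<beta> e \<and> \<beta> e < 1) \<and>
    (AE \<omega> in Pr. \<forall>n > n0 (u 0 \<omega>).
       real_cond_exp Pr (deki_filt Pr (u 0) \<rho> (n0 (u 0 \<omega>))) (\<lambda>\<omega>'. loss \<G> C0 y (ens_mean (u n \<omega>'))) \<omega>
         - loss_min \<G> C0 y
       \<le> (1 - \<beta> (u 0 \<omega>)) ^ (n - n0 (u 0 \<omega>)) *
          (loss \<G> C0 y (ens_mean (u (n0 (u 0 \<omega>)) \<omega>)) - loss_min \<G> C0 y + C\<^sub>2 (u 0 \<omega>)))"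
proof -
  let ?F = "reg_map \<G> C0" and ?l = "loss \<G> C0 y" and ?lm = "loss_min \<G> C0 y"
  let ?g = "\<lambda>v. - (transpose (jac ?F v) *v (reg_data y - ?F v))"
  \<comment> \<open>The Taylor remainder is estimated by the sum of its components, hence the dimension
     factor.\<close>
  let ?K = "real CARD('y + 'u) * (Hb / 2)"
  have F_diff: "(\<lambda>v. ?F v $ s) differentiable (at x)" for s x
    using C2[of s] by (simp add: C2_fun_def)
  have l_deriv: "(?l has_derivative (\<lambda>h. h \<bullet> ?g v)) (at v)" for v
    using has_derivative_least_squares[OF F_diff, of "reg_data y" v] by (simp add: loss_def[abs_def])
  then have grad: "gradient ?l v = ?g v" for v by (rule gradient_eqI)
  have lip: "norm (?g v - ?g w) \<le> L * norm (v - w)" for v w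
    using L_smooth(2)[of v w] by (simp only: grad)
  have hess: "spec_norm (hessian (\<lambda>w. ?F w $ s) v) \<le> Hb" for s v
  proof -
    let ?x = "\<lambda>s. spec_norm (hessian (\<lambda>w. ?F w $ s) v)"
    have "(?x s)\<^sup>2 \<le> (\<Sum>s\<in>UNIV. (?x s)\<^sup>2)" by (rule member_le_sum) auto
    then have "?x s \<le> sqrt (\<Sum>s\<in>UNIV. (?x s)\<^sup>2)" by (rule real_le_rsqrt)
    also have "\<dots> \<le> Hb" by (rule Hb(2))
    finally show ?thesis .
  qed
  have bdd: "bdd_below (range ?l)" by (rule bdd_belowI[of _ 0]) (auto simp: loss_def)
  have "0 < M" using Hn_bounds(1,2) by simp
  have F_cont: "continuous_on UNIV ?F"
    by (rule has_derivative_continuous_on) (use has_derivative_jac[OF F_diff] in auto)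
  have g_cont: "continuous_on UNIV ?g"
  proof (rule lipschitz_on_continuous_on[of L], rule lipschitz_onI)
    show "dist (?g v) (?g w) \<le> L * dist v w" for v w unfolding dist_norm by (rule lip)
  qed (use L_smooth(1) in simp)
  have l_cont: "continuous_on UNIV ?l"
    by (rule has_derivative_continuous_on) (use l_deriv in auto)
  interpret prob_space Pr using noise by (simp add: deki_noise_def)
  note l_eq = loss_def[symmetric]
  have process: "deki_process ?F (reg_data y) ?K L (jac ?F) Pr u \<rho> Hn h h' lam \<gamma> M c \<theta> \<mu> ?lm"
  proof unfold_locales
    show "0 \<le> ?K" using Hb(1) by simp
    show "norm (?F (v + d) - ?F v - jac ?F v *v d) \<le> ?K * (norm d)\<^sup>2" for v d
      by (rule quadratic_taylor_bound_vec[OF C2 hess])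
    show "1 / 2 * (norm (reg_data y - ?F (v + d)))\<^sup>2
        \<le> 1 / 2 * (norm (reg_data y - ?F v))\<^sup>2 + ?g v \<bullet> d + L / 2 * (norm d)\<^sup>2" for v d
      unfolding l_eq by (rule descent_inequality[OF l_deriv lip])
    show "?lm \<le> 1 / 2 * (norm (reg_data y - ?F v))\<^sup>2" for v
      unfolding l_eq loss_min_def by (rule cINF_lower[OF bdd]) simp
    show "c * (1 / 2 * (norm (reg_data y - ?F v))\<^sup>2 - ?lm) \<le> (norm (?g v))\<^sup>2" for v
      unfolding l_eq using PL(2)[of v] by (simp only: grad)
    show "continuous_on UNIV (\<lambda>v. 1 / 2 * (norm (reg_data y - ?F v))\<^sup>2)"
      unfolding l_eq by (rule l_cont)
    show "indep_vars (\<lambda>_. borel) (noise (u 0) \<rho>) UNIV"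
      using noise unfolding deki_noise_def noise_def[abs_def] by blast
    show "distributed Pr lborel (\<lambda>\<omega>. u 0 \<omega> j $ k) std_normal_density" for j k
      using noise by (simp add: deki_noise_def)
    show "prob {\<omega> \<in> space Pr. \<rho> n \<omega> $ k = 1} = lam" "prob {\<omega> \<in> space Pr. \<rho> n \<omega> $ k = 0} = 1 - lam" for n k
      using noise by (simp_all add: deki_noise_def)
    show "u (Suc n) \<omega> = (\<lambda>j. mean_step ?F (reg_data y) (h' n \<omega>) (\<rho> n \<omega>) (u n \<omega>)
        + dev_step (Hn n \<omega>) (h n \<omega>) (u n \<omega>) j)" if "\<omega> \<in> space Pr" for n \<omega>
      using iter[OF that] by blast
    show "Hn n \<in> borel_measurable N"
      if N: "space N = space Pr" and un: "\<And>j. (\<lambda>\<omega>. u n \<omega> j) \<in> borel_measurable N" for n N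
    proof -
      have "Gn n \<in> borel_measurable N"
        by (rule borel_measurable_lin_block[where e = "u n" and MG = MG, OF J un F_cont]) (simp add: N Gn)
      then have "(\<lambda>\<omega>. stack (Gn n \<omega>) (inv_sqrt C0)) \<in> borel_measurable N"
        by (rule borel_measurable_stack)
      then show ?thesis by (subst measurable_cong[of N _ "\<lambda>\<omega>. stack (Gn n \<omega>) (inv_sqrt C0)"]) (auto simp: N Hn)
    qed
    show "AE \<omega> in Pr. \<forall>n x. \<gamma>\<^sup>2 * (norm x)\<^sup>2 \<le> (norm (Hn n \<omega> *v x))\<^sup>2 \<and> norm (Hn n \<omega> *v x) \<le> M * norm x"
      using Hn_bounds(3)
    proof eventually_elim
      case (elim \<omega>)
      then show ?case using loewner_ge_norm loewner_le_norm \<open>0 < M\<close> by (meson less_imp_le)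
    qed
    show "\<theta> * M\<^sup>2 \<le> 1" using \<theta> \<open>0 < M\<close> by (simp add: field_simps)
    show "\<mu> * L \<le> 1" using \<mu> L_smooth(1) by (simp add: field_simps)
  qed (use J h h' Hn_bounds L_smooth \<theta> \<mu> lam PL \<open>0 < M\<close> F_cont g_cont in auto)
  obtain \<beta> C :: "('j \<Rightarrow> real^'u) \<Rightarrow> real" where \<beta>: "\<forall>e. 0 < \<beta> e \<and> \<beta> e < 1"
    and ae: "AE \<omega> in Pr. \<forall>n. real_cond_exp Pr (deki_filt Pr (u 0) \<rho> 0) (\<lambda>\<omega>. ?l (ens_mean (u n \<omega>))) \<omega> - ?lm
      \<le> (1 - \<beta> (u 0 \<omega>)) ^ n * (?l (ens_mean (u 0 \<omega>)) - ?lm + C (u 0 \<omega>))"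
    using deki_process.linear_convergence[OF process] unfolding l_eq by (elim exE conjE) (rule that)
  \<comment> \<open>The conditioning starts at step zero: the transient is already absorbed in the additive
     constant.\<close>
  have "AE \<omega> in Pr. \<forall>n > 0. real_cond_exp Pr (deki_filt Pr (u 0) \<rho> 0) (\<lambda>\<omega>. ?l (ens_mean (u n \<omega>))) \<omega> - ?lm
      \<le> (1 - \<beta> (u 0 \<omega>)) ^ (n - 0) * (?l (ens_mean (u 0 \<omega>)) - ?lm + C (u 0 \<omega>))"
    using ae by eventually_elim simp
  with \<beta> show ?thesis
    by - (rule exI[of _ "\<lambda>_. 0"], rule exI[of _ \<beta>], rule exI[of _ C], rule conjI)
qed

end
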